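(* For each $\beta\in(0,1)$, let $m=m_n$, $k_1=k_{1,n}$, $k_2=k_{2,n}$ be sequences of positive integers with $k_1\le m$, $k_2\le n$ and $\frac{m}{n}\to1$, $\frac{k_1}{n}\to\beta$, $\frac{k_2}{n}\to\beta$ as $n\to\infty$. Let $A\in\mathbb{R}^{m\times n}$ have independent standard normal entries, let $\xi$ be its largest average $k_1\times k_2$ submatrix value, and let $L^{(2)}$ be the lifted random dual defined in the context. Then, as $\beta\to0^+$, $$\lim_{\beta\to0^+}\ \frac{\lim_{n\to\infty}\sqrt{n}\,L^{(2)}}{2\sqrt{\frac1\beta\log\left(\frac1\beta\right)}}=1,$$ and, for every $\beta\in(0,1)$, $\limsup_{n\to\infty}\sqrt{n}\,\mathbb{E}\,\xi\le\lim_{n\to\infty}\sqrt{n}\,L^{(2)}$; consequently $$\limsup_{\beta\to0^+}\ \frac{\limsup_{n\to\infty}\sqrt{n}\,\mathbb{E}\,\xi}{2\sqrt{\frac1\beta\log\left(\frac1\beta\right)}}\le1 .$$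
   Context: For $A\in\mathbb{R}^{m\times n}$, the largest average $k_1\times k_2$ submatrix value is $$\xi=\frac{1}{k_1k_2}\max_{\substack{I_1\subset\{1,\dots,m\},\ |I_1|=k_1\\ I_2\subset\{1,\dots,n\},\ |I_2|=k_2}}\ \sum_{i\in I_1,\,j\in I_2}A_{ij}.$$ Set $\mathcal{S}_{\mathbf{x}}=\{\mathbf{x}\in\mathbb{R}^n:\ \mathbf{x}_i\in\{0,1/\sqrt{k_2}\}\text{ for all }i,\ \sum_{i=1}^n\mathbf{x}_i=\sqrt{k_2}\}$ and $\mathcal{S}_{\mathbf{y}}=\{\mathbf{y}\in\mathbb{R}^m:\ \mathbf{y}_i\in\{0,1/\sqrt{k_1}\}\text{ for all }i,\ \sum_{i=1}^m\mathbf{y}_i=\sqrt{k_1}\}$. With $\mathbf{h}\in\mathbb{R}^m$, $\mathbf{g}\in\mathbb{R}^n$ independent vectors with independent standard normal entries, the (deterministic) lifted random dual is $$L^{(2)}=\frac{1}{\sqrt{k_1k_2}}\ \inf_{c_3>0}\left(-\frac{c_3}{2}+\frac{1}{c_3}\log\left(\mathbb{E}\,e^{c_3\max_{\mathbf{y}\in\mathcal{S}_{\mathbf{y}}}\mathbf{h}^T\mathbf{y}}\right)+\frac{1}{c_3}\log\left(\mathbb{E}\,e^{c_3\max_{\mathbf{x}\in\mathcal{S}_{\mathbf{x}}}\mathbf{g}^T\mathbf{x}}\right)\right).$$ The limit in $n$ is taken first, for fixed $\beta$, and then $\beta\to0^+$. *)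

theory Defs
  imports "HOL-Probability.Probability"
begin

text \<open>
  Vectors in \<open>\<real>\<^sup>n\<close> are functions on the index set \<open>{1..n}\<close>, and \<open>m \<times> n\<close> matrices are functions
  of two indices that are only inspected on \<open>{1..m} \<times> {1..n}\<close>, because the dimensions vary
  along a sequence.
\<close>

definition largest_avg_submatrix ::
    "nat \<Rightarrow> nat \<Rightarrow> nat \<Rightarrow> nat \<Rightarrow> (nat \<Rightarrow> nat \<Rightarrow> real) \<Rightarrow> real" where
  "largest_avg_submatrix m n k1 k2 A =
     1 / (real k1 * real k2) *
     Max ((\<lambda>(I1, I2). \<Sum>i\<in>I1. \<Sum>j\<in>I2. A i j) `
          ({I1. I1 \<subseteq> {1..m} \<and> card I1 = k1} \<times> {I2. I2 \<subseteq> {1..n} \<and> card I2 = k2}))"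

text \<open>
  The set \<open>S\<^sub>x\<close> is \<open>sel_set n k2\<close> and \<open>S\<^sub>y\<close> is \<open>sel_set m k1\<close>.  The extensional function space
  fixes the irrelevant values outside \<open>{1..n}\<close>, so that these sets are finite.
\<close>

definition sel_set :: "nat \<Rightarrow> nat \<Rightarrow> (nat \<Rightarrow> real) set" where
  "sel_set n k =
     {x \<in> {1..n} \<rightarrow>\<^sub>E {0, 1 / sqrt (real k)}. (\<Sum>i=1..n. x i) = sqrt (real k)}"

text \<open>The law of a vector in \<open>\<real>\<^sup>n\<close> with independent standard normal entries.\<close>

definition std_gauss_vec :: "nat \<Rightarrow> (nat \<Rightarrow> real) measure" where
  "std_gauss_vec n = (\<Pi>\<^sub>M i\<in>{1..n}. density lborel (\<lambda>x. ennreal (std_normal_density x)))"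

text \<open>
  The vectors \<open>h\<close> and \<open>g\<close> only occur in separate expectations, so only their marginal laws
  enter.  The objective is nonnegative for \<open>0 < c\<close>: every vector in \<open>sel_set n k\<close> is a unit
  vector, so each logarithmic term is at least \<open>c / 2\<close>.  Hence the real-valued infimum is genuine.
\<close>

definition lifted_dual :: "nat \<Rightarrow> nat \<Rightarrow> nat \<Rightarrow> nat \<Rightarrow> real" where
  "lifted_dual m n k1 k2 =
     1 / sqrt (real k1 * real k2) *
     (INF c\<in>{0<..}.
        - c / 2
        + 1 / c * ln (\<integral>h. exp (c * Max ((\<lambda>y. \<Sum>i=1..m. h i * y i) ` sel_set m k1))
                        \<partial>std_gauss_vec m)
        + 1 / c * ln (\<integral>g. exp (c * Max ((\<lambda>x. \<Sum>i=1..n. g i * x i) ` sel_set n k2))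
                        \<partial>std_gauss_vec n))"

end

theory Submission
  imports Defs "HOL-Real_Asymp.Real_Asymp"
begin

text \<open>
  The bound on the mean is a Gaussian comparison.  On \<open>S\<^sub>y \<times> S\<^sub>x\<close> the processes \<open>y\<^sup>T A x + g\<^sub>0\<close> and
  \<open>h\<^sup>T y + g\<^sup>T x\<close> have equal variances, and the first has the larger covariances because
  \<open>(1 - \<langle>y, y'\<rangle>) (1 - \<langle>x, x'\<rangle>) \<ge> 0\<close>.  Interpolating between them along \<open>cos t\<close>, \<open>sin t\<close> and integrating by
  parts shows that the expectation of \<open>(\<Sum> exp (p z))\<^bsup>c/p\<^esup>\<close> increases; letting \<open>p \<rightarrow> \<infinity>\<close> and using
  Jensen's inequality bounds the mean of the maximum by the dual objective at every \<open>c\<close>.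

  For the limit of the dual, the sum of the \<open>k\<close> largest entries is at most
  \<open>k l + \<Sum> (g\<^sub>i - l)\<^sup>+\<close> for every threshold \<open>l\<close>, which bounds the logarithmic moment by one-dimensional
  quantities.  The bound is sharp on the exponential scale: tilt the Gaussian law by \<open>exp (a (x - l)\<^sup>+)\<close>,
  choose \<open>l\<close> such that the tilted law gives mass \<open>\<beta>\<close> to \<open>(l, \<infinity>)\<close>, and use Jensen's inequality under the
  tilted law.  As \<open>\<beta> \<rightarrow> 0\<close> the one-dimensional limit behaves like \<open>c\<^sup>2/2 + \<beta> log (1/\<beta>)\<close>, and minimising
  \<open>c/2 + 2 \<beta> log (1/\<beta>) / c\<close> gives the constant.
\<close>

section \<open>Gaussian integrals and integration by parts\<close>

text \<open>An exponent \<open>c / p\<close> below 1 fixes the sign in the comparison: equal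
  variances remove the first-order part of the derivative, and the second-order part carries the
  factor \<open>c / p - 1\<close>. The dual parameter lives on the scale \<open>sqrt n\<close>.
  After rescaling, the logarithmic terms are only known to converge for each fixed \<open>c\<close>,
  so exchanging limit and infimum needs an extra argument; it rests on the fact that a logarithmic
  moment divided by \<open>c\<close> increases with \<open>c\<close>. No concentration inequality
  enters. The number of entries above the threshold is controlled by its variance alone, through a
  weighted product inequality whose weight tends to infinity after \<open>n\<close> does. For small
  \<open>b\<close>, with \<open>L = ln (1 / b)\<close>, the two-term lower bound for the limit is
  available only for \<open>c\<close> at least \<open>sqrt (2 * b * L)\<close>. This range contains
  the approximate minimiser \<open>2 * sqrt (b * L)\<close>. For smaller \<open>c\<close> the mean
  of the maximum, about \<open>sqrt (2 * b * L)\<close>, suffices: it keeps the objective above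
  about \<open>3 / sqrt 2 * sqrt (b * L)\<close>, and \<open>3 / sqrt 2 > 2\<close>.\<close>

abbreviation gauss_PiM :: "'i set \<Rightarrow> ('i \<Rightarrow> real) measure" where
  "gauss_PiM I \<equiv> Pi\<^sub>M I (\<lambda>_. std_normal_distribution)"

interpretation std_normal: prob_space std_normal_distribution
  using real_dist_normal_dist by (simp add: real_distribution_def)

interpretation std_normal_PiM: product_sigma_finite "\<lambda>_. std_normal_distribution"
  by (simp add: product_sigma_finite_def std_normal.sigma_finite_measure_axioms)

interpretation std_normal_PiM_prob: prob_space "gauss_PiM I" for I
  by (rule prob_space_PiM) unfold_locales

lemma std_normal_density_shift:
  "std_normal_density (x + t) * exp (t * (x + t)) = exp (t\<^sup>2 / 2) * std_normal_density x"
proof -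
  have "- (x + t)\<^sup>2 / 2 + t * (x + t) = t\<^sup>2 / 2 + - x\<^sup>2 / 2"
    by (simp add: power2_eq_square algebra_simps add_divide_distrib diff_divide_distrib)
  then show ?thesis
    unfolding std_normal_density_def by (simp flip: exp_add add: mult.assoc mult.left_commute)
qed

text \<open>One-dimensional Cameron-Martin formula: an exponential tilt of the Gaussian law is a
  translation by \<open>t\<close>, up to normalisation. It gives the moment generating function and,
  later, the truncated exponential moments.\<close>

lemma
  fixes f :: "real \<Rightarrow> real"
  assumes [measurable]: "f \<in> borel_measurable borel"
  shows std_normal_cameron_martin_integrable:
      "integrable std_normal_distribution (\<lambda>x. exp (t * x) * f x)
        \<longleftrightarrow> integrable std_normal_distribution (\<lambda>x. f (x + t))"
    and std_normal_cameron_martin: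
      "(\<integral>x. exp (t * x) * f x \<partial>std_normal_distribution)
        = exp (t\<^sup>2 / 2) * (\<integral>x. f (x + t) \<partial>std_normal_distribution)"
proof -
  let ?g = "\<lambda>x. std_normal_density x * (exp (t * x) * f x)"
  have shift: "?g (t + 1 * x) = exp (t\<^sup>2 / 2) * (std_normal_density x * f (x + t))" for x
    using std_normal_density_shift[of x t] by (simp add: algebra_simps)
  have "integrable std_normal_distribution (\<lambda>x. exp (t * x) * f x) \<longleftrightarrow> integrable lborel ?g"
    by (subst integrable_density) auto
  also have "\<dots> \<longleftrightarrow> integrable lborel (\<lambda>x. ?g (t + 1 * x))"
    by (rule lborel_integrable_real_affine_iff[symmetric]) simp
  also have "\<dots> \<longleftrightarrow> integrable lborel (\<lambda>x. std_normal_density x * f (x + t))"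
    unfolding shift by simp
  also have "\<dots> \<longleftrightarrow> integrable std_normal_distribution (\<lambda>x. f (x + t))"
    by (subst integrable_density) auto
  finally show "integrable std_normal_distribution (\<lambda>x. exp (t * x) * f x)
        \<longleftrightarrow> integrable std_normal_distribution (\<lambda>x. f (x + t))" .
  have "(\<integral>x. exp (t * x) * f x \<partial>std_normal_distribution) = (\<integral>x. ?g x \<partial>lborel)"
    by (subst integral_density) auto
  also have "\<dots> = (\<integral>x. ?g (t + 1 * x) \<partial>lborel)"
    by (subst lborel_integral_real_affine[of 1 _ t]) auto
  also have "\<dots> = exp (t\<^sup>2 / 2) * (\<integral>x. std_normal_density x * f (x + t) \<partial>lborel)"
    unfolding shift by simp
  also have "(\<integral>x. std_normal_density x * f (x + t) \<partial>lborel)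
      = (\<integral>x. f (x + t) \<partial>std_normal_distribution)"
    by (subst integral_density) auto
  finally show "(\<integral>x. exp (t * x) * f x \<partial>std_normal_distribution)
        = exp (t\<^sup>2 / 2) * (\<integral>x. f (x + t) \<partial>std_normal_distribution)" .
qed

lemma std_normal_mgf:
  shows "integrable std_normal_distribution (\<lambda>x. exp (t * x))"
    and "(\<integral>x. exp (t * x) \<partial>std_normal_distribution) = exp (t\<^sup>2 / 2)"
  using std_normal_cameron_martin_integrable[of "\<lambda>_. 1" t] std_normal_cameron_martin[of "\<lambda>_. 1" t]
    std_normal.prob_space by auto

lemma integrable_std_normal_exp_abs: "integrable std_normal_distribution (\<lambda>x. exp (K * \<bar>x\<bar>))"
proof (rule Bochner_Integration.integrable_bound)
  show "integrable std_normal_distribution (\<lambda>x. exp (K * x) + exp (- K * x))"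
    by (intro Bochner_Integration.integrable_add std_normal_mgf)
  show "AE x in std_normal_distribution. norm (exp (K * \<bar>x\<bar>)) \<le> norm (exp (K * x) + exp (- K * x))"
  proof (intro AE_I2)
    fix x
    have "exp (K * \<bar>x\<bar>) \<le> exp (K * x) + exp (- K * x)" by (cases "0 \<le> x") auto
    then show "norm (exp (K * \<bar>x\<bar>)) \<le> norm (exp (K * x) + exp (- K * x))"
      unfolding real_norm_def by (smt (verit) exp_gt_zero)
  qed
qed simp

lemma integrable_std_normal_bounded:
  fixes f :: "real \<Rightarrow> real"
  assumes "f \<in> borel_measurable borel" "\<And>x. \<bar>f x\<bar> \<le> C * exp (K * \<bar>x\<bar>)"
  shows "integrable std_normal_distribution f"
proof (rule Bochner_Integration.integrable_bound)
  show "integrable std_normal_distribution (\<lambda>x. C * exp (K * \<bar>x\<bar>))"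
    using integrable_std_normal_exp_abs by simp
  show "AE x in std_normal_distribution. norm (f x) \<le> norm (C * exp (K * \<bar>x\<bar>))"
    using assms(2) by (intro AE_I2) (metis abs_of_nonneg abs_ge_zero order_trans real_norm_def)
qed (use assms in simp)

lemma integrable_std_normal_PiM_exp:
  assumes "finite I"
  shows "integrable (gauss_PiM I) (\<lambda>\<omega>. exp (K * (\<Sum>i\<in>I. \<bar>\<omega> i\<bar>)))"
proof -
  have "integrable (gauss_PiM I) (\<lambda>\<omega>. \<Prod>i\<in>I. exp (K * \<bar>\<omega> i\<bar>))"
    using assms integrable_std_normal_exp_abs
    by (intro std_normal_PiM.product_integrable_prod) auto
  also have "(\<lambda>\<omega>. \<Prod>i\<in>I. exp (K * \<bar>\<omega> i\<bar>)) = (\<lambda>\<omega>. exp (K * (\<Sum>i\<in>I. \<bar>\<omega> i\<bar>)))"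
    using assms by (simp add: exp_sum sum_distrib_left)
  finally show ?thesis .
qed

text \<open>Integrability criterion of the whole development: this growth class contains
  exponentials of linear forms and of maxima of them, and it absorbs multiplication by a coordinate
  at the price of a larger \<open>K\<close>.\<close>

lemma integrable_std_normal_PiM_bounded:
  fixes f :: "('i \<Rightarrow> real) \<Rightarrow> real"
  assumes "finite I" "f \<in> borel_measurable (gauss_PiM I)"
    and "\<And>\<omega>. \<bar>f \<omega>\<bar> \<le> C * exp (K * (\<Sum>i\<in>I. \<bar>\<omega> i\<bar>))"
  shows "integrable (gauss_PiM I) f"
proof (rule Bochner_Integration.integrable_bound)
  show "integrable (gauss_PiM I) (\<lambda>\<omega>. C * exp (K * (\<Sum>i\<in>I. \<bar>\<omega> i\<bar>)))"
    using integrable_std_normal_PiM_exp[OF assms(1)] by simp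
  show "AE x in gauss_PiM I.
      norm (f x) \<le> norm (C * exp (K * (\<Sum>i\<in>I. \<bar>x i\<bar>)))"
    using assms(3) by (intro AE_I2) (metis abs_of_nonneg abs_ge_zero order_trans real_norm_def)
qed (use assms in simp)

lemma le_exp_self: "x \<le> exp (x::real)"
  using exp_ge_add_one_self[of x] by linarith

lemma std_normal_density_exp_tendsto_0:
  "((\<lambda>x. exp (K * \<bar>x\<bar>) * std_normal_density x) \<longlongrightarrow> 0) at_top"
  "((\<lambda>x. exp (K * \<bar>x\<bar>) * std_normal_density x) \<longlongrightarrow> 0) at_bot"
proof -
  have "((\<lambda>x. 1 / sqrt (2 * pi) * exp (K * x + - x\<^sup>2 / 2)) \<longlongrightarrow> 1 / sqrt (2 * pi) * 0) at_top"
    by (intro tendsto_mult tendsto_const) real_asymp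
  then have *: "((\<lambda>x. exp (K * x) * (1 / sqrt (2 * pi) * exp (- x\<^sup>2 / 2))) \<longlongrightarrow> 0) at_top"
    unfolding exp_add by (simp add: mult.left_commute)
  show 1: "((\<lambda>x. exp (K * \<bar>x\<bar>) * std_normal_density x) \<longlongrightarrow> 0) at_top"
    by (rule Lim_transform_eventually[OF *])
       (auto simp: std_normal_density_def intro!: eventually_mono[OF eventually_ge_at_top[of 0]])
  show "((\<lambda>x. exp (K * \<bar>x\<bar>) * std_normal_density x) \<longlongrightarrow> 0) at_bot"
    unfolding filterlim_at_bot_mirror using 1 by (simp add: std_normal_density_def)
qed

text \<open>Stein's identity: the density times \<open>f' x - x * f x\<close> is the derivative of
  \<open>f\<close> times the density, whose boundary values vanish by the growth bound.\<close>

lemma std_normal_integral_by_parts: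
  fixes f f' :: "real \<Rightarrow> real"
  assumes deriv: "\<And>x. (f has_real_derivative f' x) (at x)" and cont: "\<And>x. isCont f' x"
    and bound: "\<And>x. \<bar>f x\<bar> \<le> C * exp (K * \<bar>x\<bar>)" and bound': "\<And>x. \<bar>f' x\<bar> \<le> C * exp (K * \<bar>x\<bar>)"
  shows "(\<integral>x. x * f x \<partial>std_normal_distribution) = (\<integral>x. f' x \<partial>std_normal_distribution)"
proof -
  let ?N = std_normal_distribution and ?d = std_normal_density
  have [simp]: "isCont f x" for x using deriv DERIV_isCont by blast
  have [measurable]: "f \<in> borel_measurable borel" "f' \<in> borel_measurable borel"
    using cont by (auto intro!: borel_measurable_continuous_onI simp: continuous_on_eq_continuous_at)
  have C: "0 \<le> C" using bound[of 0] abs_ge_zero[of "f 0"] by simp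
  have bound_xf: "\<bar>x * f x\<bar> \<le> C * exp ((K + 1) * \<bar>x\<bar>)" for x
  proof -
    have "\<bar>x * f x\<bar> \<le> exp \<bar>x\<bar> * (C * exp (K * \<bar>x\<bar>))"
      unfolding abs_mult using bound le_exp_self by (intro mult_mono) auto
    then show ?thesis by (simp add: algebra_simps exp_add)
  qed
  have int_f': "integrable ?N f'"
    by (rule integrable_std_normal_bounded[OF _ bound']) simp
  have int_xf: "integrable ?N (\<lambda>x. x * f x)"
    by (rule integrable_std_normal_bounded[OF _ bound_xf]) simp
  let ?g = "\<lambda>x. ?d x * (f' x - x * f x)"
  have d_deriv: "(?d has_real_derivative - x * ?d x) (at x)" for x
  proof -
    have "((\<lambda>x. c * exp (- x\<^sup>2 / 2)) has_real_derivative - x * (c * exp (- x\<^sup>2 / 2))) (at x)" for c :: real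
      by (auto intro!: derivative_eq_intros)
    then show ?thesis unfolding std_normal_density_def .
  qed
  have d_cont: "isCont ?d x" for x using d_deriv DERIV_isCont by blast
  have lim: "((\<lambda>x. f x * ?d x) \<longlongrightarrow> 0) F" if "F = at_top \<or> F = at_bot" for F
  proof (rule Lim_null_comparison)
    show "\<forall>\<^sub>F x in F. norm (f x * ?d x) \<le> C * (exp (K * \<bar>x\<bar>) * ?d x)"
      using bound by (intro always_eventually) (auto simp: abs_mult mult.assoc[symmetric] intro!: mult_right_mono)
    show "((\<lambda>x. C * (exp (K * \<bar>x\<bar>) * ?d x)) \<longlongrightarrow> 0) F"
      using that std_normal_density_exp_tendsto_0 by (auto intro!: tendsto_mult_right_zero)
  qed
  have "integrable ?N (\<lambda>x. f' x - x * f x)"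
    using int_f' int_xf by simp
  then have int_g: "integrable lborel ?g"
    by (subst (asm) integrable_density) auto
  have "(LBINT x=-\<infinity>..\<infinity>. ?g x) = 0 - 0"
  proof (rule interval_integral_FTC_integrable)
    show "((\<lambda>x. f x * ?d x) has_vector_derivative ?g x) (at x)" for x
      unfolding has_real_derivative_iff_has_vector_derivative[symmetric]
      by (auto intro!: derivative_eq_intros deriv d_deriv simp: algebra_simps)
    show "isCont ?g x" for x
      using cont d_cont by (intro continuous_intros) auto
    show "set_integrable lborel (einterval (-\<infinity>) \<infinity>) ?g"
      using int_g by (simp add: set_integrable_def)
    show "(((\<lambda>x. f x * ?d x) \<circ> real_of_ereal) \<longlongrightarrow> 0) (at_right (-\<infinity>))"
      "(((\<lambda>x. f x * ?d x) \<circ> real_of_ereal) \<longlongrightarrow> 0) (at_left \<infinity>)"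
      using lim by (auto simp: at_right_MInf at_left_PInf filterlim_filtermap comp_def)
  qed simp
  then have "(\<integral>x. ?g x \<partial>lborel) = 0"
    by (simp add: interval_lebesgue_integral_def set_lebesgue_integral_def)
  then have "(\<integral>x. f' x - x * f x \<partial>?N) = 0"
    by (subst integral_density) auto
  then show ?thesis using int_f' int_xf by simp
qed

lemma std_normal_PiM_integral_by_parts:
  fixes f f' :: "('i \<Rightarrow> real) \<Rightarrow> real"
  assumes I: "finite I" "i \<in> I"
    and [measurable]: "f \<in> borel_measurable (gauss_PiM I)"
      "f' \<in> borel_measurable (gauss_PiM I)"
    and deriv: "\<And>w x. ((\<lambda>s. f (w(i := s))) has_real_derivative f' (w(i := x))) (at x)"
    and cont: "\<And>w x. isCont (\<lambda>s. f' (w(i := s))) x"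
    and bound: "\<And>w. \<bar>f w\<bar> \<le> C * exp (K * (\<Sum>i\<in>I. \<bar>w i\<bar>))"
    and bound': "\<And>w. \<bar>f' w\<bar> \<le> C * exp (K * (\<Sum>i\<in>I. \<bar>w i\<bar>))"
  shows "integrable (gauss_PiM I) (\<lambda>w. w i * f w)"
    and "(\<integral>w. w i * f w \<partial>gauss_PiM I)
      = (\<integral>w. f' w \<partial>gauss_PiM I)"
proof -
  have C: "0 \<le> C"
    using bound[of "\<lambda>_. 0"] abs_ge_zero[of "f (\<lambda>_. 0)"] by simp
  have bound_xf: "\<bar>w i * f w\<bar> \<le> C * exp ((K + 1) * (\<Sum>i\<in>I. \<bar>w i\<bar>))" for w
  proof -
    have "\<bar>w i\<bar> \<le> (\<Sum>i\<in>I. \<bar>w i\<bar>)" using I by (intro member_le_sum) auto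
    then have "\<bar>w i * f w\<bar> \<le> exp (\<Sum>i\<in>I. \<bar>w i\<bar>) * (C * exp (K * (\<Sum>i\<in>I. \<bar>w i\<bar>)))"
      unfolding abs_mult using bound le_exp_self[of "\<Sum>i\<in>I. \<bar>w i\<bar>"]
      by (intro mult_mono) auto
    then show ?thesis by (simp add: algebra_simps exp_add)
  qed
  show int_xf: "integrable (gauss_PiM I) (\<lambda>w. w i * f w)"
    using I by (intro integrable_std_normal_PiM_bounded[OF _ _ bound_xf]) auto
  have int_f': "integrable (gauss_PiM I) f'"
    using I by (intro integrable_std_normal_PiM_bounded[OF _ _ bound']) auto
  define I' where "I' = I - {i}"
  have I': "I = insert i I'" "i \<notin> I'" "finite I'" using I by (auto simp: I'_def)
  \<comment> \<open>With all other coordinates frozen, their part of the growth bound becomes the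
    constant of the one-dimensional identity.\<close>
  let ?e = "\<lambda>w. C * exp (K * (\<Sum>i\<in>I'. \<bar>w i\<bar>))"
  have sum: "(\<Sum>j\<in>I. \<bar>(w(i := x)) j\<bar>) = \<bar>x\<bar> + (\<Sum>j\<in>I'. \<bar>w j\<bar>)" for w x
    proof -
    have "(\<Sum>j\<in>I'. \<bar>(w(i := x)) j\<bar>) = (\<Sum>j\<in>I'. \<bar>w j\<bar>)"
      using I'(2) by (intro sum.cong) auto
    then show ?thesis unfolding I'(1) using I'(2,3) by simp
  qed
  have ibp: "(\<integral>x. x * f (w(i := x)) \<partial>std_normal_distribution)
      = (\<integral>x. f' (w(i := x)) \<partial>std_normal_distribution)" for w
  proof (rule std_normal_integral_by_parts[where C = "?e w" and K = K, OF deriv cont])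
    show "\<bar>f (w(i := x))\<bar> \<le> ?e w * exp (K * \<bar>x\<bar>)" "\<bar>f' (w(i := x))\<bar> \<le> ?e w * exp (K * \<bar>x\<bar>)" for x
      using bound[of "w(i := x)"] bound'[of "w(i := x)"] unfolding sum
      by (simp_all add: algebra_simps exp_add)
  qed
  have "(\<integral>w. w i * f w \<partial>gauss_PiM I) =
      (\<integral>w. (\<integral>x. x * f (w(i := x)) \<partial>std_normal_distribution) \<partial>Pi\<^sub>M I' (\<lambda>_. std_normal_distribution))"
    using std_normal_PiM.product_integral_insert[OF I'(3,2) int_xf[unfolded I'(1)]] I'(1) by simp
  also have "\<dots> = (\<integral>w. (\<integral>x. f' (w(i := x)) \<partial>std_normal_distribution) \<partial>Pi\<^sub>M I' (\<lambda>_. std_normal_distribution))"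
    unfolding ibp ..
  also have "\<dots> = (\<integral>w. f' w \<partial>gauss_PiM I)"
    using std_normal_PiM.product_integral_insert[OF I'(3,2) int_f'[unfolded I'(1)]] I'(1) by simp
  finally show "(\<integral>w. w i * f w \<partial>gauss_PiM I)
      = (\<integral>w. f' w \<partial>gauss_PiM I)" .
qed

text \<open>Dominated convergence for difference quotients: the mean value theorem bounds them by
  \<open>g\<close>, because \<open>g\<close> dominates the derivative for all \<open>t\<close> at
  once.\<close>

lemma has_real_derivative_integral:
  fixes f f' :: "real \<Rightarrow> 'a \<Rightarrow> real"
  assumes int: "\<And>t. integrable M (f t)"
    and deriv: "\<And>t \<omega>. ((\<lambda>t. f t \<omega>) has_real_derivative f' t \<omega>) (at t)"
    and bound: "\<And>t \<omega>. \<bar>f' t \<omega>\<bar> \<le> g \<omega>" and g: "integrable M g"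
    and meas: "f' t \<in> borel_measurable M"
  shows "((\<lambda>t. \<integral>\<omega>. f t \<omega> \<partial>M) has_real_derivative (\<integral>\<omega>. f' t \<omega> \<partial>M)) (at t)"
  unfolding has_field_derivative_iff tendsto_at_iff_sequentially comp_def
proof (intro allI impI)
  fix X assume X: "\<forall>i. X i \<in> UNIV - {t}" "X \<longlonglongrightarrow> t"
  have mvt: "\<bar>(f s \<omega> - f t \<omega>) / (s - t)\<bar> \<le> g \<omega>" for s \<omega>
  proof (cases "s = t")
    case True
    then show ?thesis using bound[of t \<omega>] abs_ge_zero[of "f' t \<omega>"] by simp
  next
    case False
    have "norm (f s \<omega> - f t \<omega>) \<le> g \<omega> * norm (s - t)"
      by (rule field_differentiable_bound[of UNIV "\<lambda>t. f t \<omega>" "\<lambda>t. f' t \<omega>"])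
         (use deriv bound in auto)
    then show ?thesis using False by (simp add: divide_simps)
  qed
  have "(\<lambda>n. \<integral>\<omega>. (f (X n) \<omega> - f t \<omega>) / (X n - t) \<partial>M) \<longlonglongrightarrow> (\<integral>\<omega>. f' t \<omega> \<partial>M)"
  proof (rule integral_dominated_convergence[where w = g])
    have "((\<lambda>s. (f s \<omega> - f t \<omega>) / (s - t)) \<longlongrightarrow> f' t \<omega>) (at t)" for \<omega>
      using deriv[of \<omega> t] by (simp add: has_field_derivative_iff)
    then show "AE \<omega> in M. (\<lambda>n. (f (X n) \<omega> - f t \<omega>) / (X n - t)) \<longlonglongrightarrow> f' t \<omega>"
      using X by (intro AE_I2) (auto simp: tendsto_at_iff_sequentially comp_def)
    show "(\<lambda>\<omega>. (f (X n) \<omega> - f t \<omega>) / (X n - t)) \<in> borel_measurable M" for n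
      using int by (auto intro!: borel_measurable_integrable)
  qed (use g meas mvt in auto)
  also have "(\<lambda>n. \<integral>\<omega>. (f (X n) \<omega> - f t \<omega>) / (X n - t) \<partial>M)
      = (\<lambda>n. ((\<integral>\<omega>. f (X n) \<omega> \<partial>M) - (\<integral>\<omega>. f t \<omega> \<partial>M)) / (X n - t))"
    using int by simp
  finally show "(\<lambda>n. ((\<integral>\<omega>. f (X n) \<omega> \<partial>M) - (\<integral>\<omega>. f t \<omega> \<partial>M)) / (X n - t)) \<longlonglongrightarrow> (\<integral>\<omega>. f' t \<omega> \<partial>M)" .
qed

section \<open>Gaussian comparison\<close>

text \<open>Used in two directions: along a single Gaussian coordinate for the integration by parts,
  and along the interpolation parameter for the derivative of the interpolated expectation.\<close>

lemma has_real_derivative_sum_exp_powr: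
  fixes z :: "real \<Rightarrow> 'j \<Rightarrow> real"
  assumes J: "finite J" "J \<noteq> {}"
    and z: "\<And>j. j \<in> J \<Longrightarrow> ((\<lambda>s. z s j) has_real_derivative v j) (at x)"
  shows "((\<lambda>s. (\<Sum>j\<in>J. exp (p * z s j)) powr r) has_real_derivative
    r * p * (\<Sum>j\<in>J. v j * ((\<Sum>j\<in>J. exp (p * z x j)) powr (r - 1) * exp (p * z x j)))) (at x)"
proof -
  have pos: "0 < (\<Sum>j\<in>J. exp (p * z x j))" using J by (intro sum_pos) auto
  have "((\<lambda>s. \<Sum>j\<in>J. exp (p * z s j)) has_real_derivative (\<Sum>j\<in>J. exp (p * z x j) * (p * v j))) (at x)"
    using z by (auto intro!: derivative_eq_intros sum.cong simp: mult_ac)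
  from DERIV_chain2[OF has_real_derivative_powr[OF pos, where r = r] this] show ?thesis
    by (simp add: sum_distrib_left mult_ac)
qed

section \<open>Interpolation between two Gaussian families on one probability space\<close>

context
  fixes I :: "'i set" and J :: "'j set" and a b :: "'j \<Rightarrow> 'i \<Rightarrow> real" and p \<theta> :: real
  assumes fin: "finite I" "finite J" "J \<noteq> {}" and p: "0 < p" and \<theta>: "0 < \<theta>" "\<theta> < 1"
    and orth: "\<And>j l. j \<in> J \<Longrightarrow> l \<in> J \<Longrightarrow> (\<Sum>i\<in>I. a j i * b l i) = 0"
    and var: "\<And>j. j \<in> J \<Longrightarrow> (\<Sum>i\<in>I. a j i * a j i) = (\<Sum>i\<in>I. b j i * b j i)"
    and cov: "\<And>j l. j \<in> J \<Longrightarrow> l \<in> J \<Longrightarrow> (\<Sum>i\<in>I. b j i * b l i) \<le> (\<Sum>i\<in>I. a j i * a l i)"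
begin

text \<open>At \<open>t = 0\<close> the coefficients are \<open>a\<close>, at
  \<open>t = pi / 2\<close> they are \<open>b\<close>, and \<open>d\<close> is the derivative in
  \<open>t\<close>. By \<open>orth\<close> the two families are independent although they are built
  from the same Gaussian vector.\<close>

private abbreviation c where "c t j i \<equiv> cos t * a j i + sin t * b j i"
private abbreviation d where "d t j i \<equiv> cos t * b j i - sin t * a j i"
private definition Z where "Z t w j = (\<Sum>i\<in>I. c t j i * w i)"
private definition S where "S t w = (\<Sum>j\<in>J. exp (p * Z t w j))"
private definition F where "F t w = S t w powr \<theta>"
text \<open>\<open>F1\<close> and \<open>F2\<close> are \<open>F\<close> times one or two Gibbs
  weights \<open>exp (p * Z t w j) / S t w\<close>; up to constants they are the partial derivatives
  that the interpolation produces. As the weights sum to 1, \<open>F2\<close> sums to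
  \<open>F1\<close> and \<open>F1\<close> to \<open>F\<close>, so one bound for \<open>F\<close>
  serves all three.\<close>

private definition F1 where "F1 t j w = S t w powr (\<theta> - 1) * exp (p * Z t w j)"
private definition F2 where "F2 t j l w = S t w powr (\<theta> - 2) * exp (p * Z t w j) * exp (p * Z t w l)"
private definition B where "B = (\<Sum>j\<in>J. \<Sum>i\<in>I. \<bar>a j i\<bar> + \<bar>b j i\<bar>)"
private abbreviation W where "W w \<equiv> \<Sum>i\<in>I. \<bar>w i\<bar>"
text \<open>An envelope for \<open>F\<close>, \<open>F1\<close> and \<open>F2\<close> that does not
  depend on \<open>t\<close>. The summand 1 comes from
  \<open>x powr \<theta> \<le> 1 + x\<close>.\<close>

private definition E where "E w = (1 + real (card J)) * exp (p * B * W w)"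
private abbreviation P where "P \<equiv> gauss_PiM I"

private lemma S_pos: "0 < S t w"
  unfolding S_def using fin by (intro sum_pos) auto

private lemma B_nonneg: "0 \<le> B"
  unfolding B_def by (intro sum_nonneg) auto

private lemma coeff_le_B:
  assumes "i \<in> I" "j \<in> J"
  shows "\<bar>c t j i\<bar> \<le> B" "\<bar>d t j i\<bar> \<le> B"
proof -
  have "\<bar>a j i\<bar> + \<bar>b j i\<bar> \<le> (\<Sum>i\<in>I. \<bar>a j i\<bar> + \<bar>b j i\<bar>)"
    using assms fin by (intro member_le_sum[where f = "\<lambda>i. \<bar>a j i\<bar> + \<bar>b j i\<bar>"]) auto
  also have "\<dots> \<le> B" unfolding B_def
    using assms fin by (intro member_le_sum[where f = "\<lambda>j. \<Sum>i\<in>I. \<bar>a j i\<bar> + \<bar>b j i\<bar>"]) (auto intro: sum_nonneg)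
  finally have "\<bar>a j i\<bar> + \<bar>b j i\<bar> \<le> B" .
  moreover have "\<bar>cos t * x\<bar> \<le> \<bar>x\<bar>" "\<bar>sin t * x\<bar> \<le> \<bar>x\<bar>" for x
    by (auto simp: abs_mult intro!: mult_left_le_one_le)
  then have "\<bar>c t j i\<bar> \<le> \<bar>a j i\<bar> + \<bar>b j i\<bar>" "\<bar>d t j i\<bar> \<le> \<bar>a j i\<bar> + \<bar>b j i\<bar>"
    by (smt (verit))+
  ultimately show "\<bar>c t j i\<bar> \<le> B" "\<bar>d t j i\<bar> \<le> B" by auto
qed

private lemma lin_le: "(\<And>i. i \<in> I \<Longrightarrow> \<bar>x i\<bar> \<le> B) \<Longrightarrow> \<bar>\<Sum>i\<in>I. x i * w i\<bar> \<le> B * W w"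
  by (intro order_trans[OF sum_abs]) (auto simp: abs_mult sum_distrib_left intro!: sum_mono mult_right_mono)

private lemma F_le: "\<bar>F t w\<bar> \<le> E w"
proof -
  have "S t w \<le> (\<Sum>j\<in>J. exp (p * B * W w))" unfolding S_def
  proof (rule sum_mono)
    fix j assume "j \<in> J"
    then have "Z t w j \<le> B * W w"
      unfolding Z_def using lin_le[of "c t j" w] coeff_le_B[of _ j t] by auto
    then show "exp (p * Z t w j) \<le> exp (p * B * W w)" using p by (simp add: mult.assoc)
  qed
  moreover define e where "e = exp (p * B * W w)"
  ultimately have "S t w \<le> real (card J) * e" by simp
  moreover have "1 \<le> e"
    unfolding e_def one_le_exp_iff using p B_nonneg by (intro mult_nonneg_nonneg sum_nonneg) auto
  moreover have "S t w powr \<theta> \<le> 1 + S t w"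
    using S_pos[of t w] \<theta> powr_le1[of \<theta> "S t w"] powr_mono[of \<theta> 1 "S t w"]
    by (cases "S t w \<le> 1") auto
  ultimately have "S t w powr \<theta> \<le> 1 * e + real (card J) * e"
    by linarith
  then show ?thesis unfolding F_def E_def e_def distrib_right by simp
qed

private lemma F1_nonneg: "0 \<le> F1 t j w" and F2_nonneg: "0 \<le> F2 t j l w"
  unfolding F1_def F2_def by auto

private lemma sum_F1: "(\<Sum>j\<in>J. F1 t j w) = F t w"
  unfolding F1_def F_def sum_distrib_left[symmetric] S_def[symmetric]
  using S_pos[of t w] powr_add[of "S t w" "\<theta> - 1" 1] by simp

private lemma sum_F2: "(\<Sum>l\<in>J. F2 t j l w) = F1 t j w"
  unfolding F2_def F1_def sum_distrib_left[symmetric] S_def[symmetric]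
  using S_pos[of t w] powr_add[of "S t w" "\<theta> - 2" 1] by simp

private lemma F1_le: "j \<in> J \<Longrightarrow> F1 t j w \<le> E w"
  using member_le_sum[of j J "\<lambda>j. F1 t j w"] fin F1_nonneg F_le[of t w] sum_F1[of t w] by auto

private lemma measurable_Z [measurable]: "(\<lambda>w. Z t w j) \<in> borel_measurable P"
  unfolding Z_def by measurable

private lemma measurable_S [measurable]: "S t \<in> borel_measurable P"
  unfolding S_def by measurable

private lemma measurable_F [measurable]: "F t \<in> borel_measurable P" "F1 t j \<in> borel_measurable P"
  "F2 t j l \<in> borel_measurable P"
  unfolding F_def[abs_def] F1_def[abs_def] F2_def[abs_def] by measurable

private lemma integrable_E: "integrable P (\<lambda>w. C * exp (K * W w))"
  using integrable_std_normal_PiM_exp[OF fin(1)] by simp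

private lemma integrable_F: "integrable P (F t)"
  using fin F_le by (intro integrable_std_normal_PiM_bounded) (auto simp: E_def)

private lemma F2_le: "j \<in> J \<Longrightarrow> l \<in> J \<Longrightarrow> F2 t j l w \<le> E w"
  using member_le_sum[of l J "\<lambda>l. F2 t j l w"] fin F2_nonneg F1_le[of j t w] sum_F2[of t j w] by auto

private lemma integrable_F1: "j \<in> J \<Longrightarrow> integrable P (F1 t j)"
  using fin F1_le F1_nonneg by (intro integrable_std_normal_PiM_bounded) (auto simp: E_def)

private lemma integrable_F2: "j \<in> J \<Longrightarrow> l \<in> J \<Longrightarrow> integrable P (F2 t j l)"
  using fin F2_le F2_nonneg by (intro integrable_std_normal_PiM_bounded) (auto simp: E_def)

text \<open>Gaussian integration by parts: differentiating the explicit exponential gives the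
  \<open>F1\<close> term, differentiating the power of \<open>S\<close> gives the \<open>F2\<close>
  terms with the negative factor \<open>\<theta> - 1\<close>.\<close>

private lemma integral_mult_F1:
  assumes j: "j \<in> J" and i: "i \<in> I"
  shows "integrable P (\<lambda>w. w i * F1 t j w)"
    and "(\<integral>w. w i * F1 t j w \<partial>P) =
      p * c t j i * (\<integral>w. F1 t j w \<partial>P) - (1 - \<theta>) * p * (\<Sum>l\<in>J. c t l i * (\<integral>w. F2 t j l w \<partial>P))"
proof -
  let ?f' = "\<lambda>w. p * c t j i * F1 t j w - (1 - \<theta>) * p * (\<Sum>l\<in>J. c t l i * F2 t j l w)"
  \<comment> \<open>One constant for the function and its derivative: the derivative has two terms,
    each at most \<open>p * B * E w\<close>.\<close>
  let ?C = "(1 + 2 * p * B) * (1 + real (card J))"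
  have dZ: "((\<lambda>s. Z t (w(i := s)) l) has_real_derivative c t l i) (at x)" for w l x
  proof -
    have "Z t (w(i := s)) l = c t l i * s + (\<Sum>k\<in>I - {i}. c t l k * w k)" for s
      unfolding Z_def using i fin by (subst sum.remove[OF _ i]) auto
    then show ?thesis by (auto intro!: derivative_eq_intros)
  qed
  have cZ: "isCont (\<lambda>s. Z t (w(i := s)) l) x" for w l x using dZ DERIV_isCont by blast
  have deriv: "((\<lambda>s. F1 t j (w(i := s))) has_real_derivative ?f' (w(i := x))) (at x)" for w x
  proof -
    let ?w = "w(i := x)"
    have 2: "\<theta> - 1 - 1 = \<theta> - 2" by simp
    have "((\<lambda>s. F1 t j (w(i := s))) has_real_derivative
        (\<theta> - 1) * p * (\<Sum>l\<in>J. c t l i * (S t ?w powr (\<theta> - 1 - 1) * exp (p * Z t ?w l))) * exp (p * Z t ?w j)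
        + exp (p * Z t ?w j) * (p * c t j i) * S t ?w powr (\<theta> - 1)) (at x)"
      unfolding F1_def S_def
      by (rule DERIV_mult[OF has_real_derivative_sum_exp_powr[OF fin(2,3) dZ]
          DERIV_chain2[OF DERIV_exp DERIV_cmult[OF dZ]]])
    then have "((\<lambda>s. F1 t j (w(i := s))) has_real_derivative
        (\<theta> - 1) * p * (\<Sum>l\<in>J. c t l i * (S t ?w powr (\<theta> - 2) * exp (p * Z t ?w l))) * exp (p * Z t ?w j)
        + exp (p * Z t ?w j) * (p * c t j i) * S t ?w powr (\<theta> - 1)) (at x)"
      unfolding 2 .
    moreover have "(\<Sum>l\<in>J. c t l i * F2 t j l ?w)
        = (\<Sum>l\<in>J. c t l i * (S t ?w powr (\<theta> - 2) * exp (p * Z t ?w l))) * exp (p * Z t ?w j)"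
      unfolding F2_def sum_distrib_right by (intro sum.cong) (auto simp: mult_ac)
    ultimately show ?thesis
      unfolding F1_def by (simp only:) (rule DERIV_cong, assumption, simp add: algebra_simps)
  qed
  have cont: "isCont (\<lambda>s. ?f' (w(i := s))) x" for w x
    unfolding F1_def F2_def using S_pos less_imp_neq[OF S_pos, symmetric]
    by (auto intro!: continuous_intros cZ simp: S_def)
  have EC: "?C * exp (p * B * W w) = E w + 2 * p * B * E w" for w
    by (simp add: E_def algebra_simps)
  have E: "0 \<le> E w" for w by (simp add: E_def)
  have b1: "\<bar>F1 t j w\<bar> \<le> ?C * exp (p * B * W w)" for w
    unfolding EC using F1_nonneg[of t j w] F1_le[OF j, of t w] p B_nonneg E[of w]
    by (simp add: add_increasing2)
  have b2: "\<bar>?f' w\<bar> \<le> ?C * exp (p * B * W w)" for w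
  proof -
    have "\<bar>p * c t j i * F1 t j w\<bar> \<le> p * B * E w"
      unfolding abs_mult using coeff_le_B[OF i j, of t] F1_le[OF j, of t w] F1_nonneg[of t j w] p B_nonneg
      by (intro mult_mono) auto
    moreover have "\<bar>(1 - \<theta>) * p * (\<Sum>l\<in>J. c t l i * F2 t j l w)\<bar> \<le> p * (B * E w)"
    proof -
      have "\<bar>\<Sum>l\<in>J. c t l i * F2 t j l w\<bar> \<le> (\<Sum>l\<in>J. B * F2 t j l w)"
        by (intro order_trans[OF sum_abs] sum_mono)
           (auto simp: abs_mult F2_nonneg intro!: mult_right_mono coeff_le_B i)
      also have "\<dots> \<le> B * E w"
        unfolding sum_distrib_left[symmetric] sum_F2 using F1_le[OF j] B_nonneg by (intro mult_left_mono) auto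
      finally have "\<bar>\<Sum>l\<in>J. c t l i * F2 t j l w\<bar> \<le> B * E w" .
      then show ?thesis unfolding abs_mult[of "(1 - \<theta>) * p"] using \<theta> p B_nonneg E
        by (intro mult_mono) auto
    qed
    ultimately have "\<bar>?f' w\<bar> \<le> p * B * E w + p * (B * E w)" by linarith
    then show ?thesis unfolding EC using E[of w] by (simp add: algebra_simps)
  qed
  note ibp = std_normal_PiM_integral_by_parts[OF fin(1) i _ _ deriv cont b1 b2]
  show "integrable P (\<lambda>w. w i * F1 t j w)" by (rule ibp(1)) measurable
  have "(\<integral>w. w i * F1 t j w \<partial>P) = (\<integral>w. ?f' w \<partial>P)" by (rule ibp(2)) measurable
  also have "\<dots> = p * c t j i * (\<integral>w. F1 t j w \<partial>P) - (1 - \<theta>) * p * (\<Sum>l\<in>J. c t l i * (\<integral>w. F2 t j l w \<partial>P))"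
    using integrable_F1[OF j, of t] integrable_F2[OF j, of _ t]
    by (subst Bochner_Integration.integral_diff)
       (auto simp: Bochner_Integration.integral_sum intro!: Bochner_Integration.integrable_sum)
  finally show "(\<integral>w. w i * F1 t j w \<partial>P) = \<dots>" .
qed

private lemma has_derivative_F:
  "((\<lambda>t. \<integral>w. F t w \<partial>P) has_real_derivative
    (\<integral>w. \<theta> * p * (\<Sum>j\<in>J. \<Sum>i\<in>I. d t j i * (w i * F1 t j w)) \<partial>P)) (at t)"
proof (rule has_real_derivative_integral[OF integrable_F])
  let ?F' = "\<lambda>t w. \<theta> * p * (\<Sum>j\<in>J. \<Sum>i\<in>I. d t j i * (w i * F1 t j w))"
  show "((\<lambda>t. F t w) has_real_derivative ?F' t w) (at t)" for t w
  proof -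
    have "((\<lambda>t. Z t w j) has_real_derivative (\<Sum>i\<in>I. d t j i * w i)) (at t)" for j
      unfolding Z_def by (auto intro!: derivative_eq_intros sum.cong simp: algebra_simps)
    from has_real_derivative_sum_exp_powr[OF fin(2,3) this, where r = \<theta> and p = p] show ?thesis
      unfolding F_def F1_def S_def by (simp add: sum_distrib_right mult.assoc)
  qed
  show "\<bar>?F' t w\<bar> \<le> \<theta> * p * B * (1 + real (card J)) * exp ((p * B + 1) * W w)" for t w
  proof -
    have "\<bar>\<Sum>j\<in>J. \<Sum>i\<in>I. d t j i * (w i * F1 t j w)\<bar> \<le> (\<Sum>j\<in>J. (B * W w) * F1 t j w)"
    proof (rule order_trans[OF sum_abs], rule sum_mono)
      fix j assume j: "j \<in> J"
      have "(\<Sum>i\<in>I. d t j i * (w i * F1 t j w)) = (\<Sum>i\<in>I. d t j i * w i) * F1 t j w"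
        by (simp add: sum_distrib_right mult.assoc)
      then show "\<bar>\<Sum>i\<in>I. d t j i * (w i * F1 t j w)\<bar> \<le> (B * W w) * F1 t j w"
        using lin_le[of "d t j" w] coeff_le_B(2)[OF _ j, of _ t] F1_nonneg[of t j w]
        by (auto simp: abs_mult intro!: mult_right_mono)
    qed
    also have "\<dots> = B * (W w * F t w)" by (simp add: sum_distrib_left[symmetric] sum_F1)
    also have "\<dots> \<le> B * (exp (W w) * E w)"
      using F_le[of t w] B_nonneg le_exp_self[of "W w"]
      by (intro mult_left_mono mult_mono) (auto simp: E_def F_def)
    finally have "\<bar>?F' t w\<bar> \<le> \<theta> * p * (B * (exp (W w) * E w))"
      unfolding abs_mult[of "\<theta> * p"] using \<theta> p by (intro mult_mono) auto
    also have "\<dots> = \<theta> * p * B * (1 + real (card J)) * exp ((p * B + 1) * W w)"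
    proof -
      have "(p * B + 1) * W w = p * B * W w + W w" by (simp add: algebra_simps)
      then show ?thesis unfolding E_def exp_add by (simp only: exp_add mult_ac)
    qed
    finally show ?thesis .
  qed
  show "integrable P (\<lambda>w. \<theta> * p * B * (1 + real (card J)) * exp ((p * B + 1) * W w))"
    by (rule integrable_E)
qed measurable

text \<open>Here \<open>r j l\<close> is the covariance of the \<open>t\<close>-derivative of
  \<open>Z\<close> at \<open>j\<close> with \<open>Z\<close> at \<open>l\<close>; by
  \<open>orth\<close> it equals \<open>sin t * cos t\<close> times the difference of the two
  covariances. It vanishes on the diagonal by \<open>var\<close>, which removes the
  \<open>F1\<close> terms, and is nonpositive elsewhere by \<open>cov\<close>; the factor
  \<open>-(1 - \<theta>)\<close> of the \<open>F2\<close> terms turns this into a nonnegative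
  derivative.\<close>

private lemma derivative_F_nonneg:
  assumes t: "0 \<le> t" "t \<le> pi / 2"
  shows "0 \<le> (\<integral>w. \<theta> * p * (\<Sum>j\<in>J. \<Sum>i\<in>I. d t j i * (w i * F1 t j w)) \<partial>P)"
proof -
  define r where "r j l = (\<Sum>i\<in>I. d t j i * c t l i)" for j l
  have r: "r j l = sin t * cos t * ((\<Sum>i\<in>I. b j i * b l i) - (\<Sum>i\<in>I. a j i * a l i))"
    if "j \<in> J" "l \<in> J" for j l
  proof -
    have "r j l = sin t * cos t * ((\<Sum>i\<in>I. b j i * b l i) - (\<Sum>i\<in>I. a j i * a l i))
       + (cos t)\<^sup>2 * (\<Sum>i\<in>I. a l i * b j i) - (sin t)\<^sup>2 * (\<Sum>i\<in>I. a j i * b l i)"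
      unfolding r_def by (simp add: sum_distrib_left algebra_simps power2_eq_square
        flip: sum.distrib sum_subtractf)
    then show ?thesis using orth that by simp
  qed
  have "0 \<le> sin t * cos t" using t by (intro mult_nonneg_nonneg sin_ge_zero cos_ge_zero) auto
  then have r_le: "r j l \<le> 0" if "j \<in> J" "l \<in> J" for j l
    using r[OF that] cov[OF that] by (auto intro!: mult_nonneg_nonpos)
  have "(\<integral>w. \<theta> * p * (\<Sum>j\<in>J. \<Sum>i\<in>I. d t j i * (w i * F1 t j w)) \<partial>P)
      = \<theta> * p * (\<Sum>j\<in>J. \<Sum>i\<in>I. d t j i * (\<integral>w. w i * F1 t j w \<partial>P))"
    using integral_mult_F1(1) by (simp add: Bochner_Integration.integral_sum Bochner_Integration.integrable_sum)
  also have "\<dots> = \<theta> * p * (\<Sum>j\<in>J. p * r j j * (\<integral>w. F1 t j w \<partial>P)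
      - (1 - \<theta>) * p * (\<Sum>l\<in>J. r j l * (\<integral>w. F2 t j l w \<partial>P)))"
  proof (intro arg_cong[where f = "\<lambda>x. \<theta> * p * x"] sum.cong refl)
    fix j assume j: "j \<in> J"
    have "(\<Sum>i\<in>I. d t j i * (\<integral>w. w i * F1 t j w \<partial>P)) =
       (\<Sum>i\<in>I. d t j i * (p * c t j i * (\<integral>w. F1 t j w \<partial>P)
         - (1 - \<theta>) * p * (\<Sum>l\<in>J. c t l i * (\<integral>w. F2 t j l w \<partial>P))))"
      using integral_mult_F1(2)[OF j] by (intro sum.cong refl) simp
    also have "\<dots> = p * r j j * (\<integral>w. F1 t j w \<partial>P)
       - (1 - \<theta>) * p * (\<Sum>i\<in>I. \<Sum>l\<in>J. d t j i * c t l i * (\<integral>w. F2 t j l w \<partial>P))"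
      unfolding r_def right_diff_distrib sum_subtractf
      by (simp add: sum_distrib_left sum_distrib_right mult_ac)
    also have "(\<Sum>i\<in>I. \<Sum>l\<in>J. d t j i * c t l i * (\<integral>w. F2 t j l w \<partial>P))
        = (\<Sum>l\<in>J. r j l * (\<integral>w. F2 t j l w \<partial>P))"
      unfolding r_def sum_distrib_right by (rule sum.swap)
    finally show "(\<Sum>i\<in>I. d t j i * (\<integral>w. w i * F1 t j w \<partial>P)) = p * r j j * (\<integral>w. F1 t j w \<partial>P)
       - (1 - \<theta>) * p * (\<Sum>l\<in>J. r j l * (\<integral>w. F2 t j l w \<partial>P))" .
  qed
  also have "\<dots> \<ge> 0"
  proof (intro mult_nonneg_nonneg sum_nonneg)
    fix j assume j: "j \<in> J"
    have "r j j = 0" using r[OF j j] var[OF j] by simp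
    moreover have "(\<Sum>l\<in>J. r j l * (\<integral>w. F2 t j l w \<partial>P)) \<le> 0"
      using r_le j by (intro sum_nonpos mult_nonpos_nonneg integral_nonneg) (auto simp: F2_nonneg)
    ultimately show "0 \<le> p * r j j * (\<integral>w. F1 t j w \<partial>P)
      - (1 - \<theta>) * p * (\<Sum>l\<in>J. r j l * (\<integral>w. F2 t j l w \<partial>P))"
      using \<theta> p by (simp add: mult_nonneg_nonpos)
  qed (use \<theta> p in auto)
  finally show ?thesis .
qed

lemma gaussian_comparison_powr:
  "(\<integral>w. (\<Sum>j\<in>J. exp (p * (\<Sum>i\<in>I. a j i * w i))) powr \<theta> \<partial>gauss_PiM I)
    \<le> (\<integral>w. (\<Sum>j\<in>J. exp (p * (\<Sum>i\<in>I. b j i * w i))) powr \<theta> \<partial>gauss_PiM I)"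
proof -
  have "(\<integral>w. F 0 w \<partial>P) \<le> (\<integral>w. F (pi / 2) w \<partial>P)"
    by (rule DERIV_nonneg_imp_nondecreasing[of _ _ "\<lambda>t. \<integral>w. F t w \<partial>P"])
       (use has_derivative_F derivative_F_nonneg in auto)
  then show ?thesis unfolding F_def S_def Z_def by simp
qed

lemma gaussian_comparison_integrable:
  "integrable (gauss_PiM I) (\<lambda>w. (\<Sum>j\<in>J. exp (p * (\<Sum>i\<in>I. a j i * w i))) powr \<theta>)"
  using integrable_F[of 0] unfolding F_def[abs_def] S_def Z_def by simp

end

section \<open>Maxima over selections\<close>

lemma integral_std_normal_PiM_reindex:
  fixes F :: "('k \<Rightarrow> real) \<Rightarrow> real"
  assumes "inj_on f K" "f \<in> K \<rightarrow> I"
    and [measurable]: "F \<in> borel_measurable (gauss_PiM K)"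
  shows "(\<integral>w. F (\<lambda>k\<in>K. w (f k)) \<partial>gauss_PiM I)
    = (\<integral>v. F v \<partial>gauss_PiM K)"
proof -
  have *: "(\<lambda>w. \<lambda>k\<in>K. w (f k)) \<in> gauss_PiM I \<rightarrow>\<^sub>M gauss_PiM K"
    using assms(2) by (intro measurable_restrict measurable_component_singleton) auto
  have "(\<integral>v. F v \<partial>gauss_PiM K)
    = (\<integral>v. F v \<partial>distr (gauss_PiM I) (gauss_PiM K)
        (\<lambda>w. \<lambda>k\<in>K. w (f k)))"
    using distr_PiM_reindex[OF std_normal.prob_space_axioms assms(1,2)] by simp
  then show ?thesis by (simp add: integral_distr[OF *])
qed

text \<open>Independence of disjoint blocks of coordinates. Coordinates outside
  \<open>A \<union> B\<close> are integrated out first, then Fubini applies to the two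
  blocks.\<close>

lemma integral_std_normal_PiM_mult:
  fixes F G :: "('i \<Rightarrow> real) \<Rightarrow> real"
  assumes AB: "A \<inter> B = {}" "A \<union> B \<subseteq> I" "finite I"
    and [measurable]: "F \<in> borel_measurable (gauss_PiM A)"
      "G \<in> borel_measurable (gauss_PiM B)"
    and bound: "\<And>w. \<bar>F w\<bar> \<le> C * exp (K * (\<Sum>i\<in>A. \<bar>w i\<bar>))" "\<And>w. \<bar>G w\<bar> \<le> C * exp (K * (\<Sum>i\<in>B. \<bar>w i\<bar>))"
  shows "(\<integral>w. F (restrict w A) * G (restrict w B) \<partial>gauss_PiM I)
    = (\<integral>w. F w \<partial>gauss_PiM A) * (\<integral>w. G w \<partial>gauss_PiM B)"
proof -
  have fin: "finite A" "finite B" using AB by (auto intro: finite_subset)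
  let ?P = "\<lambda>I. gauss_PiM I"
  let ?f = "\<lambda>w. F (restrict w A) * G (restrict w B)"
  have [measurable]: "(\<lambda>w. restrict w A) \<in> ?P (A \<union> B) \<rightarrow>\<^sub>M ?P A" "(\<lambda>w. restrict w B) \<in> ?P (A \<union> B) \<rightarrow>\<^sub>M ?P B"
    by (auto intro!: measurable_restrict_subset)
  have bound_f: "\<bar>?f w\<bar> \<le> C * C * exp (K * (\<Sum>i\<in>A\<union>B. \<bar>w i\<bar>))" for w
  proof -
    have "\<bar>?f w\<bar> \<le> (C * exp (K * (\<Sum>i\<in>A. \<bar>restrict w A i\<bar>))) * (C * exp (K * (\<Sum>i\<in>B. \<bar>restrict w B i\<bar>)))"
      unfolding abs_mult using bound(1)[of "restrict w A"] bound(2)[of "restrict w B"]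
        order_trans[OF abs_ge_zero bound(1)[of "restrict w A"]] by (intro mult_mono) auto
    then show ?thesis
      using sum.union_disjoint[OF fin AB(1), of "\<lambda>i. \<bar>w i\<bar>"] by (simp add: exp_add algebra_simps)
  qed
  have int: "integrable (?P (A \<union> B)) ?f"
    using fin by (intro integrable_std_normal_PiM_bounded[OF _ _ bound_f]) auto
  have "(\<integral>w. ?f w \<partial>?P I) = (\<integral>w. ?f (\<lambda>i\<in>A\<union>B. w i) \<partial>?P I)"
    by (auto simp: restrict_restrict Int_absorb1 Int_absorb2 intro!: Bochner_Integration.integral_cong)
  also have "\<dots> = (\<integral>w. ?f w \<partial>?P (A \<union> B))"
    using integral_std_normal_PiM_reindex[of "\<lambda>i. i" "A \<union> B" I ?f] AB by auto
  also have "\<dots> = (\<integral>x. (\<integral>y. ?f (merge A B (x, y)) \<partial>?P B) \<partial>?P A)"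
    by (rule std_normal_PiM.product_integral_fold[OF AB(1) fin int])
  also have "\<dots> = (\<integral>x. (\<integral>y. F x * G y \<partial>?P B) \<partial>?P A)"
  proof (intro Bochner_Integration.integral_cong refl)
    fix x y assume "x \<in> space (?P A)" "y \<in> space (?P B)"
    then show "?f (merge A B (x, y)) = F x * G y"
      using AB(1) by (auto simp: space_PiM PiE_def extensional_restrict)
  qed
  finally show ?thesis by simp
qed

section \<open>Selections as subsets of fixed size, and maxima over them\<close>

definition subsets_of_card :: "nat \<Rightarrow> nat \<Rightarrow> nat set set" where
  "subsets_of_card n k = {I. I \<subseteq> {1..n} \<and> card I = k}"

lemma finite_subsets_of_card [simp]: "finite (subsets_of_card n k)"
  unfolding subsets_of_card_def by (rule finite_subset[of _ "Pow {1..n}"]) auto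

lemma subsets_of_card_nonempty: "k \<le> n \<Longrightarrow> subsets_of_card n k \<noteq> {}"
  unfolding subsets_of_card_def using obtain_subset_with_card_n[of k "{1..n}"] by auto

definition unit_ind :: "nat \<Rightarrow> nat set \<Rightarrow> nat \<Rightarrow> real" where
  "unit_ind k I i = (if i \<in> I then 1 / sqrt (real k) else 0)"

lemma sum_mult_unit_ind:
  "I \<subseteq> {1..n} \<Longrightarrow> (\<Sum>i=1..n. w i * unit_ind k I i) = (\<Sum>i\<in>I. w i) / sqrt (real k)"
  by (auto simp: unit_ind_def if_distrib sum_divide_distrib sum.If_cases Int_absorb1 cong: if_cong)

text \<open>The sum constraint counts the support: a vector with support \<open>I\<close> has sum
  \<open>card I / sqrt k\<close>, which equals \<open>sqrt k\<close> exactly when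
  \<open>card I = k\<close>.\<close>

lemma sel_set_eq:
  assumes "0 < k"
  shows "sel_set n k = (\<lambda>I. restrict (unit_ind k I) {1..n}) ` subsets_of_card n k"
proof (intro equalityI subsetI)
  fix x assume "x \<in> sel_set n k"
  then have x: "x \<in> {1..n} \<rightarrow>\<^sub>E {0, 1 / sqrt (real k)}" "(\<Sum>i=1..n. x i) = sqrt (real k)"
    by (auto simp: sel_set_def)
  define I where "I = {i \<in> {1..n}. x i \<noteq> 0}"
  have I: "x i = unit_ind k I i" if "i \<in> {1..n}" for i
    using x(1) that by (force simp: unit_ind_def I_def PiE_iff)
  have "(\<Sum>i=1..n. x i) = real (card I) / sqrt (real k)"
  proof -
    have "(\<Sum>i=1..n. x i) = (\<Sum>i=1..n. 1 * unit_ind k I i)" using I by (intro sum.cong) auto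
    also have "\<dots> = real (card I) / sqrt (real k)"
      by (subst sum_mult_unit_ind) (auto simp: I_def)
    finally show ?thesis .
  qed
  with x(2) assms have "real (card I) = real k" by (simp add: field_simps)
  then have "I \<in> subsets_of_card n k" by (auto simp: subsets_of_card_def I_def)
  moreover have "x = restrict (unit_ind k I) {1..n}"
    using x(1) I by (auto simp: PiE_iff extensional_def restrict_def)
  ultimately show "x \<in> (\<lambda>I. restrict (unit_ind k I) {1..n}) ` subsets_of_card n k" by blast
next
  fix x assume "x \<in> (\<lambda>I. restrict (unit_ind k I) {1..n}) ` subsets_of_card n k"
  then obtain I where I: "I \<subseteq> {1..n}" "card I = k" and x: "x = restrict (unit_ind k I) {1..n}"
    by (auto simp: subsets_of_card_def)
  have "(\<Sum>i=1..n. x i) = real k / sqrt (real k)"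
    unfolding x using sum_mult_unit_ind[OF I(1), of "\<lambda>_. 1" k] I(2) by simp
  also have "\<dots> = sqrt (real k)" by (simp add: real_div_sqrt)
  finally show "x \<in> sel_set n k" by (auto simp: sel_set_def x unit_ind_def)
qed

definition sel_max :: "nat \<Rightarrow> nat \<Rightarrow> (nat \<Rightarrow> real) \<Rightarrow> real" where
  "sel_max n k w = Max ((\<lambda>x. \<Sum>i=1..n. w i * x i) ` sel_set n k)"

lemma sel_max_eq:
  assumes "0 < k"
  shows "sel_max n k w = Max ((\<lambda>I. (\<Sum>i\<in>I. w i) / sqrt (real k)) ` subsets_of_card n k)"
proof -
  have "(\<Sum>i=1..n. w i * restrict (unit_ind k I) {1..n} i) = (\<Sum>i\<in>I. w i) / sqrt (real k)"
    if "I \<in> subsets_of_card n k" for I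
    using sum_mult_unit_ind[of I n w k] that by (simp add: subsets_of_card_def)
  then show ?thesis unfolding sel_max_def sel_set_eq[OF assms] image_image by simp
qed

lemma sel_max_ge:
  "\<lbrakk>0 < k; I \<in> subsets_of_card n k\<rbrakk> \<Longrightarrow> (\<Sum>i\<in>I. w i) / sqrt (real k) \<le> sel_max n k w"
  unfolding sel_max_eq by (intro Max_ge) auto

lemma sel_max_obtain:
  assumes "0 < k" "k \<le> n"
  obtains I where "I \<in> subsets_of_card n k" "sel_max n k w = (\<Sum>i\<in>I. w i) / sqrt (real k)"
proof -
  have "sel_max n k w \<in> (\<lambda>I. (\<Sum>i\<in>I. w i) / sqrt (real k)) ` subsets_of_card n k"
    unfolding sel_max_eq[OF assms(1)] using subsets_of_card_nonempty[OF assms(2)] by (intro Max_in) auto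
  with that show ?thesis by blast
qed

lemma sel_max_restrict: "sel_max n k (restrict w {1..n}) = sel_max n k w"
  unfolding sel_max_def by (intro arg_cong[where f = Max] image_cong refl sum.cong) auto

text \<open>Deliberately crude: it only places the maximum in the growth class that guarantees
  integrability.\<close>

lemma abs_sel_max_le:
  assumes "0 < k" "k \<le> n"
  shows "\<bar>sel_max n k w\<bar> \<le> (\<Sum>i=1..n. \<bar>w i\<bar>)"
proof -
  obtain I where I: "I \<subseteq> {1..n}" "sel_max n k w = (\<Sum>i\<in>I. w i) / sqrt (real k)"
    using sel_max_obtain[OF assms] by (metis (mono_tags, lifting) mem_Collect_eq subsets_of_card_def)
  have "\<bar>\<Sum>i\<in>I. w i\<bar> \<le> (\<Sum>i\<in>I. \<bar>w i\<bar>)" by (rule sum_abs)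
  also have "\<dots> \<le> (\<Sum>i=1..n. \<bar>w i\<bar>)" using I by (intro sum_mono2) auto
  finally have "\<bar>\<Sum>i\<in>I. w i\<bar> \<le> (\<Sum>i=1..n. \<bar>w i\<bar>)" .
  moreover have "\<bar>sel_max n k w\<bar> \<le> \<bar>\<Sum>i\<in>I. w i\<bar>"
    unfolding I(2) abs_divide using assms divide_left_mono[of 1 "sqrt (real k)" "\<bar>\<Sum>i\<in>I. w i\<bar>"] by simp
  ultimately show ?thesis by linarith
qed

lemma measurable_sel_max [measurable]:
  assumes "0 < k"
  shows "sel_max n k \<in> borel_measurable (gauss_PiM {1..n})"
  unfolding sel_max_eq[OF assms, abs_def]
  by (intro borel_measurable_Max borel_measurable_divide borel_measurable_sum)
     (auto simp: subsets_of_card_def)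

lemma std_gauss_vec_eq: "std_gauss_vec n = gauss_PiM {1..n}"
  by (simp add: std_gauss_vec_def)

interpretation std_gauss_vec: prob_space "std_gauss_vec n" for n
  unfolding std_gauss_vec_eq by (rule std_normal_PiM_prob.prob_space_axioms)

lemma integrable_sel_max:
  assumes "0 < k" "k \<le> n"
  shows "integrable (std_gauss_vec n) (\<lambda>w. exp (c * sel_max n k w))"
    and "integrable (std_gauss_vec n) (sel_max n k)"
proof -
  have "\<bar>exp (c * sel_max n k w)\<bar> \<le> 1 * exp (\<bar>c\<bar> * (\<Sum>i=1..n. \<bar>w i\<bar>))" for w
    using abs_sel_max_le[OF assms, of w] mult_left_mono[of "\<bar>sel_max n k w\<bar>" _ "\<bar>c\<bar>"]
    by (simp add: abs_mult[symmetric]) (smt (verit))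
  then show "integrable (std_gauss_vec n) (\<lambda>w. exp (c * sel_max n k w))"
    unfolding std_gauss_vec_eq using assms
    by (intro integrable_std_normal_PiM_bounded[of _ _ 1 "\<bar>c\<bar>"]) measurable
  have "\<bar>sel_max n k w\<bar> \<le> 1 * exp (1 * (\<Sum>i=1..n. \<bar>w i\<bar>))" for w
    using abs_sel_max_le[OF assms, of w] le_exp_self[of "\<Sum>i=1..n. \<bar>w i\<bar>"] by simp
  then show "integrable (std_gauss_vec n) (sel_max n k)"
    unfolding std_gauss_vec_eq using assms
    by (intro integrable_std_normal_PiM_bounded[of _ _ 1 1]) measurable
qed

definition sel_lmgf :: "nat \<Rightarrow> nat \<Rightarrow> real \<Rightarrow> real" where
  "sel_lmgf n k c = ln (\<integral>w. exp (c * sel_max n k w) \<partial>std_gauss_vec n)"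

lemma integral_exp_sel_max_pos:
  assumes "0 < k" "k \<le> n"
  shows "0 < (\<integral>w. exp (c * sel_max n k w) \<partial>std_gauss_vec n)"
  by (rule std_gauss_vec.expectation_greater[OF integrable_sel_max(1)[OF assms]]) simp

text \<open>The bilinear form of the matrix maximised over unit selection vectors; this explains the
  square root in the normalisation. Indexing by pairs makes the matrix a point of a product
  space.\<close>

definition submatrix_max :: "nat \<Rightarrow> nat \<Rightarrow> nat \<Rightarrow> nat \<Rightarrow> (nat \<times> nat \<Rightarrow> real) \<Rightarrow> real" where
  "submatrix_max m n k1 k2 w =
     Max ((\<lambda>(I1, I2). (\<Sum>i\<in>I1. \<Sum>j\<in>I2. w (i, j)) / sqrt (real k1 * real k2)) `
       (subsets_of_card m k1 \<times> subsets_of_card n k2))"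

lemma largest_avg_submatrix_eq:
  assumes "0 < k1" "0 < k2" "k1 \<le> m" "k2 \<le> n"
  shows "largest_avg_submatrix m n k1 k2 A
    = 1 / sqrt (real k1 * real k2) * submatrix_max m n k1 k2 (\<lambda>(i, j). A i j)"
proof -
  let ?S = "subsets_of_card m k1 \<times> subsets_of_card n k2"
  let ?s = "sqrt (real k1 * real k2)"
  have s: "0 < ?s" "?s * ?s = real k1 * real k2" using assms by auto
  have "Max ((\<lambda>x. x / ?s) ` ((\<lambda>(I1, I2). \<Sum>i\<in>I1. \<Sum>j\<in>I2. A i j) ` ?S))
      = Max ((\<lambda>(I1, I2). \<Sum>i\<in>I1. \<Sum>j\<in>I2. A i j) ` ?S) / ?s"
  proof (rule mono_Max_commute[symmetric])
    show "mono (\<lambda>x. x / ?s)" using s by (auto simp: mono_def divide_right_mono)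
  qed (use subsets_of_card_nonempty[OF assms(3)] subsets_of_card_nonempty[OF assms(4)] in auto)
  moreover have "1 / (real k1 * real k2) * x = 1 / ?s * (x / ?s)" for x
    by (subst s(2)[symmetric]) simp
  ultimately show ?thesis
    unfolding largest_avg_submatrix_def submatrix_max_def subsets_of_card_def[symmetric]
    by (simp only: image_image case_prod_unfold fst_conv snd_conv)
qed

text \<open>The split into corner, zeroth column, zeroth row and interior separates the four
  independent ingredients of the comparison.\<close>

lemma sum_grid:
  fixes f :: "nat \<times> nat \<Rightarrow> real"
  shows "sum f ({0..m} \<times> {0..n}) =
    f (0, 0) + (\<Sum>i=1..m. f (i, 0)) + (\<Sum>j=1..n. f (0, j)) + (\<Sum>i=1..m. \<Sum>j=1..n. f (i, j))"
proof -
  have *: "{0..m} = insert 0 {1..m}" for m :: nat by auto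
  show ?thesis unfolding sum.cartesian_product' * by (simp add: sum.distrib)
qed

text \<open>The inner product is \<open>card (I \<inter> I') / k\<close>.\<close>

lemma unit_ind_inner:
  assumes "0 < k" "I \<in> subsets_of_card n k" "I' \<in> subsets_of_card n k"
  shows "(\<Sum>i=1..n. unit_ind k I i * unit_ind k I' i) \<le> 1"
    and "(\<Sum>i=1..n. unit_ind k I i * unit_ind k I i) = 1"
proof -
  have I: "I \<subseteq> {1..n}" "finite I" "card I = k" "I' \<subseteq> {1..n}"
    using assms finite_subset[of _ "{1..n}"] by (auto simp: subsets_of_card_def)
  have inner: "(\<Sum>i=1..n. unit_ind k I i * unit_ind k I'' i) = real (card (I \<inter> I'')) / real k"
    if "I'' \<subseteq> {1..n}" for I''
  proof -
    have "finite I''" using that finite_subset by blast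
    then have "(\<Sum>i\<in>I''. unit_ind k I i) = real (card (I \<inter> I'')) / sqrt (real k)"
      by (simp add: unit_ind_def sum.If_cases Int_commute)
    then show ?thesis unfolding sum_mult_unit_ind[OF that] by simp
  qed
  show "(\<Sum>i=1..n. unit_ind k I i * unit_ind k I' i) \<le> 1"
    unfolding inner[OF I(4)] using card_mono[OF I(2), of "I \<inter> I'"] I(3) assms(1) by simp
  show "(\<Sum>i=1..n. unit_ind k I i * unit_ind k I i) = 1"
    unfolding inner[OF I(1)] using I(3) assms(1) by simp
qed

lemma submatrix_max_obtain:
  assumes "k1 \<le> m" "k2 \<le> n"
  obtains I1 I2 where "I1 \<in> subsets_of_card m k1" "I2 \<in> subsets_of_card n k2"
    "submatrix_max m n k1 k2 w = (\<Sum>i\<in>I1. \<Sum>j\<in>I2. w (i, j)) / sqrt (real k1 * real k2)"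
proof -
  have "submatrix_max m n k1 k2 w \<in> (\<lambda>(I1, I2). (\<Sum>i\<in>I1. \<Sum>j\<in>I2. w (i, j)) / sqrt (real k1 * real k2)) `
       (subsets_of_card m k1 \<times> subsets_of_card n k2)"
    unfolding submatrix_max_def using subsets_of_card_nonempty assms by (intro Max_in) auto
  with that show ?thesis by auto
qed

lemma submatrix_max_cong:
  assumes "\<And>i j. i \<in> {1..m} \<Longrightarrow> j \<in> {1..n} \<Longrightarrow> w (i, j) = w' (i, j)"
  shows "submatrix_max m n k1 k2 w = submatrix_max m n k1 k2 w'"
  unfolding submatrix_max_def
  by (intro arg_cong[where f = Max] image_cong refl)
     (use assms in \<open>auto simp: subsets_of_card_def subset_eq intro!: arg_cong2[where f = "(/)"] sum.cong\<close>)

lemma abs_submatrix_max_le: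
  assumes "0 < k1" "k1 \<le> m" "0 < k2" "k2 \<le> n"
  shows "\<bar>submatrix_max m n k1 k2 w\<bar> \<le> (\<Sum>q\<in>{1..m} \<times> {1..n}. \<bar>w q\<bar>)"
proof -
  obtain I1 I2 where I: "I1 \<in> subsets_of_card m k1" "I2 \<in> subsets_of_card n k2"
    "submatrix_max m n k1 k2 w = (\<Sum>i\<in>I1. \<Sum>j\<in>I2. w (i, j)) / sqrt (real k1 * real k2)"
    using submatrix_max_obtain assms by metis
  have "\<bar>\<Sum>i\<in>I1. \<Sum>j\<in>I2. w (i, j)\<bar> = \<bar>\<Sum>q\<in>I1 \<times> I2. w q\<bar>" by (simp add: sum.cartesian_product')
  also have "\<dots> \<le> (\<Sum>q\<in>I1 \<times> I2. \<bar>w q\<bar>)" by (rule sum_abs)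
  also have "\<dots> \<le> (\<Sum>q\<in>{1..m} \<times> {1..n}. \<bar>w q\<bar>)"
    using I by (intro sum_mono2) (auto simp: subsets_of_card_def)
  finally have "\<bar>\<Sum>i\<in>I1. \<Sum>j\<in>I2. w (i, j)\<bar> \<le> (\<Sum>q\<in>{1..m} \<times> {1..n}. \<bar>w q\<bar>)" .
  moreover have "1 * 1 \<le> real k1 * real k2" using assms by (intro mult_mono) auto
  then have "\<bar>submatrix_max m n k1 k2 w\<bar> \<le> \<bar>\<Sum>i\<in>I1. \<Sum>j\<in>I2. w (i, j)\<bar>"
    unfolding I(3) abs_divide
    using divide_left_mono[of 1 "sqrt (real k1 * real k2)" "\<bar>\<Sum>i\<in>I1. \<Sum>j\<in>I2. w (i, j)\<bar>"] by simp
  ultimately show ?thesis by linarith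
qed

lemma measurable_std_normal_component:
  "i \<in> I \<Longrightarrow> (\<lambda>w. w i) \<in> borel_measurable (gauss_PiM I)"
  using measurable_component_singleton[of i I "\<lambda>_. std_normal_distribution"] by simp

lemma measurable_submatrix_max [measurable]:
  "submatrix_max m n k1 k2 \<in> borel_measurable (gauss_PiM ({1..m} \<times> {1..n}))"
  unfolding submatrix_max_def[abs_def] case_prod_unfold
  by (intro borel_measurable_Max borel_measurable_divide borel_measurable_sum measurable_std_normal_component)
     (auto simp: subsets_of_card_def)

lemma integrable_submatrix_max:
  assumes "0 < k1" "k1 \<le> m" "0 < k2" "k2 \<le> n"
  shows "integrable (gauss_PiM ({1..m} \<times> {1..n})) (submatrix_max m n k1 k2)"
    and "integrable (gauss_PiM ({1..m} \<times> {1..n})) (\<lambda>w. exp (c * submatrix_max m n k1 k2 w))"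
proof -
  have "\<bar>exp (c * submatrix_max m n k1 k2 w)\<bar> \<le> 1 * exp (\<bar>c\<bar> * (\<Sum>q\<in>{1..m} \<times> {1..n}. \<bar>w q\<bar>))" for w
    using abs_submatrix_max_le[OF assms, of w] mult_left_mono[of "\<bar>submatrix_max m n k1 k2 w\<bar>" _ "\<bar>c\<bar>"]
    by (simp add: abs_mult[symmetric]) (smt (verit))
  then show "integrable (gauss_PiM ({1..m} \<times> {1..n})) (\<lambda>w. exp (c * submatrix_max m n k1 k2 w))"
    by (intro integrable_std_normal_PiM_bounded[of _ _ 1 "\<bar>c\<bar>"]) measurable
  have "\<bar>submatrix_max m n k1 k2 w\<bar> \<le> 1 * exp (1 * (\<Sum>q\<in>{1..m} \<times> {1..n}. \<bar>w q\<bar>))" for w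
    using abs_submatrix_max_le[OF assms, of w] le_exp_self[of "\<Sum>q\<in>{1..m} \<times> {1..n}. \<bar>w q\<bar>"] by simp
  then show "integrable (gauss_PiM ({1..m} \<times> {1..n})) (submatrix_max m n k1 k2)"
    by (intro integrable_std_normal_PiM_bounded[of _ _ 1 1]) measurable
qed

text \<open>The factor \<open>exp (c\<^sup>2 / 2)\<close> is the moment generating function of the
  auxiliary scalar and the origin of \<open>- c / 2\<close> in the dual. The maximum is replaced by
  a power of a sum of exponentials: the largest summand alone bounds the left side, and
  \<open>card J\<close> copies of it bound the right side.\<close>

lemma submatrix_comparison:
  assumes k: "0 < k1" "k1 \<le> m" "0 < k2" "k2 \<le> n" and c: "0 < c"
  shows "exp (c\<^sup>2 / 2) *
      (\<integral>w. exp (c * submatrix_max m n k1 k2 w) \<partial>gauss_PiM ({1..m} \<times> {1..n}))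
    \<le> (\<integral>w. exp (c * sel_max m k1 w) \<partial>std_gauss_vec m) * (\<integral>w. exp (c * sel_max n k2 w) \<partial>std_gauss_vec n)"
    (is "?L \<le> ?R")
proof -
  define I where "I = {0..m} \<times> {0..n}"
  define J where "J = subsets_of_card m k1 \<times> subsets_of_card n k2"
  let ?P = "\<lambda>I::(nat \<times> nat) set. gauss_PiM I"
  \<comment> \<open>The entry \<open>(i, j)\<close> with \<open>i, j \<ge> 1\<close> of the Gaussian array plays \<open>A i j\<close>, its zeroth column plays \<open>h\<close>,
    its zeroth row \<open>g\<close>, and its corner the auxiliary scalar that equalises the variances.\<close>
  define a where "a = (\<lambda>(I1, I2) (i, j). if i = 0 \<and> j = 0 then 1 else if i = 0 \<or> j = 0 then 0
    else unit_ind k1 I1 i * unit_ind k2 I2 j)"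
  define b where "b = (\<lambda>(I1, I2) (i, j). if i = 0 \<and> j = 0 then 0 else if j = 0 then unit_ind k1 I1 i
    else if i = 0 then unit_ind k2 I2 j else 0)"
  have fin: "finite I" "finite J" "J \<noteq> {}"
    using subsets_of_card_nonempty k by (auto simp: I_def J_def)
  have aa: "(\<Sum>q\<in>I. a (I1, I2) q * a (I1', I2') q) =
      1 + (\<Sum>i=1..m. unit_ind k1 I1 i * unit_ind k1 I1' i) * (\<Sum>i=1..n. unit_ind k2 I2 i * unit_ind k2 I2' i)"
    for I1 I2 I1' I2'
    unfolding I_def sum_grid by (simp add: a_def sum_product mult_ac)
  have bb: "(\<Sum>q\<in>I. b (I1, I2) q * b (I1', I2') q) =
      (\<Sum>i=1..m. unit_ind k1 I1 i * unit_ind k1 I1' i) + (\<Sum>i=1..n. unit_ind k2 I2 i * unit_ind k2 I2' i)"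
    for I1 I2 I1' I2'
    unfolding I_def sum_grid by (simp add: b_def)
  have orth: "(\<Sum>q\<in>I. a j q * b l q) = 0" for j l
    unfolding I_def sum_grid by (cases j, cases l) (simp add: a_def b_def)
  have var: "(\<Sum>q\<in>I. a j q * a j q) = (\<Sum>q\<in>I. b j q * b j q)" if jJ: "j \<in> J" for j
  proof -
    obtain I1 I2 where j: "j = (I1, I2)" "I1 \<in> subsets_of_card m k1" "I2 \<in> subsets_of_card n k2"
      using jJ by (auto simp: J_def)
    show ?thesis unfolding j(1) aa bb
      using unit_ind_inner(2)[OF k(1) j(2) j(2)] unit_ind_inner(2)[OF k(3) j(3) j(3)] by simp
  qed
  have cov: "(\<Sum>q\<in>I. b j q * b l q) \<le> (\<Sum>q\<in>I. a j q * a l q)" if jJ: "j \<in> J" "l \<in> J" for j l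
  proof -
    obtain I1 I2 I1' I2' where j: "j = (I1, I2)" "I1 \<in> subsets_of_card m k1" "I2 \<in> subsets_of_card n k2"
      and l: "l = (I1', I2')" "I1' \<in> subsets_of_card m k1" "I2' \<in> subsets_of_card n k2"
      using jJ by (auto simp: J_def)
    let ?x = "\<Sum>i=1..m. unit_ind k1 I1 i * unit_ind k1 I1' i"
    let ?y = "\<Sum>i=1..n. unit_ind k2 I2 i * unit_ind k2 I2' i"
    have "0 \<le> (1 - ?x) * (1 - ?y)"
      using unit_ind_inner(1)[OF k(1) j(2) l(2)] unit_ind_inner(1)[OF k(3) j(3) l(3)]
      by (intro mult_nonneg_nonneg) auto
    then show ?thesis unfolding j(1) l(1) aa bb by (simp add: algebra_simps)
  qed
  have a_sum: "(\<Sum>q\<in>I. a (I1, I2) q * w q) = w (0, 0) + (\<Sum>i\<in>I1. \<Sum>j\<in>I2. w (i, j)) / sqrt (real k1 * real k2)"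
    if "(I1, I2) \<in> J" for I1 I2 w
  proof -
    have "I1 \<subseteq> {1..m}" "I2 \<subseteq> {1..n}" using that by (auto simp: J_def subsets_of_card_def)
    then have "(\<Sum>i=1..m. (\<Sum>j=1..n. w (i, j) * unit_ind k2 I2 j) * unit_ind k1 I1 i)
        = (\<Sum>i\<in>I1. (\<Sum>j\<in>I2. w (i, j)) / sqrt (real k2)) / sqrt (real k1)"
      by (simp only: sum_mult_unit_ind)
    also have "\<dots> = (\<Sum>i\<in>I1. \<Sum>j\<in>I2. w (i, j)) / sqrt (real k1 * real k2)"
      by (simp add: sum_divide_distrib[symmetric] real_sqrt_mult)
    finally show ?thesis
      unfolding I_def sum_grid by (simp add: a_def sum_distrib_left sum_distrib_right mult_ac)
  qed
  have b_sum: "(\<Sum>q\<in>I. b (I1, I2) q * w q) =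
      (\<Sum>i\<in>I1. w (i, 0)) / sqrt (real k1) + (\<Sum>j\<in>I2. w (0, j)) / sqrt (real k2)"
    if "(I1, I2) \<in> J" for I1 I2 w
    using sum_mult_unit_ind[of I1 m "\<lambda>i. w (i, 0)" k1] sum_mult_unit_ind[of I2 n "\<lambda>j. w (0, j)" k2] that
    unfolding I_def sum_grid by (simp add: b_def J_def subsets_of_card_def mult.commute)
  let ?U = "\<lambda>w. sel_max m k1 (\<lambda>i. w (i, 0)) + sel_max n k2 (\<lambda>j. w (0, j))"
  let ?V = "\<lambda>w. w (0, 0) + submatrix_max m n k1 k2 w"
  define A where "A = {1..m} \<times> {0::nat}"
  define B where "B = {0::nat} \<times> {1..n}"
  let ?F = "\<lambda>w. exp (c * sel_max m k1 (\<lambda>i. w (i, 0)))"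
  let ?G = "\<lambda>w. exp (c * sel_max n k2 (\<lambda>j. w (0, j)))"
  have restr: "?F w = exp (c * sel_max m k1 (\<lambda>i\<in>{1..m}. w (i, 0)))"
    "?G w = exp (c * sel_max n k2 (\<lambda>i\<in>{1..n}. w (0, i)))" for w
    by (simp_all only: sel_max_restrict)
  have mA: "(\<lambda>w. \<lambda>i\<in>{1..m}. w (i, 0)) \<in> ?P A \<rightarrow>\<^sub>M gauss_PiM {1..m}"
    by (intro measurable_restrict measurable_component_singleton) (auto simp: A_def)
  have mB: "(\<lambda>w. \<lambda>i\<in>{1..n}. w (0, i)) \<in> ?P B \<rightarrow>\<^sub>M gauss_PiM {1..n}"
    by (intro measurable_restrict measurable_component_singleton) (auto simp: B_def)
  have mFG: "?F \<in> borel_measurable (?P A)" "?G \<in> borel_measurable (?P B)"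
    unfolding restr using k measurable_compose[OF mA measurable_sel_max[OF k(1)]]
      measurable_compose[OF mB measurable_sel_max[OF k(3)]] by measurable
  have intF: "(\<integral>w. ?F w \<partial>?P A) = (\<integral>w. exp (c * sel_max m k1 w) \<partial>std_gauss_vec m)"
    unfolding restr std_gauss_vec_eq
    using measurable_sel_max[OF k(1)]
    by (intro integral_std_normal_PiM_reindex[of "\<lambda>i. (i, 0)" "{1..m}" A "\<lambda>w. exp (c * sel_max m k1 w)"])
       (auto simp: inj_on_def A_def)
  have intG: "(\<integral>w. ?G w \<partial>?P B) = (\<integral>w. exp (c * sel_max n k2 w) \<partial>std_gauss_vec n)"
    unfolding restr std_gauss_vec_eq
    using measurable_sel_max[OF k(3)]
    by (intro integral_std_normal_PiM_reindex[of "\<lambda>i. (0, i)" "{1..n}" B "\<lambda>w. exp (c * sel_max n k2 w)"])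
       (auto simp: inj_on_def B_def)
  have boundF: "\<bar>?F w\<bar> \<le> 1 * exp (c * (\<Sum>q\<in>A. \<bar>w q\<bar>))" for w
    using abs_sel_max_le[OF k(1,2), of "\<lambda>i. w (i, 0)"] c
    by (simp add: A_def sum.cartesian_product')
  have boundG: "\<bar>?G w\<bar> \<le> 1 * exp (c * (\<Sum>q\<in>B. \<bar>w q\<bar>))" for w
    using abs_sel_max_le[OF k(3,4), of "\<lambda>i. w (0, i)"] c
    by (simp add: B_def sum.cartesian_product')
  have R: "(\<integral>w. exp (c * ?U w) \<partial>?P I) = ?R"
  proof -
    have *: "exp (c * ?U w) = ?F (restrict w A) * ?G (restrict w B)" for w
    proof -
      have "(\<lambda>i\<in>{1..m}. restrict w A (i, 0)) = (\<lambda>i\<in>{1..m}. w (i, 0))"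
        "(\<lambda>i\<in>{1..n}. restrict w B (0, i)) = (\<lambda>i\<in>{1..n}. w (0, i))"
        by (auto simp: A_def B_def restrict_def)
      then show ?thesis unfolding restr by (simp only: sel_max_restrict distrib_left exp_add)
    qed
    have AB: "A \<inter> B = {}" "A \<union> B \<subseteq> I" by (auto simp: A_def B_def I_def)
    show ?thesis unfolding * intF[symmetric] intG[symmetric]
      by (rule integral_std_normal_PiM_mult[OF AB fin(1) mFG boundF boundG])
  qed
  define D where "D = {1..m} \<times> {1..n}"
  let ?H = "\<lambda>w. exp (c * submatrix_max m n k1 k2 w)"
  have mgf0: "(\<integral>w. exp (c * w (0, 0)) \<partial>?P {(0, 0)}) = exp (c\<^sup>2 / 2)"
    using std_normal_PiM.product_integral_singleton[of "\<lambda>x. exp (c * x)" "(0::nat, 0::nat)"] std_normal_mgf by simp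
  have boundH: "\<bar>?H w\<bar> \<le> 1 * exp (c * (\<Sum>q\<in>D. \<bar>w q\<bar>))" for w
    using abs_submatrix_max_le[OF k, of w] c by (simp add: D_def)
  have VH: "exp (c * ?V w) = exp (c * restrict w {(0, 0)} (0, 0)) * ?H (restrict w D)" for w
    using submatrix_max_cong[of m n w "restrict w D"] by (simp add: D_def distrib_left exp_add)
  have L: "(\<integral>w. exp (c * ?V w) \<partial>?P I) = ?L"
  proof -
    have 0: "{(0, 0)} \<inter> D = {}" "{(0, 0)} \<union> D \<subseteq> I" by (auto simp: D_def I_def)
    have m: "(\<lambda>w. exp (c * w (0, 0))) \<in> borel_measurable (?P {(0, 0)})"
      by (simp add: measurable_std_normal_component)
    have m': "?H \<in> borel_measurable (?P D)"
      unfolding D_def by measurable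
    have b: "\<bar>exp (c * w (0, 0))\<bar> \<le> 1 * exp (c * (\<Sum>q\<in>{(0, 0)}. \<bar>w q\<bar>))" for w :: "nat \<times> nat \<Rightarrow> real"
      using c by simp
    show ?thesis unfolding VH D_def[symmetric] mgf0[symmetric]
      by (rule integral_std_normal_PiM_mult[OF 0 fin(1) m m' b boundH])
  qed
  have intU: "integrable (?P I) (\<lambda>w. exp (c * ?U w))" and intV: "integrable (?P I) (\<lambda>w. exp (c * ?V w))"
  proof -
    have [measurable]: "(\<lambda>w. sel_max m k1 (\<lambda>i. w (i, 0))) \<in> borel_measurable (?P I)"
      "(\<lambda>w. sel_max n k2 (\<lambda>i. w (0, i))) \<in> borel_measurable (?P I)"
      "submatrix_max m n k1 k2 \<in> borel_measurable (?P I)" "(\<lambda>w. w (0, 0)) \<in> borel_measurable (?P I)"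
      unfolding sel_max_eq[OF k(1)] sel_max_eq[OF k(3)] submatrix_max_def[abs_def] case_prod_unfold
      by (auto simp: subsets_of_card_def I_def
        intro!: borel_measurable_Max borel_measurable_divide borel_measurable_sum measurable_std_normal_component)
    have I_sum: "(\<Sum>q\<in>I. \<bar>w q\<bar>) = \<bar>w (0, 0)\<bar> + (\<Sum>i=1..m. \<bar>w (i, 0)\<bar>) + (\<Sum>j=1..n. \<bar>w (0, j)\<bar>)
        + (\<Sum>q\<in>{1..m} \<times> {1..n}. \<bar>w q\<bar>)" for w :: "nat \<times> nat \<Rightarrow> real"
      unfolding I_def sum_grid sum.cartesian_product'[of _ "{1..m}"] ..
    have nonneg: "0 \<le> (\<Sum>i=1..m. \<bar>w (i, 0)\<bar>)" "0 \<le> (\<Sum>j=1..n. \<bar>w (0, j)\<bar>)"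
      "0 \<le> (\<Sum>q\<in>{1..m} \<times> {1..n}. \<bar>w q\<bar>)" for w :: "nat \<times> nat \<Rightarrow> real"
      by (auto intro!: sum_nonneg)
    have "?U w \<le> (\<Sum>q\<in>I. \<bar>w q\<bar>)" "?V w \<le> (\<Sum>q\<in>I. \<bar>w q\<bar>)" for w
      unfolding I_sum using nonneg[of w] abs_submatrix_max_le[OF k, of w]
        abs_sel_max_le[OF k(1,2), of "\<lambda>i. w (i, 0)"] abs_sel_max_le[OF k(3,4), of "\<lambda>i. w (0, i)"]
      by linarith+
    then have "\<bar>exp (c * ?U w)\<bar> \<le> 1 * exp (c * (\<Sum>q\<in>I. \<bar>w q\<bar>))"
      "\<bar>exp (c * ?V w)\<bar> \<le> 1 * exp (c * (\<Sum>q\<in>I. \<bar>w q\<bar>))" for w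
      using c by (auto simp del: mult_le_cancel_left_pos intro!: mult_left_mono)
    then show "integrable (?P I) (\<lambda>w. exp (c * ?U w))" "integrable (?P I) (\<lambda>w. exp (c * ?V w))"
      using fin by (intro integrable_std_normal_PiM_bounded[of _ _ 1 c]; measurable)+
  qed
  \<comment> \<open>Taking \<open>\<theta> = c / p\<close> turns
    \<open>exp (p * z) powr \<theta>\<close> into \<open>exp (c * z)\<close>, and
    \<open>c < p\<close> makes the exponent admissible.\<close>
  have main: "?L \<le> real (card J) powr (c / p) * ?R" if p: "c < p" for p
  proof -
    have \<theta>: "0 < p" "0 < c / p" "c / p < 1" using c p by auto
    have "exp (c * ?V w) \<le> (\<Sum>j\<in>J. exp (p * (\<Sum>q\<in>I. a j q * w q))) powr (c / p)" for w
    proof -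
      obtain I1 I2 where j: "I1 \<in> subsets_of_card m k1" "I2 \<in> subsets_of_card n k2"
        "submatrix_max m n k1 k2 w = (\<Sum>i\<in>I1. \<Sum>j\<in>I2. w (i, j)) / sqrt (real k1 * real k2)"
        using submatrix_max_obtain k by metis
      then have V: "?V w = (\<Sum>q\<in>I. a (I1, I2) q * w q)" and jJ: "(I1, I2) \<in> J"
        using a_sum[of I1 I2 w] by (auto simp: J_def)
      have "exp (c * ?V w) = exp (p * ?V w) powr (c / p)"
        using \<theta> by (simp add: exp_powr_real)
      also have "\<dots> \<le> (\<Sum>j\<in>J. exp (p * (\<Sum>q\<in>I. a j q * w q))) powr (c / p)"
        unfolding V using fin jJ \<theta>
        by (intro powr_mono2 member_le_sum[where f = "\<lambda>j. exp (p * (\<Sum>q\<in>I. a j q * w q))"]) auto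
      finally show ?thesis .
    qed
    then have "?L \<le> (\<integral>w. (\<Sum>j\<in>J. exp (p * (\<Sum>q\<in>I. a j q * w q))) powr (c / p) \<partial>?P I)"
      unfolding L[symmetric]
      using intV gaussian_comparison_integrable[OF fin \<theta> orth var cov]
      by (intro integral_mono) auto
    also have "\<dots> \<le> (\<integral>w. (\<Sum>j\<in>J. exp (p * (\<Sum>q\<in>I. b j q * w q))) powr (c / p) \<partial>?P I)"
      by (rule gaussian_comparison_powr[OF fin \<theta> orth var cov])
    also have "\<dots> \<le> (\<integral>w. real (card J) powr (c / p) * exp (c * ?U w) \<partial>?P I)"
    proof (rule integral_mono')
      fix w
      have "exp (p * (\<Sum>q\<in>I. b j q * w q)) \<le> exp (p * ?U w)" if jJ: "j \<in> J" for j
      proof -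
        obtain I1 I2 where j: "j = (I1, I2)" "I1 \<in> subsets_of_card m k1" "I2 \<in> subsets_of_card n k2"
          using jJ by (auto simp: J_def)
        show ?thesis
          using b_sum[of I1 I2 w] jJ \<theta> sel_max_ge[OF k(1) j(2), of "\<lambda>i. w (i, 0)"]
            sel_max_ge[OF k(3) j(3), of "\<lambda>i. w (0, i)"] by (simp add: j(1))
      qed
      then have "(\<Sum>j\<in>J. exp (p * (\<Sum>q\<in>I. b j q * w q))) \<le> real (card J) * exp (p * ?U w)"
        by (intro sum_bounded_above)
      then have "(\<Sum>j\<in>J. exp (p * (\<Sum>q\<in>I. b j q * w q))) powr (c / p)
          \<le> (real (card J) * exp (p * ?U w)) powr (c / p)"
        using \<theta> by (intro powr_mono2) (auto intro: sum_nonneg)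
      also have "\<dots> = real (card J) powr (c / p) * exp (c * ?U w)"
        using \<theta> by (simp add: powr_mult exp_powr_real)
      finally show "(\<Sum>j\<in>J. exp (p * (\<Sum>q\<in>I. b j q * w q))) powr (c / p)
          \<le> real (card J) powr (c / p) * exp (c * ?U w)" .
    qed (use intU in auto)
    finally show ?thesis using R by simp
  qed
  \<comment> \<open>The number of competitors enters only through
    \<open>card J powr (c / p)\<close>, which tends to 1.\<close>
  have "((\<lambda>p. real (card J) powr (c / p) * ?R) \<longlongrightarrow> real (card J) powr 0 * ?R) at_top"
    using fin by (intro tendsto_intros tendsto_powr real_tendsto_divide_at_top[OF tendsto_const filterlim_ident]) auto
  then have "?L \<le> real (card J) powr 0 * ?R"
    by (rule tendsto_lowerbound[OF _ eventually_mono[OF eventually_gt_at_top[of c] main]]) simp_all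
  then show ?thesis using fin by simp
qed

lemma expectation_le_ln_expectation_exp:
  fixes X :: "'a \<Rightarrow> real"
  assumes "prob_space M" "integrable M X" "integrable M (\<lambda>x. exp (X x))"
  shows "(\<integral>x. X x \<partial>M) \<le> ln (\<integral>x. exp (X x) \<partial>M)"
proof -
  interpret prob_space M by fact
  have "exp (\<integral>x. X x \<partial>M) \<le> (\<integral>x. exp (X x) \<partial>M)"
    using assms(2,3) exp_convex by (intro jensens_inequality[where I = UNIV]) auto
  moreover from this have "0 < (\<integral>x. exp (X x) \<partial>M)"
    by (rule less_le_trans[OF exp_gt_zero])
  ultimately show ?thesis by (simp add: ln_ge_iff)
qed

lemma lifted_dual_eq:
  "lifted_dual m n k1 k2 = 1 / sqrt (real k1 * real k2) *
    (INF c\<in>{0<..}. - c / 2 + 1 / c * sel_lmgf m k1 c + 1 / c * sel_lmgf n k2 c)"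
  unfolding lifted_dual_def sel_lmgf_def sel_max_def ..

lemma submatrix_max_le_dual:
  assumes k: "0 < k1" "k1 \<le> m" "0 < k2" "k2 \<le> n" and c: "0 < c"
  shows "(\<integral>w. submatrix_max m n k1 k2 w \<partial>gauss_PiM ({1..m} \<times> {1..n}))
    \<le> - c / 2 + 1 / c * sel_lmgf m k1 c + 1 / c * sel_lmgf n k2 c"
proof -
  let ?P = "gauss_PiM ({1..m} \<times> {1..n})"
  let ?X = "\<integral>w. exp (c * submatrix_max m n k1 k2 w) \<partial>?P"
  have int: "integrable ?P (\<lambda>w. c * submatrix_max m n k1 k2 w)"
    using integrable_submatrix_max(1)[OF k] by simp
  have "c * (\<integral>w. submatrix_max m n k1 k2 w \<partial>?P) \<le> ln ?X"
    using expectation_le_ln_expectation_exp[OF std_normal_PiM_prob.prob_space_axioms int integrable_submatrix_max(2)[OF k]]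
    by simp
  also have "ln ?X = ln (exp (c\<^sup>2 / 2) * ?X) - c\<^sup>2 / 2"
  proof -
    have "0 < ?X"
      by (rule std_normal_PiM_prob.expectation_greater[OF integrable_submatrix_max(2)[OF k]]) simp
    then show ?thesis by (simp add: ln_mult)
  qed
  also have "ln (exp (c\<^sup>2 / 2) * ?X) \<le> sel_lmgf m k1 c + sel_lmgf n k2 c"
  proof -
    have "0 < ?X"
      by (rule std_normal_PiM_prob.expectation_greater[OF integrable_submatrix_max(2)[OF k]]) simp
    then have "ln (exp (c\<^sup>2 / 2) * ?X) \<le> ln ((\<integral>w. exp (c * sel_max m k1 w) \<partial>std_gauss_vec m) *
        (\<integral>w. exp (c * sel_max n k2 w) \<partial>std_gauss_vec n))"
      using submatrix_comparison[OF k c] by (intro ln_mono) auto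
    then show ?thesis
      using integral_exp_sel_max_pos[OF k(1,2), of c] integral_exp_sel_max_pos[OF k(3,4), of c]
      by (simp add: sel_lmgf_def ln_mult)
  qed
  finally show ?thesis using c by (simp add: field_simps power2_eq_square)
qed

text \<open>Independence and normality of the entries say that the array, restricted to its index
  grid, has the product Gaussian law, so its expectation can be computed there. The bound holds at
  every \<open>c\<close>, hence at the infimum.\<close>

lemma expectation_largest_avg_submatrix_le:
  assumes k: "0 < k1" "k1 \<le> m" "0 < k2" "k2 \<le> n"
    and M: "prob_space M"
    and indep: "prob_space.indep_vars M (\<lambda>_. borel) (\<lambda>(i, j). A i j) ({1..m} \<times> {1..n})"
    and normal: "\<And>i j. i \<in> {1..m} \<Longrightarrow> j \<in> {1..n} \<Longrightarrow>
      distributed M lborel (A i j) (\<lambda>x. ennreal (std_normal_density x))"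
  shows "(\<integral>\<omega>. largest_avg_submatrix m n k1 k2 (\<lambda>i j. A i j \<omega>) \<partial>M) \<le> lifted_dual m n k1 k2"
proof -
  interpret M: prob_space M by fact
  define D where "D = {1..m} \<times> {1..n}"
  define a where "a = (\<lambda>\<omega>. \<lambda>q\<in>D. (case q of (i, j) \<Rightarrow> A i j) \<omega>)"
  let ?P = "\<lambda>I. gauss_PiM I"
  have rv: "(case q of (i, j) \<Rightarrow> A i j) \<in> borel_measurable M" if "q \<in> D" for q
    using distributed_measurable[OF normal] that by (auto simp: D_def)
  have dist: "distr M borel (case q of (i, j) \<Rightarrow> A i j) = std_normal_distribution" if "q \<in> D" for q
  proof -
    have "distr M borel (case q of (i, j) \<Rightarrow> A i j) = distr M lborel (case q of (i, j) \<Rightarrow> A i j)"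
      by (intro distr_cong) auto
    then show ?thesis using distributed_distr_eq_density[OF normal] that by (auto simp: D_def)
  qed
  have "distr M (Pi\<^sub>M D (\<lambda>_. borel)) a = Pi\<^sub>M D (\<lambda>q. distr M borel (case q of (i, j) \<Rightarrow> A i j))"
    unfolding a_def using indep k rv
    by (subst M.indep_vars_iff_distr_eq_PiM'[symmetric]) (auto simp: D_def)
  also have "\<dots> = ?P D"
    using dist by (intro PiM_cong refl) auto
  finally have distr: "distr M (Pi\<^sub>M D (\<lambda>_. borel)) a = ?P D" .
  have a: "a \<in> M \<rightarrow>\<^sub>M Pi\<^sub>M D (\<lambda>_. borel)"
    unfolding a_def using rv by (intro measurable_restrict) auto
  have sets: "sets (?P D) = sets (Pi\<^sub>M D (\<lambda>_. borel))"
    by (intro sets_PiM_cong) auto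
  have "(\<integral>\<omega>. largest_avg_submatrix m n k1 k2 (\<lambda>i j. A i j \<omega>) \<partial>M)
      = (\<integral>\<omega>. 1 / sqrt (real k1 * real k2) * submatrix_max m n k1 k2 (a \<omega>) \<partial>M)"
  proof (intro Bochner_Integration.integral_cong refl)
    fix \<omega>
    have "submatrix_max m n k1 k2 (\<lambda>(i, j). A i j \<omega>) = submatrix_max m n k1 k2 (a \<omega>)"
      by (rule submatrix_max_cong) (simp add: a_def D_def)
    then show "largest_avg_submatrix m n k1 k2 (\<lambda>i j. A i j \<omega>) =
        1 / sqrt (real k1 * real k2) * submatrix_max m n k1 k2 (a \<omega>)"
      using k by (subst largest_avg_submatrix_eq) auto
  qed
  also have "\<dots> = 1 / sqrt (real k1 * real k2) * (\<integral>\<omega>. submatrix_max m n k1 k2 (a \<omega>) \<partial>M)"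
    by simp
  also have "(\<integral>\<omega>. submatrix_max m n k1 k2 (a \<omega>) \<partial>M) = (\<integral>w. submatrix_max m n k1 k2 w \<partial>?P D)"
    unfolding distr[symmetric]
    by (rule integral_distr[symmetric, OF a])
       (use measurable_submatrix_max[of m n k1 k2] measurable_cong_sets[OF sets refl] in \<open>auto simp: D_def\<close>)
  also have "1 / sqrt (real k1 * real k2) * \<dots> \<le> lifted_dual m n k1 k2"
    unfolding lifted_dual_eq D_def using submatrix_max_le_dual[OF k]
    by (intro mult_left_mono cINF_greatest) auto
  finally show ?thesis .
qed

section \<open>Sums of the largest entries under a product law\<close>

text \<open>Both measures agree on boxes, where the product integral factorises. It turns an
  entrywise tilt into an explicit density for the whole vector.\<close>

lemma PiM_density_const:
  fixes f :: "'b \<Rightarrow> ennreal"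
  assumes I: "finite I" and N: "prob_space N" and [measurable]: "f \<in> borel_measurable N"
    and D: "prob_space (density N f)"
  shows "density (Pi\<^sub>M I (\<lambda>_. N)) (\<lambda>w. \<Prod>i\<in>I. f (w i)) = Pi\<^sub>M I (\<lambda>_. density N f)"
proof -
  interpret N: product_sigma_finite "\<lambda>_. N"
    using N by (simp add: product_sigma_finite_def prob_space_imp_sigma_finite)
  interpret D: product_sigma_finite "\<lambda>_. density N f"
    using D by (simp add: product_sigma_finite_def prob_space_imp_sigma_finite)
  show ?thesis
  proof (rule D.PiM_eqI[OF I])
    show "sets (density (Pi\<^sub>M I (\<lambda>_. N)) (\<lambda>w. \<Prod>i\<in>I. f (w i))) = sets (Pi\<^sub>M I (\<lambda>_. density N f))"
      by (auto intro!: sets_PiM_cong)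
    fix A assume "\<And>i. i \<in> I \<Longrightarrow> A i \<in> sets (density N f)"
    then have A: "\<And>i. i \<in> I \<Longrightarrow> A i \<in> sets N" by simp
    have "emeasure (density (Pi\<^sub>M I (\<lambda>_. N)) (\<lambda>w. \<Prod>i\<in>I. f (w i))) (Pi\<^sub>E I A)
        = (\<integral>\<^sup>+w. (\<Prod>i\<in>I. f (w i)) * indicator (Pi\<^sub>E I A) w \<partial>Pi\<^sub>M I (\<lambda>_. N))"
      using A I by (intro emeasure_density) (auto intro!: sets_PiM_I_finite)
    also have "\<dots> = (\<integral>\<^sup>+w. (\<Prod>i\<in>I. f (w i) * indicator (A i) (w i)) \<partial>Pi\<^sub>M I (\<lambda>_. N))"
    proof (rule nn_integral_cong)
      fix w assume "w \<in> space (Pi\<^sub>M I (\<lambda>_. N))"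
      then have "indicator (Pi\<^sub>E I A) w = (\<Prod>i\<in>I. indicator (A i) (w i) :: ennreal)"
        using I by (auto simp: space_PiM PiE_iff indicator_def intro!: prod_zero[symmetric])
      then show "(\<Prod>i\<in>I. f (w i)) * indicator (Pi\<^sub>E I A) w = (\<Prod>i\<in>I. f (w i) * indicator (A i) (w i))"
        by (simp add: prod.distrib)
    qed
    also have "\<dots> = (\<Prod>i\<in>I. \<integral>\<^sup>+x. f x * indicator (A i) x \<partial>N)"
      using A I by (intro N.product_nn_integral_prod) auto
    also have "\<dots> = (\<Prod>i\<in>I. emeasure (density N f) (A i))"
      using A by (intro prod.cong refl) (simp add: emeasure_density)
    finally show "emeasure (density (Pi\<^sub>M I (\<lambda>_. N)) (\<lambda>w. \<Prod>i\<in>I. f (w i))) (Pi\<^sub>E I A)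
        = (\<Prod>i\<in>I. emeasure (density N f) (A i))" .
  qed
qed

text \<open>Some \<open>k\<close> elements have at least the average of \<open>B\<close>, stated
  without division. Dropping a smallest element is harmless, since its value is at most the average
  over the \<open>k\<close> elements that survive.\<close>

lemma obtain_heavy_subset:
  fixes f :: "'a \<Rightarrow> real"
  assumes "finite B" "k \<le> card B"
  obtains I where "I \<subseteq> B" "card I = k" "real k * sum f B \<le> real (card B) * sum f I"
proof -
  have "\<exists>I\<subseteq>B. card I = k \<and> real k * sum f B \<le> real (card B) * sum f I"
    using assms
  proof (induction "card B - k" arbitrary: B)
    case 0
    then show ?case by (intro exI[of _ B]) auto
  next
    case (Suc d)
    then have B: "B \<noteq> {}" "finite B" by auto
    then obtain x where x: "x \<in> B" "\<And>y. y \<in> B \<Longrightarrow> f x \<le> f y"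
      using ex_min_if_finite[of "f ` B"] by (metis (no_types, lifting) finite_imageI image_is_empty imageE imageI linorder_not_less)
    let ?B = "B - {x}"
    have c: "card ?B = card B - 1" using x B by simp
    have "d = card ?B - k" "finite ?B" "k \<le> card ?B" using Suc c B by auto
    from Suc.hyps(1)[OF this(1,2,3)] obtain I where I: "I \<subseteq> ?B" "card I = k"
      "real k * sum f ?B \<le> real (card ?B) * sum f I" by auto
    have fI: "real k * f x \<le> sum f I"
      using I x sum_bounded_below[of I "f x" f] by auto
    have "sum f B = f x + sum f ?B" using x B by (simp add: sum.remove)
    moreover have "real (card B) = 1 + real (card ?B)" using c Suc(2) by auto
    ultimately have "real k * sum f B \<le> real (card B) * sum f I"
      using I(3) fI by (simp add: algebra_simps)
    then show ?case using I by auto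
  qed
  then show ?thesis using that by blast
qed

lemma sel_max_le:
  assumes "0 < k" "k \<le> n"
  shows "sel_max n k w \<le> sqrt (real k) * l + (\<Sum>i=1..n. max 0 (w i - l)) / sqrt (real k)"
proof -
  obtain I where I: "I \<subseteq> {1..n}" "card I = k" "sel_max n k w = (\<Sum>i\<in>I. w i) / sqrt (real k)"
    using sel_max_obtain[OF assms] by (metis (mono_tags, lifting) mem_Collect_eq subsets_of_card_def)
  have "(\<Sum>i\<in>I. w i) \<le> (\<Sum>i\<in>I. l + max 0 (w i - l))" by (intro sum_mono) auto
  also have "\<dots> = real k * l + (\<Sum>i\<in>I. max 0 (w i - l))" using I by (simp add: sum.distrib)
  also have "\<dots> \<le> real k * l + (\<Sum>i=1..n. max 0 (w i - l))"
    using I by (intro add_left_mono sum_mono2) auto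
  finally have "sel_max n k w \<le> (real k * l + (\<Sum>i=1..n. max 0 (w i - l))) / sqrt (real k)"
    unfolding I(3) by (intro divide_right_mono) auto
  also have "\<dots> = real k / sqrt (real k) * l + (\<Sum>i=1..n. max 0 (w i - l)) / sqrt (real k)"
    by (simp add: add_divide_distrib)
  also have "real k / sqrt (real k) = sqrt (real k)" by (simp add: real_div_sqrt)
  finally show ?thesis .
qed

\<comment> \<open>The deviation from the threshold sum is controlled by how far the number of entries above the
  threshold is from \<open>k\<close>: the surplus or deficit is averaged over the competing entries.\<close>
lemma sel_max_ge_threshold:
  fixes l :: real and w :: "nat \<Rightarrow> real"
  assumes k: "0 < k" "k < n"
  defines "N \<equiv> card {i \<in> {1..n}. l < w i}"
  shows "real k * l + (\<Sum>i=1..n. max 0 (w i - l))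
      - \<bar>real (N) - real k\<bar> / real (min k (n - k)) * (\<Sum>i=1..n. \<bar>w i - l\<bar>)
    \<le> sqrt (real k) * sel_max n k w"
proof -
  define T where "T = {i \<in> {1..n}. l < w i}"
  \<comment> \<open>A lower bound for the number of competing entries: at least \<open>k\<close> lie
    above the threshold in a surplus, and more than \<open>n - k\<close> do not in a
    deficit.\<close>
  define D where "D = real (min k (n - k))"
  have D: "0 < D" "D \<le> real k" "D \<le> real (n - k)" using k by (auto simp: D_def)
  have T: "finite T" "T \<subseteq> {1..n}" "card T = N" by (auto simp: T_def N_def)
  let ?f = "\<lambda>i. w i - l"
  define R where "R = {1..n} - T"
  have R: "finite R" "R \<subseteq> {1..n}" "card R = n - N" using T by (auto simp: R_def card_Diff_subset)
  have Y: "(\<Sum>i=1..n. max 0 (w i - l)) = sum ?f T"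
  proof -
    have "(\<Sum>i=1..n. max 0 (w i - l)) = (\<Sum>i\<in>T. max 0 (w i - l))"
      by (rule sum.mono_neutral_right) (auto simp: T_def)
    also have "\<dots> = sum ?f T" by (intro sum.cong) (auto simp: T_def)
    finally show ?thesis .
  qed
  let ?W = "\<Sum>i=1..n. \<bar>w i - l\<bar>"
  have W: "0 \<le> ?W" by (intro sum_nonneg) auto
  have sums_le: "\<bar>sum ?f T\<bar> \<le> ?W" "\<bar>sum ?f R\<bar> \<le> ?W"
    using T R by (auto intro!: order_trans[OF sum_abs] sum_mono2)
  have step: "\<bar>real (N) - real k\<bar> / E * \<bar>x\<bar> \<le> \<bar>real (N) - real k\<bar> / D * ?W"
    if "\<bar>x\<bar> \<le> ?W" "D \<le> E" for x E
    using that D W by (intro mult_mono divide_left_mono) auto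
  have "\<exists>I\<subseteq>{1..n}. card I = k \<and> sum ?f T - \<bar>real (N) - real k\<bar> / D * ?W \<le> sum ?f I"
  proof (cases "k \<le> N")
    \<comment> \<open>Surplus: choosing the best \<open>k\<close> entries above the threshold loses
      at most the fraction \<open>(N - k) / N\<close> of their total excess.\<close>
    case True
    obtain I where I: "I \<subseteq> T" "card I = k" "real k * sum ?f T \<le> real (card T) * sum ?f I"
      using obtain_heavy_subset[of T k ?f] T True by metis
    have N: "0 < real (N)" using True k by simp
    have "\<bar>real (N) - real k\<bar> / real (N) * \<bar>sum ?f T\<bar> \<le> \<bar>real (N) - real k\<bar> / D * ?W"
      using True D by (intro step sums_le) auto
    moreover have "0 \<le> sum ?f T" by (intro sum_nonneg) (auto simp: T_def)
    then have "\<bar>real (N) - real k\<bar> / real (N) * \<bar>sum ?f T\<bar> = sum ?f T - real k * sum ?f T / real (N)"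
      using True N by (simp add: field_simps)
    moreover have "real k * sum ?f T / real (N) \<le> sum ?f I"
      using I(3) N T by (simp add: field_simps)
    ultimately show ?thesis using I T by (intro exI[of _ I]) auto
  next
    \<comment> \<open>Deficit: every entry above the threshold is kept, and the missing
      \<open>k - N\<close> ones are filled at no less than the average of the rest.\<close>
    case False
    have "k - N \<le> card R" using R k by auto
    then obtain I where I: "I \<subseteq> R" "card I = k - N"
      "real (k - N) * sum ?f R \<le> real (card R) * sum ?f I"
      using obtain_heavy_subset[of R "k - N" ?f] R by metis
    have E: "0 < real (n - N)" "D \<le> real (n - N)" using False k D by auto
    have "\<bar>real (N) - real k\<bar> / real (n - N) * \<bar>sum ?f R\<bar> \<le> \<bar>real (N) - real k\<bar> / D * ?W"
      using E by (intro step sums_le) auto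
    moreover have "- (\<bar>real (N) - real k\<bar> / real (n - N) * \<bar>sum ?f R\<bar>)
        \<le> real (k - N) * sum ?f R / real (n - N)"
    proof -
      have "- (\<bar>real (N) - real k\<bar> / real (n - N) * \<bar>sum ?f R\<bar>)
          = real (k - N) / real (n - N) * - \<bar>sum ?f R\<bar>" using False by simp
      also have "\<dots> \<le> real (k - N) / real (n - N) * sum ?f R"
        by (intro mult_left_mono) auto
      finally show ?thesis by simp
    qed
    moreover have "real (k - N) * sum ?f R / real (n - N) \<le> sum ?f I"
      using I(3) E R by (simp add: field_simps)
    moreover have "sum ?f (T \<union> I) = sum ?f T + sum ?f I" "card (T \<union> I) = card T + card I"
    proof -
      have "T \<inter> I = {}" "finite I" using I(1) R(1) finite_subset by (auto simp: R_def)
      then show "sum ?f (T \<union> I) = sum ?f T + sum ?f I" "card (T \<union> I) = card T + card I"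
        using T by (auto intro: sum.union_disjoint card_Un_disjoint)
    qed
    ultimately show ?thesis using I T R False
      by (intro exI[of _ "T \<union> I"]) auto
  qed
  then obtain I where I: "I \<subseteq> {1..n}" "card I = k"
    "sum ?f T - \<bar>real (N) - real k\<bar> / D * ?W \<le> sum ?f I" by blast
  have "sum ?f I = (\<Sum>i\<in>I. w i) - real k * l" using I by (simp add: sum_subtractf)
  moreover have "(\<Sum>i\<in>I. w i) \<le> sqrt (real k) * sel_max n k w"
    using sel_max_ge[of k I n w] I k by (simp add: subsets_of_card_def field_simps)
  ultimately show ?thesis using I(3) unfolding Y D_def[symmetric] by linarith
qed

lemma
  assumes "prob_space \<nu>" "i \<in> I" and f: "f \<in> borel_measurable \<nu>"
  shows integrable_PiM_component: "integrable (Pi\<^sub>M I (\<lambda>_. \<nu>)) (\<lambda>w. f (w i)) \<longleftrightarrow> integrable \<nu> f"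
    and integral_PiM_component: "(\<integral>w. f (w i) \<partial>Pi\<^sub>M I (\<lambda>_. \<nu>)) = (\<integral>x. f x \<partial>\<nu> :: real)"
proof -
  have *: "distr (Pi\<^sub>M I (\<lambda>_. \<nu>)) \<nu> (\<lambda>w. w i) = \<nu>"
    using distr_PiM_component[of I "\<lambda>_. \<nu>" i] assms by simp
  have m: "(\<lambda>w. w i) \<in> Pi\<^sub>M I (\<lambda>_. \<nu>) \<rightarrow>\<^sub>M \<nu>" using assms(2) by simp
  show "integrable (Pi\<^sub>M I (\<lambda>_. \<nu>)) (\<lambda>w. f (w i)) \<longleftrightarrow> integrable \<nu> f"
    using integrable_distr_eq[OF m f] unfolding * by simp
  show "(\<integral>w. f (w i) \<partial>Pi\<^sub>M I (\<lambda>_. \<nu>)) = (\<integral>x. f x \<partial>\<nu> :: real)"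
    using integral_distr[OF m f] unfolding * by simp
qed

lemma integral_PiM_two_components:
  fixes f :: "'a \<Rightarrow> real"
  assumes \<nu>: "prob_space \<nu>" and ij: "finite I" "i \<in> I" "j \<in> I" "i \<noteq> j" and f: "integrable \<nu> f"
  shows "integrable (Pi\<^sub>M I (\<lambda>_. \<nu>)) (\<lambda>w. f (w i) * f (w j))"
    and "(\<integral>w. f (w i) * f (w j) \<partial>Pi\<^sub>M I (\<lambda>_. \<nu>)) = (\<integral>x. f x \<partial>\<nu>)\<^sup>2"
proof -
  interpret prob_space \<nu> by fact
  interpret P: product_sigma_finite "\<lambda>_. \<nu>"
    by (simp add: product_sigma_finite_def sigma_finite_measure_axioms)
  let ?g = "\<lambda>q. if q = i \<or> q = j then f else (\<lambda>_. 1)"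
  have *: "(\<Prod>q\<in>I. if q = i \<or> q = j then F q else 1) = F i * F j" for F :: "_ \<Rightarrow> real"
    using ij by (subst prod.remove[of _ i], simp, simp, subst prod.remove[of _ j]) auto
  have g: "(\<Prod>q\<in>I. ?g q (w q)) = f (w i) * f (w j)" for w
    using *[of "\<lambda>q. f (w q)"] by (simp add: if_distrib[of "\<lambda>h. h _"] cong: if_cong)
  have int: "integrable \<nu> (?g q)" for q using f by simp
  show "integrable (Pi\<^sub>M I (\<lambda>_. \<nu>)) (\<lambda>w. f (w i) * f (w j))"
    using P.product_integrable_prod[of I ?g] ij int unfolding g by simp
  have "(\<integral>w. f (w i) * f (w j) \<partial>Pi\<^sub>M I (\<lambda>_. \<nu>)) = (\<Prod>q\<in>I. integral\<^sup>L \<nu> (?g q))"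
    using P.product_integral_prod[of I ?g] ij int unfolding g by simp
  also have "\<dots> = (\<Prod>q\<in>I. if q = i \<or> q = j then integral\<^sup>L \<nu> f else 1)"
    by (intro prod.cong) (auto simp: prob_space)
  finally show "(\<integral>w. f (w i) * f (w j) \<partial>Pi\<^sub>M I (\<lambda>_. \<nu>)) = (\<integral>x. f x \<partial>\<nu>)\<^sup>2"
    unfolding * by (simp add: power2_eq_square)
qed

text \<open>Off-diagonal products vanish by independence and centring, and each diagonal term is at
  most 1.\<close>

lemma integral_sum_square_centered:
  fixes f :: "'a \<Rightarrow> real"
  assumes \<nu>: "prob_space \<nu>" and I: "finite I" and f: "f \<in> borel_measurable \<nu>" "\<And>x. \<bar>f x\<bar> \<le> 1"
    and zero: "(\<integral>x. f x \<partial>\<nu>) = 0"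
  shows "integrable (Pi\<^sub>M I (\<lambda>_. \<nu>)) (\<lambda>w. (\<Sum>i\<in>I. f (w i))\<^sup>2)"
    and "(\<integral>w. (\<Sum>i\<in>I. f (w i))\<^sup>2 \<partial>Pi\<^sub>M I (\<lambda>_. \<nu>)) \<le> real (card I)"
proof -
  interpret prob_space \<nu> by fact
  let ?P = "Pi\<^sub>M I (\<lambda>_. \<nu>)"
  have int_f: "integrable \<nu> f" using f by (intro integrable_const_bound[of _ 1]) auto
  have f2: "(f x)\<^sup>2 \<le> 1" for x using f(2)[of x] by (simp add: abs_square_le_1)
  have int_f2: "integrable \<nu> (\<lambda>x. (f x)\<^sup>2)" using f f2 by (intro integrable_const_bound[of _ 1]) auto
  have sq: "(\<Sum>i\<in>I. f (w i))\<^sup>2 = (\<Sum>i\<in>I. \<Sum>j\<in>I. f (w i) * f (w j))" for w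
    by (simp add: power2_eq_square sum_product)
  have int: "integrable ?P (\<lambda>w. f (w i) * f (w j))" if "i \<in> I" "j \<in> I" for i j
  proof (cases "i = j")
    case True
    then show ?thesis
      using integrable_PiM_component[OF \<nu> that(1), of "\<lambda>x. (f x)\<^sup>2"] int_f2 f(1) by (simp add: power2_eq_square)
  qed (use integral_PiM_two_components(1)[OF \<nu> I that _ int_f] in auto)
  show "integrable ?P (\<lambda>w. (\<Sum>i\<in>I. f (w i))\<^sup>2)"
    unfolding sq using int by (intro Bochner_Integration.integrable_sum) auto
  have "(\<integral>w. (\<Sum>i\<in>I. f (w i))\<^sup>2 \<partial>?P) = (\<Sum>i\<in>I. \<Sum>j\<in>I. \<integral>w. f (w i) * f (w j) \<partial>?P)"
    unfolding sq using int by (simp add: Bochner_Integration.integral_sum Bochner_Integration.integrable_sum)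
  also have "\<dots> \<le> (\<Sum>i\<in>I. \<Sum>j\<in>I. if i = j then 1 else 0)"
  proof (intro sum_mono)
    fix i j assume ij: "i \<in> I" "j \<in> I"
    show "(\<integral>w. f (w i) * f (w j) \<partial>?P) \<le> (if i = j then 1 else 0)"
    proof (cases "i = j")
      case True
      have "(\<integral>w. f (w i) * f (w j) \<partial>?P) = (\<integral>x. (f x)\<^sup>2 \<partial>\<nu>)"
        using integral_PiM_component[OF \<nu> ij(1), of "\<lambda>x. (f x)\<^sup>2"] f(1) True by (simp add: power2_eq_square)
      also have "\<dots> \<le> 1" using int_f2 f2 by (intro integral_le_const) auto
      finally show ?thesis using True by simp
    next
      case False
      then show ?thesis using integral_PiM_two_components(2)[OF \<nu> I ij False int_f] zero by simp
    qed
  qed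
  also have "\<dots> = real (card I)" using I by simp
  finally show "(\<integral>w. (\<Sum>i\<in>I. f (w i))\<^sup>2 \<partial>?P) \<le> real (card I)" .
qed

lemma (in prob_space) expectation_combination:
  fixes A B C :: "'a \<Rightarrow> real"
  assumes "integrable M A" "integrable M B" "integrable M C"
  shows "integrable M (\<lambda>w. x + A w - (t * (B w + y) + z * C w / s) / D)"
    and "expectation (\<lambda>w. x + A w - (t * (B w + y) + z * C w / s) / D)
      = x + expectation A - (t * (expectation B + y) + z * expectation C / s) / D"
  using assms by (simp_all add: prob_space)

text \<open>The error of the threshold bound is a product of two dependent sums, the miscount
  \<open>\<bar>N - k\<bar>\<close> and the total deviation \<open>W\<close>. The inequality
  \<open>x * y \<le> t / 2 * x\<^sup>2 + y\<^sup>2 / (2 * t)\<close> separates them: the squared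
  miscount has variance of order \<open>n\<close> plus a bias, while the mean of
  \<open>W\<^sup>2\<close> is only bounded by order \<open>n\<^sup>2\<close>. A large
  \<open>t\<close> makes the second part small, and its cost in the first part is negligible as
  \<open>n\<close> grows.\<close>

lemma expectation_sel_max_ge:
  fixes \<nu> :: "real measure"
  assumes \<nu>: "prob_space \<nu>" "sets \<nu> = sets borel" and sq: "integrable \<nu> (\<lambda>x. (x - l)\<^sup>2)"
    and tail: "measure \<nu> {l<..} = b" and k: "0 < k" "k < n" and t: "0 < t"
  shows "integrable (Pi\<^sub>M {1..n} (\<lambda>_. \<nu>)) (sel_max n k)"
    and "real k * l + real n * (\<integral>x. max 0 (x - l) \<partial>\<nu>)
      - (t * (real n + (real n * b - real k)\<^sup>2) + (real n)\<^sup>2 * (\<integral>x. (x - l)\<^sup>2 \<partial>\<nu>) / (2 * t)) / real (min k (n - k))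
      \<le> sqrt (real k) * (\<integral>w. sel_max n k w \<partial>Pi\<^sub>M {1..n} (\<lambda>_. \<nu>))"
proof -
  interpret prob_space \<nu> by fact
  have meas [measurable]: "f \<in> borel_measurable \<nu>" if "f \<in> borel_measurable borel" for f :: "real \<Rightarrow> real"
    using that measurable_cong_sets[OF \<nu>(2) refl] by blast
  have UNIV: "space \<nu> = UNIV" using sets_eq_imp_space_eq[OF \<nu>(2)] by simp
  let ?P = "Pi\<^sub>M {1..n} (\<lambda>_. \<nu>)"
  interpret P: prob_space ?P by (rule prob_space_PiM) (rule \<nu>(1))
  have comp: "integrable ?P (\<lambda>w. f (w i))" "(\<integral>w. f (w i) \<partial>?P) = (\<integral>x. f x \<partial>\<nu>)"
    if "i \<in> {1..n}" "integrable \<nu> f" for f :: "real \<Rightarrow> real" and i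
    by (rule integrable_PiM_component[THEN iffD2, OF \<nu>(1) that(1) borel_measurable_integrable that(2)])
      (rule that(2) integral_PiM_component[OF \<nu>(1) that(1) borel_measurable_integrable])+
  have abs1: "\<bar>x - l\<bar> \<le> 1 + (x - l)\<^sup>2" for x
  proof -
    have "0 \<le> (\<bar>x - l\<bar> - 1)\<^sup>2" by simp
    then show ?thesis by (simp add: power2_diff)
      (smt (verit) zero_le_power2)
  qed
  have int1: "integrable \<nu> f" if "f \<in> borel_measurable borel" "\<And>x. \<bar>f x\<bar> \<le> \<bar>x - l\<bar> + C" for f C
  proof (rule Bochner_Integration.integrable_bound)
    show "integrable \<nu> (\<lambda>x. 1 + (x - l)\<^sup>2 + C)" using sq by simp
    show "AE x in \<nu>. norm (f x) \<le> norm (1 + (x - l)\<^sup>2 + C)"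
    proof (rule AE_I2)
      fix x show "norm (f x) \<le> norm (1 + (x - l)\<^sup>2 + C)"
        using that(2)[of x] abs1[of x] by simp
    qed
  qed (rule meas[OF that(1)])
  have intY: "integrable \<nu> (\<lambda>x. max 0 (x - l))" by (rule int1[of _ 0]) auto
  have intabs: "integrable \<nu> (\<lambda>x. \<bar>x\<bar>)" by (rule int1[of _ "\<bar>l\<bar>"]) auto
  have meas_comp: "(\<lambda>w. w i) \<in> borel_measurable ?P" if "i \<in> {1..n}" for i
    using measurable_component_singleton[OF that, of "\<lambda>_. \<nu>"] measurable_cong_sets[OF refl \<nu>(2)] by blast
  have "sel_max n k \<in> borel_measurable ?P"
    unfolding sel_max_eq[OF k(1), abs_def]
    by (intro borel_measurable_Max borel_measurable_divide borel_measurable_sum meas_comp)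
       (auto simp: subsets_of_card_def)
  then show int_sel: "integrable ?P (sel_max n k)"
  proof (rule Bochner_Integration.integrable_bound[rotated])
    show "integrable ?P (\<lambda>w. \<Sum>i=1..n. \<bar>w i\<bar>)"
      by (intro Bochner_Integration.integrable_sum comp(1) intabs)
    show "AE w in ?P. norm (sel_max n k w) \<le> norm (\<Sum>i=1..n. \<bar>w i\<bar>)"
      using abs_sel_max_le[of k n] k by (intro AE_I2) (simp add: sum_nonneg)
  qed
  let ?\<xi> = "\<lambda>x. indicator {l<..} x - b :: real"
  have b: "0 \<le> b" "b \<le> 1" using tail by auto
  have \<xi>: "(\<integral>x. ?\<xi> x \<partial>\<nu>) = 0"
  proof -
    have "integrable \<nu> (\<lambda>x. indicator {l<..} x :: real)"
      by (rule integrable_const_bound[of _ 1]) (auto intro: meas)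
    then show ?thesis using tail UNIV prob_space by simp
  qed
  have \<xi>_bound: "\<bar>?\<xi> x\<bar> \<le> 1" for x using b by (auto simp: indicator_def)
  have \<xi>_meas: "?\<xi> \<in> borel_measurable \<nu>" by (rule meas) measurable
  note sq_\<xi> = integral_sum_square_centered[OF \<nu>(1) _ \<xi>_meas \<xi>_bound \<xi>, of "{1..n}"]
  define D where "D = real (min k (n - k))"
  have D: "0 < D" using k by (simp add: D_def)
  let ?low = "\<lambda>w. real k * l + (\<Sum>i=1..n. max 0 (w i - l))
    - (t * ((\<Sum>i=1..n. ?\<xi> (w i))\<^sup>2 + (real n * b - real k)\<^sup>2) + real n * (\<Sum>i=1..n. (w i - l)\<^sup>2) / (2 * t)) / D"
  have low: "?low w \<le> sqrt (real k) * sel_max n k w" for w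
  proof -
    let ?N = "real (card {i \<in> {1..n}. l < w i})"
    let ?W = "\<Sum>i=1..n. \<bar>w i - l\<bar>"
    let ?S = "\<Sum>i=1..n. ?\<xi> (w i)"
    have N: "?S = ?N - real n * b"
      by (simp add: sum_subtractf indicator_def sum.If_cases Int_def)
    \<comment> \<open>The miscount is the fluctuation \<open>?S\<close> plus the bias
      \<open>n * b - k\<close>; the estimate is
      \<open>(x + y)\<^sup>2 \<le> 2 * (x\<^sup>2 + y\<^sup>2)\<close>, obtained from the square of
      their difference.\<close>
    have A: "(?N - real k)\<^sup>2 \<le> 2 * (?S\<^sup>2 + (real n * b - real k)\<^sup>2)"
      unfolding N using sum_squares_ge_zero[of "?N - 2 * (real n * b) + real k" 0]
      by (simp add: power2_eq_square algebra_simps)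
    have B: "?W\<^sup>2 \<le> real n * (\<Sum>i=1..n. (w i - l)\<^sup>2)"
      using Cauchy_Schwarz_ineq_sum[of "\<lambda>_. 1" "\<lambda>i. \<bar>w i - l\<bar>" "{1..n}"] by simp
    have C: "\<bar>?N - real k\<bar> * ?W \<le> t / 2 * (?N - real k)\<^sup>2 + ?W\<^sup>2 / (2 * t)"
    proof -
      have "0 \<le> (t * \<bar>?N - real k\<bar> - ?W)\<^sup>2 / (2 * t)" using t by simp
      also have "\<dots> = t / 2 * (?N - real k)\<^sup>2 + ?W\<^sup>2 / (2 * t) - \<bar>?N - real k\<bar> * ?W"
        using t by (simp add: power2_diff field_simps power_mult_distrib power2_eq_square)
      finally show ?thesis by simp
    qed
    have A': "t / 2 * (?N - real k)\<^sup>2 \<le> t * (?S\<^sup>2 + (real n * b - real k)\<^sup>2)"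
    proof -
      have "t / 2 * (?N - real k)\<^sup>2 \<le> t / 2 * (2 * (?S\<^sup>2 + (real n * b - real k)\<^sup>2))"
        using A t by (intro mult_left_mono) auto
      also have "\<dots> = t * (?S\<^sup>2 + (real n * b - real k)\<^sup>2)" by simp
      finally show ?thesis .
    qed
    have B': "?W\<^sup>2 / (2 * t) \<le> real n * (\<Sum>i=1..n. (w i - l)\<^sup>2) / (2 * t)"
      using B t by (intro divide_right_mono) auto
    have "\<bar>?N - real k\<bar> * ?W
        \<le> t * (?S\<^sup>2 + (real n * b - real k)\<^sup>2) + real n * (\<Sum>i=1..n. (w i - l)\<^sup>2) / (2 * t)"
      by (rule order_trans[OF C add_mono[OF A' B']])
    then have "\<bar>?N - real k\<bar> / D * ?W
        \<le> (t * (?S\<^sup>2 + (real n * b - real k)\<^sup>2) + real n * (\<Sum>i=1..n. (w i - l)\<^sup>2) / (2 * t)) / D"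
      using D by (simp add: divide_right_mono)
    then show ?thesis using sel_max_ge_threshold[OF k, of l w] unfolding D_def[symmetric] by linarith
  qed
  have intYs: "integrable ?P (\<lambda>w. \<Sum>i=1..n. max 0 (w i - l))"
    by (intro Bochner_Integration.integrable_sum comp(1) intY)
  have EYs: "(\<integral>w. (\<Sum>i=1..n. max 0 (w i - l)) \<partial>?P) = real n * (\<integral>x. max 0 (x - l) \<partial>\<nu>)"
    using comp[OF _ intY] by (simp add: Bochner_Integration.integral_sum)
  have intV: "integrable ?P (\<lambda>w. \<Sum>i=1..n. (w i - l)\<^sup>2)"
    by (intro Bochner_Integration.integrable_sum comp(1) sq)
  have EV: "(\<integral>w. (\<Sum>i=1..n. (w i - l)\<^sup>2) \<partial>?P) = real n * (\<integral>x. (x - l)\<^sup>2 \<partial>\<nu>)"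
    using comp[OF _ sq] by (simp add: Bochner_Integration.integral_sum)
  have "real k * l + real n * (\<integral>x. max 0 (x - l) \<partial>\<nu>)
      - (t * (real n + (real n * b - real k)\<^sup>2) + (real n)\<^sup>2 * (\<integral>x. (x - l)\<^sup>2 \<partial>\<nu>) / (2 * t)) / D
    \<le> real k * l + real n * (\<integral>x. max 0 (x - l) \<partial>\<nu>)
      - (t * ((\<integral>w. (\<Sum>i=1..n. ?\<xi> (w i))\<^sup>2 \<partial>?P) + (real n * b - real k)\<^sup>2)
        + real n * (real n * (\<integral>x. (x - l)\<^sup>2 \<partial>\<nu>)) / (2 * t)) / D"
    using sq_\<xi>(2) D t
    by (intro diff_left_mono divide_right_mono add_mono mult_left_mono) (auto simp: power2_eq_square)
  also have "\<dots> = (\<integral>w. ?low w \<partial>?P)"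
    unfolding EYs[symmetric] EV[symmetric]
    by (rule P.expectation_combination(2)[symmetric]) (simp_all only: sq_\<xi>(1) intYs intV finite_atLeastAtMost)
  also have "\<dots> \<le> (\<integral>w. sqrt (real k) * sel_max n k w \<partial>?P)"
    by (rule integral_mono[OF P.expectation_combination(1) _ low])
       (simp_all only: sq_\<xi>(1) intYs intV finite_atLeastAtMost integrable_mult_right int_sel)
  finally show "real k * l + real n * (\<integral>x. max 0 (x - l) \<partial>\<nu>)
      - (t * (real n + (real n * b - real k)\<^sup>2) + (real n)\<^sup>2 * (\<integral>x. (x - l)\<^sup>2 \<partial>\<nu>) / (2 * t)) / real (min k (n - k))
      \<le> sqrt (real k) * (\<integral>w. sel_max n k w \<partial>?P)"
    unfolding D_def by simp
qed

section \<open>The tilted Gaussian law\<close>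

definition trunc_mgf :: "real \<Rightarrow> real \<Rightarrow> real" where
  "trunc_mgf a l = (\<integral>x. exp (a * max 0 (x - l)) \<partial>std_normal_distribution)"

abbreviation upper_tail :: "real \<Rightarrow> real" where
  "upper_tail l \<equiv> measure std_normal_distribution {l<..}"

lemma exp_trunc_bound: "\<bar>exp (a * max 0 (x - l))\<bar> \<le> exp (\<bar>a\<bar> * \<bar>l\<bar>) * exp (\<bar>a\<bar> * \<bar>x\<bar>)" for a x l :: real
proof -
  have "a * max 0 (x - l) \<le> \<bar>a\<bar> * (\<bar>l\<bar> + \<bar>x\<bar>)"
  proof -
    have "a * max 0 (x - l) \<le> \<bar>a\<bar> * max 0 (x - l)" by (intro mult_right_mono) auto
    also have "\<dots> \<le> \<bar>a\<bar> * (\<bar>l\<bar> + \<bar>x\<bar>)" by (intro mult_left_mono) auto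
    finally show ?thesis .
  qed
  then show ?thesis by (simp flip: exp_add add: distrib_left)
qed

lemma integrable_trunc: "integrable std_normal_distribution (\<lambda>x. exp (a * max 0 (x - l)))"
  by (rule integrable_std_normal_bounded[OF _ exp_trunc_bound]) measurable

lemma trunc_mgf_pos: "0 < trunc_mgf a l"
  unfolding trunc_mgf_def by (rule std_normal.expectation_greater[OF integrable_trunc]) simp

lemma cdf_std_normal: "cdf std_normal_distribution l = 1 - upper_tail l"
proof -
  have "- {..l} = {l<..}" by auto
  then show ?thesis
    using std_normal.prob_compl[of "{..l}"] by (simp add: cdf_def Compl_eq_Diff_UNIV)
qed

lemma isCont_upper_tail: "isCont upper_tail l"
proof -
  interpret real_distribution std_normal_distribution by (rule real_dist_normal_dist)
  have "AE x in lborel. x \<in> {l} \<longrightarrow> \<not> 0 < ennreal (std_normal_density x)"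
    using AE_lborel_singleton[of l] by eventually_elim auto
  then have "measure std_normal_distribution {l} = 0"
    by (simp add: measure_def emeasure_density nn_integral_0_iff_AE)
  then have "isCont (\<lambda>l. 1 - cdf std_normal_distribution l) l"
    using isCont_cdf by (intro continuous_intros) auto
  then show ?thesis unfolding cdf_std_normal by simp
qed

lemma upper_tail_at_top: "(upper_tail \<longlongrightarrow> 0) at_top"
  and upper_tail_at_bot: "(upper_tail \<longlongrightarrow> 1) at_bot"
proof -
  interpret real_distribution std_normal_distribution by (rule real_dist_normal_dist)
  have "((\<lambda>l. 1 - cdf std_normal_distribution l) \<longlongrightarrow> 1 - 1) at_top"
    "((\<lambda>l. 1 - cdf std_normal_distribution l) \<longlongrightarrow> 1 - 0) at_bot"
    by (intro tendsto_intros cdf_lim_at_top_prob cdf_lim_at_bot)+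
  then show "(upper_tail \<longlongrightarrow> 0) at_top" "(upper_tail \<longlongrightarrow> 1) at_bot"
    unfolding cdf_std_normal by simp_all
qed

lemma integral_exp_tail:
  "integrable std_normal_distribution (\<lambda>x. exp (a * x) * indicator {l<..} x)"
  "(\<integral>x. exp (a * x) * indicator {l<..} x \<partial>std_normal_distribution) = exp (a\<^sup>2 / 2) * upper_tail (l - a)"
proof -
  have *: "(\<lambda>x. indicator {l<..} (x + a) :: real) = indicator {l - a<..}"
    by (auto simp: indicator_def fun_eq_iff)
  have "integrable std_normal_distribution (\<lambda>x. indicator {l - a<..} x :: real)"
    by (rule std_normal.integrable_const_bound[of _ 1]) auto
  then show "integrable std_normal_distribution (\<lambda>x. exp (a * x) * indicator {l<..} x)"
    by (subst std_normal_cameron_martin_integrable) (simp_all add: *)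
  show "(\<integral>x. exp (a * x) * indicator {l<..} x \<partial>std_normal_distribution) = exp (a\<^sup>2 / 2) * upper_tail (l - a)"
    by (subst std_normal_cameron_martin) (simp_all add: *)
qed

text \<open>The cut \<open>m\<close> may differ from the level \<open>l\<close>; the small-density
  lower bound cuts at a point that does not depend on the level.\<close>

lemma integral_exp_tail_shift:
  "integrable std_normal_distribution (\<lambda>x. exp (a * (x - l)) * indicator {m<..} x)"
  "(\<integral>x. exp (a * (x - l)) * indicator {m<..} x \<partial>std_normal_distribution)
    = exp (a\<^sup>2 / 2 - a * l) * upper_tail (m - a)"
proof -
  have *: "exp (a * (x - l)) * indicator {m<..} x = exp (- a * l) * (exp (a * x) * indicator {m<..} x)" for x
    by (simp add: algebra_simps exp_diff exp_minus field_simps)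
  show "integrable std_normal_distribution (\<lambda>x. exp (a * (x - l)) * indicator {m<..} x)"
    unfolding * using integral_exp_tail(1) by simp
  show "(\<integral>x. exp (a * (x - l)) * indicator {m<..} x \<partial>std_normal_distribution)
    = exp (a\<^sup>2 / 2 - a * l) * upper_tail (m - a)"
  proof -
    have "exp (a\<^sup>2 / 2 - a * l) = exp (- a * l) * exp (a\<^sup>2 / 2)" by (simp flip: exp_add)
    then show ?thesis unfolding * using integral_exp_tail(2)[of a m] by simp
  qed
qed

lemma trunc_mgf_eq: "trunc_mgf a l = 1 - upper_tail l + exp (a\<^sup>2 / 2 - a * l) * upper_tail (l - a)"
proof -
  have *: "exp (a * max 0 (x - l)) = 1 - indicator {l<..} x + exp (a * (x - l)) * indicator {l<..} x" for x
    by (auto simp: indicator_def)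
  have "integrable std_normal_distribution (\<lambda>x. indicator {l<..} x :: real)"
    by (rule std_normal.integrable_const_bound[of _ 1]) auto
  then show ?thesis unfolding trunc_mgf_def * using integral_exp_tail_shift[of a l l] std_normal.prob_space
    by simp
qed

definition tilted :: "real \<Rightarrow> real \<Rightarrow> real measure" where
  "tilted a l = density std_normal_distribution (\<lambda>x. ennreal (exp (a * max 0 (x - l)) / trunc_mgf a l))"

lemma sets_tilted [simp, measurable_cong]: "sets (tilted a l) = sets borel"
  by (simp add: tilted_def)

lemma
  fixes f :: "real \<Rightarrow> real"
  assumes [measurable]: "f \<in> borel_measurable borel"
  shows integrable_tilted: "integrable (tilted a l) f \<longleftrightarrow>
      integrable std_normal_distribution (\<lambda>x. exp (a * max 0 (x - l)) * f x)"
    and integral_tilted: "(\<integral>x. f x \<partial>tilted a l) =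
      (\<integral>x. exp (a * max 0 (x - l)) * f x \<partial>std_normal_distribution) / trunc_mgf a l"
proof -
  have 0: "exp (a * max 0 (x - l)) / trunc_mgf a l * y = exp (a * max 0 (x - l)) * y / trunc_mgf a l" for x y
    by simp
  have Z: "trunc_mgf a l \<noteq> 0" "\<And>x. 0 \<le> exp (a * max 0 (x - l)) / trunc_mgf a l"
    using trunc_mgf_pos[of a l] by (auto intro: less_imp_le)
  have "integrable (tilted a l) f \<longleftrightarrow>
      integrable std_normal_distribution (\<lambda>x. exp (a * max 0 (x - l)) / trunc_mgf a l * f x)"
    unfolding tilted_def using Z(2) by (subst integrable_density) simp_all
  then show "integrable (tilted a l) f \<longleftrightarrow>
      integrable std_normal_distribution (\<lambda>x. exp (a * max 0 (x - l)) * f x)"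
    unfolding 0 divide_inverse using Z(1) by (simp add: mult.commute[of _ "inverse _"] mult.assoc)
  have "(\<integral>x. f x \<partial>tilted a l)
      = (\<integral>x. exp (a * max 0 (x - l)) / trunc_mgf a l * f x \<partial>std_normal_distribution)"
    unfolding tilted_def using Z(2) by (subst integral_density) simp_all
  then show "(\<integral>x. f x \<partial>tilted a l) =
      (\<integral>x. exp (a * max 0 (x - l)) * f x \<partial>std_normal_distribution) / trunc_mgf a l"
    unfolding 0 by simp
qed

lemma prob_space_tilted: "prob_space (tilted a l)"
proof
  have "emeasure (tilted a l) (space (tilted a l)) =
      (\<integral>\<^sup>+x. ennreal (exp (a * max 0 (x - l)) / trunc_mgf a l) \<partial>std_normal_distribution)"
    unfolding tilted_def by (subst emeasure_density) (auto intro!: nn_integral_cong)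
  also have "\<dots> = ennreal (\<integral>x. exp (a * max 0 (x - l)) / trunc_mgf a l \<partial>std_normal_distribution)"
    using integrable_trunc trunc_mgf_pos[of a l] by (intro nn_integral_eq_integral) (auto intro: less_imp_le)
  also have "\<dots> = 1" using trunc_mgf_pos[of a l] by (simp add: trunc_mgf_def)
  finally show "emeasure (tilted a l) (space (tilted a l)) = 1" .
qed

lemma integrable_tilted_bounded:
  assumes "f \<in> borel_measurable borel" "\<And>x. \<bar>f x\<bar> \<le> C * exp (K * \<bar>x\<bar>)"
  shows "integrable (tilted a l) f"
  unfolding integrable_tilted[OF assms(1)]
proof (rule integrable_std_normal_bounded)
  show "\<bar>exp (a * max 0 (x - l)) * f x\<bar> \<le> (exp (\<bar>a\<bar> * \<bar>l\<bar>) * C) * exp ((\<bar>a\<bar> + K) * \<bar>x\<bar>)" for x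
  proof -
    have "\<bar>exp (a * max 0 (x - l)) * f x\<bar> \<le> (exp (\<bar>a\<bar> * \<bar>l\<bar>) * exp (\<bar>a\<bar> * \<bar>x\<bar>)) * (C * exp (K * \<bar>x\<bar>))"
      unfolding abs_mult using exp_trunc_bound assms(2) by (intro mult_mono) auto
    also have "\<dots> = (exp (\<bar>a\<bar> * \<bar>l\<bar>) * C) * exp ((\<bar>a\<bar> + K) * \<bar>x\<bar>)"
      unfolding distrib_right exp_add by (simp only: mult_ac)
    finally show ?thesis .
  qed
qed (use assms(1) in measurable)

lemma exp_abs_dominates: "\<bar>x - l\<bar> \<le> (1 + \<bar>l\<bar>) * exp (1 * \<bar>x\<bar>)" "(x - l)\<^sup>2 \<le> (1 + \<bar>l\<bar>)\<^sup>2 * exp (2 * \<bar>x\<bar>)" for x l :: real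
proof -
  have "1 \<le> exp \<bar>x\<bar>" by simp
  then have "\<bar>l\<bar> * 1 \<le> \<bar>l\<bar> * exp \<bar>x\<bar>" by (intro mult_left_mono) auto
  then show *: "\<bar>x - l\<bar> \<le> (1 + \<bar>l\<bar>) * exp (1 * \<bar>x\<bar>)"
    using le_exp_self[of "\<bar>x\<bar>"] by (simp add: distrib_right)
  have "(x - l)\<^sup>2 = \<bar>x - l\<bar>\<^sup>2" by simp
  also have "\<dots> \<le> ((1 + \<bar>l\<bar>) * exp (1 * \<bar>x\<bar>))\<^sup>2" using * by (intro power_mono) auto
  finally show "(x - l)\<^sup>2 \<le> (1 + \<bar>l\<bar>)\<^sup>2 * exp (2 * \<bar>x\<bar>)" by (simp add: power_mult_distrib exp_double)
qed

lemma integrable_tilted_trunc: "integrable (tilted a l) (\<lambda>x. max 0 (x - l))"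
proof (rule integrable_tilted_bounded)
  show "\<bar>max 0 (x - l)\<bar> \<le> (1 + \<bar>l\<bar>) * exp (1 * \<bar>x\<bar>)" for x
    using exp_abs_dominates(1)[of x l] by auto
qed measurable

lemma integrable_tilted_square: "integrable (tilted a l) (\<lambda>x. (x - l)\<^sup>2)"
  by (rule integrable_tilted_bounded[of _ "(1 + \<bar>l\<bar>)\<^sup>2" 2]) (use exp_abs_dominates(2)[of _ l] in auto)

lemma tilted_tail:
  "measure (tilted a l) {l<..} = exp (a\<^sup>2 / 2 - a * l) * upper_tail (l - a) / trunc_mgf a l"
proof -
  interpret T: prob_space "tilted a l" by (rule prob_space_tilted)
  have "measure (tilted a l) {l<..} = (\<integral>x. indicator {l<..} x \<partial>tilted a l)" by simp
  also have "\<dots> = (\<integral>x. exp (a * max 0 (x - l)) * indicator {l<..} x \<partial>std_normal_distribution) / trunc_mgf a l"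
    by (rule integral_tilted) measurable
  also have "(\<lambda>x. exp (a * max 0 (x - l)) * indicator {l<..} x) = (\<lambda>x. exp (a * (x - l)) * indicator {l<..} x :: real)"
    by (auto simp: indicator_def)
  finally show ?thesis unfolding integral_exp_tail_shift(2) .
qed

text \<open>Intermediate value theorem for the equation with the normalisation cleared, so that
  \<open>?g\<close> compares \<open>(1 - b)\<close> times the upper mass with \<open>b\<close> times
  the lower mass. As \<open>a \<ge> 0\<close>, the factor \<open>exp (a\<^sup>2 / 2 - a * l)\<close>
  is bounded for \<open>l \<ge> 0\<close> and at least 1 for \<open>l \<le> 0\<close>, so the tail
  limits alone decide the signs at both ends.\<close>

lemma ex_tilted_tail_eq:
  assumes a: "0 \<le> a" and b: "0 < b" "b < 1"
  shows "\<exists>l. measure (tilted a l) {l<..} = b"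
proof -
  let ?g = "\<lambda>l. (1 - b) * (exp (a\<^sup>2 / 2 - a * l) * upper_tail (l - a)) - b * (1 - upper_tail l)"
  have cont: "isCont ?g l" for l
  proof -
    have "isCont (\<lambda>l. upper_tail (l - a)) l"
      using isCont_o2[of l "\<lambda>l. l - a" upper_tail] isCont_upper_tail by auto
    then show ?thesis using isCont_upper_tail by (intro continuous_intros) auto
  qed
  have shift: "filterlim (\<lambda>l. l - a) at_top at_top" "filterlim (\<lambda>l. l - a) at_bot at_bot"
    by real_asymp+
  have "((\<lambda>l. (1 - b) * (exp (a\<^sup>2 / 2) * upper_tail (l - a)) - b * (1 - upper_tail l)) \<longlongrightarrow>
      (1 - b) * (exp (a\<^sup>2 / 2) * 0) - b * (1 - 0)) at_top"
    by (intro tendsto_intros upper_tail_at_top filterlim_compose[OF upper_tail_at_top shift(1)])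
  then have "\<forall>\<^sub>F l in at_top. (1 - b) * (exp (a\<^sup>2 / 2) * upper_tail (l - a)) - b * (1 - upper_tail l) < 0"
    by (rule order_tendstoD) (use b in simp)
  then have "\<forall>\<^sub>F l in at_top. ?g l < 0 \<and> 0 \<le> l"
    using eventually_ge_at_top[of 0]
  proof eventually_elim
    case (elim l)
    have "exp (a\<^sup>2 / 2 - a * l) \<le> exp (a\<^sup>2 / 2)" using a elim(2) by simp
    then have "(1 - b) * (exp (a\<^sup>2 / 2 - a * l) * upper_tail (l - a)) \<le> (1 - b) * (exp (a\<^sup>2 / 2) * upper_tail (l - a))"
      using b by (intro mult_left_mono mult_right_mono) auto
    then show ?case using elim by linarith
  qed
  then obtain l1 where l1: "?g l1 < 0" "0 \<le> l1" by (auto simp: eventually_at_top_linorder)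
  have "((\<lambda>l. (1 - b) * (1 * upper_tail (l - a)) - b * (1 - upper_tail l)) \<longlongrightarrow>
      (1 - b) * (1 * 1) - b * (1 - 1)) at_bot"
    by (intro tendsto_intros upper_tail_at_bot filterlim_compose[OF upper_tail_at_bot shift(2)])
  then have "\<forall>\<^sub>F l in at_bot. 0 < (1 - b) * (1 * upper_tail (l - a)) - b * (1 - upper_tail l)"
    by (rule order_tendstoD) (use b in simp)
  then have "\<forall>\<^sub>F l in at_bot. 0 < ?g l \<and> l \<le> 0"
    using eventually_le_at_bot[of 0]
  proof eventually_elim
    case (elim l)
    have "0 \<le> a\<^sup>2 / 2 - a * l" using a elim(2) by (simp add: mult_nonneg_nonpos order_trans[of _ 0])
    then have "1 \<le> exp (a\<^sup>2 / 2 - a * l)" by simp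
    then have "(1 - b) * (1 * upper_tail (l - a)) \<le> (1 - b) * (exp (a\<^sup>2 / 2 - a * l) * upper_tail (l - a))"
      using b by (intro mult_left_mono mult_right_mono) auto
    then show ?case using elim by linarith
  qed
  then obtain l0 where l0: "0 < ?g l0" "l0 \<le> 0" by (auto simp: eventually_at_bot_linorder)
  have "\<exists>l\<ge>l0. l \<le> l1 \<and> ?g l = 0"
    by (rule IVT2[of ?g l1 0 l0]) (use l0 l1 cont in auto)
  then obtain l where l: "?g l = 0" by auto
  have "exp (a\<^sup>2 / 2 - a * l) * upper_tail (l - a) = b * trunc_mgf a l"
    unfolding trunc_mgf_eq using l by (simp add: algebra_simps)
  then have "measure (tilted a l) {l<..} = b"
    unfolding tilted_tail using trunc_mgf_pos[of a l] by simp
  then show ?thesis ..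
qed

text \<open>Once the level is fixed, the threshold bound is a sum over coordinates, and its
  exponential moment factorises into powers of \<open>trunc_mgf\<close>.\<close>

lemma sel_lmgf_le:
  assumes k: "0 < k" "k \<le> n" and c: "0 \<le> c"
  shows "sel_lmgf n k c \<le> c * (sqrt (real k) * l) + real n * ln (trunc_mgf (c / sqrt (real k)) l)"
proof -
  let ?a = "c / sqrt (real k)"
  let ?P = "gauss_PiM {1..n}"
  let ?f = "\<lambda>w. \<Prod>i=1..n. exp (?a * max 0 (w i - l))"
  have int: "integrable ?P ?f"
    by (intro std_normal_PiM.product_integrable_prod integrable_trunc) auto
  have "(\<integral>w. exp (c * sel_max n k w) \<partial>?P) \<le> (\<integral>w. exp (c * (sqrt (real k) * l)) * ?f w \<partial>?P)"
  proof (rule integral_mono)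
    show "integrable ?P (\<lambda>w. exp (c * sel_max n k w))"
      using integrable_sel_max(1)[OF k] by (simp add: std_gauss_vec_eq)
    show "integrable ?P (\<lambda>w. exp (c * (sqrt (real k) * l)) * ?f w)" using int by simp
    fix w
    have "c * sel_max n k w \<le> c * (sqrt (real k) * l + (\<Sum>i=1..n. max 0 (w i - l)) / sqrt (real k))"
      using c sel_max_le[OF k] by (intro mult_left_mono) auto
    also have "\<dots> = c * (sqrt (real k) * l) + (\<Sum>i=1..n. ?a * max 0 (w i - l))"
      by (simp add: distrib_left sum_divide_distrib sum_distrib_left)
    finally show "exp (c * sel_max n k w) \<le> exp (c * (sqrt (real k) * l)) * ?f w"
      by (simp add: exp_add[symmetric] exp_sum[symmetric])
  qed
  also have "\<dots> = exp (c * (sqrt (real k) * l)) * trunc_mgf ?a l ^ n"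
  proof -
    have "(\<integral>w. ?f w \<partial>?P) = (\<Prod>i=1..n. trunc_mgf ?a l)"
      unfolding trunc_mgf_def by (intro std_normal_PiM.product_integral_prod integrable_trunc) auto
    then show ?thesis by simp
  qed
  finally have "sel_lmgf n k c \<le> ln (exp (c * (sqrt (real k) * l)) * trunc_mgf ?a l ^ n)"
    unfolding sel_lmgf_def using integral_exp_sel_max_pos[OF k, of c] by (intro ln_mono) (simp_all add: std_gauss_vec_eq)
  also have "\<dots> = c * (sqrt (real k) * l) + real n * ln (trunc_mgf ?a l)"
    using trunc_mgf_pos[of ?a l] by (simp add: ln_mult ln_realpow)
  finally show ?thesis .
qed

lemma (in prob_space) expectation_affine_diff:
  fixes A B :: "'a \<Rightarrow> real"
  assumes "integrable M A" "integrable M B"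
  shows "expectation (\<lambda>w. c * A w - B w + z) = c * expectation A - expectation B + z"
  using assms by (simp add: prob_space)

text \<open>Gibbs variational inequality: a logarithmic moment is at least the tilted mean minus
  relative entropy, and the entropy of the tilted product law is \<open>n\<close> times
  \<open>a * E - ln (trunc_mgf a l)\<close>, where \<open>E\<close> is the tilted mean of the excess
  over \<open>l\<close>.\<close>

lemma sel_lmgf_ge:
  assumes k: "0 < k" "k \<le> n" and int_sel: "integrable (Pi\<^sub>M {1..n} (\<lambda>_. tilted a l)) (sel_max n k)"
  shows "real n * (ln (trunc_mgf a l) - a * (\<integral>x. max 0 (x - l) \<partial>tilted a l))
      + c * (\<integral>w. sel_max n k w \<partial>Pi\<^sub>M {1..n} (\<lambda>_. tilted a l)) \<le> sel_lmgf n k c"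
proof -
  let ?P = "gauss_PiM {1..n}" and ?T = "Pi\<^sub>M {1..n} (\<lambda>_. tilted a l)"
  interpret T: prob_space ?T by (rule prob_space_PiM) (rule prob_space_tilted)
  let ?Z = "trunc_mgf a l"
  have Z: "0 < ?Z" by (rule trunc_mgf_pos)
  let ?t = "\<lambda>x. exp (a * max 0 (x - l)) / ?Z"
  \<comment> \<open>The exponent minus the logarithm of the tilted density, so the mean of
    \<open>exp (X w)\<close> under the tilted law is the original exponential moment.\<close>
  define X where "X = (\<lambda>w. c * sel_max n k w - (\<Sum>i=1..n. a * max 0 (w i - l)) + real n * ln ?Z)"
  have T: "?T = density ?P (\<lambda>w. ennreal (\<Prod>i=1..n. ?t (w i)))"
  proof -
    have "?T = density ?P (\<lambda>w. \<Prod>i=1..n. ennreal (?t (w i)))"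
      unfolding tilted_def
      by (rule PiM_density_const[symmetric])
         (use prob_space_tilted[of a l] std_normal.prob_space_axioms in \<open>auto simp: tilted_def\<close>)
    then show ?thesis using Z by (simp add: prod_ennreal less_imp_le)
  qed
  have sets: "sets ?T = sets ?P" by (intro sets_PiM_cong) auto
  have [measurable]: "X \<in> borel_measurable ?P"
    unfolding X_def using k measurable_sel_max[of k n]
    by (intro borel_measurable_add borel_measurable_diff borel_measurable_sum borel_measurable_times
      borel_measurable_max borel_measurable_const measurable_std_normal_component) auto
  have tX: "(\<Prod>i=1..n. ?t (w i)) * exp (X w) = exp (c * sel_max n k w)" for w
  proof -
    have "(\<Prod>i=1..n. ?t (w i)) = exp (\<Sum>i=1..n. a * max 0 (w i - l)) / ?Z ^ n"
      by (simp add: exp_sum prod_dividef)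
    moreover have "exp (X w) = exp (c * sel_max n k w) / exp (\<Sum>i=1..n. a * max 0 (w i - l)) * ?Z ^ n"
      unfolding X_def exp_add exp_diff using Z by (simp add: exp_of_nat_mult)
    ultimately show ?thesis using Z by simp
  qed
  have meas_t: "(\<lambda>w. \<Prod>i=1..n. ?t (w i)) \<in> borel_measurable ?P"
    by (intro borel_measurable_prod borel_measurable_divide borel_measurable_const
      measurable_compose[OF measurable_std_normal_component]) auto
  have t_nonneg: "0 \<le> (\<Prod>i=1..n. ?t (w i))" for w using Z by (intro prod_nonneg) (auto intro: less_imp_le)
  have meas_X: "(\<lambda>w. exp (X w)) \<in> borel_measurable ?P" by measurable
  have int_exp: "integrable ?T (\<lambda>w. exp (X w))"
    unfolding T integrable_density[OF meas_X meas_t AE_I2[OF t_nonneg]] real_scaleR_def tX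
    using integrable_sel_max(1)[OF k, of c] unfolding std_gauss_vec_eq .
  have E_exp: "(\<integral>w. exp (X w) \<partial>?T) = (\<integral>w. exp (c * sel_max n k w) \<partial>std_gauss_vec n)"
    unfolding T integral_density[OF meas_X meas_t AE_I2[OF t_nonneg]] real_scaleR_def tX
    unfolding std_gauss_vec_eq ..
  have comp: "integrable ?T (\<lambda>w. max 0 (w i - l))"
    "(\<integral>w. max 0 (w i - l) \<partial>?T) = (\<integral>x. max 0 (x - l) \<partial>tilted a l)" if "i \<in> {1..n}" for i
    using integrable_PiM_component[OF prob_space_tilted that, of "\<lambda>x. max 0 (x - l)" a l]
      integral_PiM_component[OF prob_space_tilted that, of "\<lambda>x. max 0 (x - l)" a l] integrable_tilted_trunc
    by auto
  have int_X: "integrable ?T X"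
    unfolding X_def using int_sel comp(1)
    by (intro Bochner_Integration.integrable_add Bochner_Integration.integrable_diff
      Bochner_Integration.integrable_sum integrable_mult_right T.integrable_const) auto
  have "(\<integral>w. X w \<partial>?T) = c * (\<integral>w. sel_max n k w \<partial>?T) - (\<Sum>i=1..n. a * (\<integral>x. max 0 (x - l) \<partial>tilted a l)) + real n * ln ?Z"
  proof -
    have s: "integrable ?T (\<lambda>w. \<Sum>i=1..n. a * max 0 (w i - l))"
      "(\<integral>w. (\<Sum>i=1..n. a * max 0 (w i - l)) \<partial>?T) = (\<Sum>i=1..n. a * (\<integral>x. max 0 (x - l) \<partial>tilted a l))"
    proof -
      have *: "integrable ?T (\<lambda>w. a * max 0 (w i - l))" if "i \<in> {1..n}" for i
        using comp(1)[OF that] by simp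
      have **: "(\<integral>w. a * max 0 (w i - l) \<partial>?T) = a * (\<integral>x. max 0 (x - l) \<partial>tilted a l)" if "i \<in> {1..n}" for i
        using comp(2)[OF that] by simp
      show "integrable ?T (\<lambda>w. \<Sum>i=1..n. a * max 0 (w i - l))"
        by (rule Bochner_Integration.integrable_sum) (rule *)
      show "(\<integral>w. (\<Sum>i=1..n. a * max 0 (w i - l)) \<partial>?T) = (\<Sum>i=1..n. a * (\<integral>x. max 0 (x - l) \<partial>tilted a l))"
        by (subst Bochner_Integration.integral_sum[OF *], assumption, rule sum.cong[OF refl], rule **)
    qed
    show ?thesis unfolding X_def s(2)[symmetric]
      by (rule T.expectation_affine_diff[OF int_sel s(1)])
  qed
  then have "real n * (ln ?Z - a * (\<integral>x. max 0 (x - l) \<partial>tilted a l)) + c * (\<integral>w. sel_max n k w \<partial>?T)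
      = (\<integral>w. X w \<partial>?T)" by (simp add: algebra_simps)
  also have "\<dots> \<le> ln (\<integral>w. exp (X w) \<partial>?T)"
    by (rule expectation_le_ln_expectation_exp[OF T.prob_space_axioms int_X int_exp])
  also have "\<dots> = sel_lmgf n k c" unfolding E_exp sel_lmgf_def ..
  finally show ?thesis .
qed

section \<open>Limit of the logarithmic moments\<close>

lemma sel_lmgf_ge_mean:
  assumes k: "0 < k" "k \<le> n"
  shows "c * (\<integral>w. sel_max n k w \<partial>std_gauss_vec n) \<le> sel_lmgf n k c"
proof -
  have "(\<integral>w. c * sel_max n k w \<partial>std_gauss_vec n) \<le> sel_lmgf n k c"
    unfolding sel_lmgf_def using integrable_sel_max[OF k]
    by (intro expectation_le_ln_expectation_exp std_gauss_vec.prob_space_axioms) auto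
  then show ?thesis by simp
qed

text \<open>Monotonicity of power means, by Jensen's inequality for the power
  \<open>d / c \<ge> 1\<close>.\<close>

lemma sel_lmgf_div_mono:
  assumes k: "0 < k" "k \<le> n" and c: "0 < c" "c \<le> d"
  shows "sel_lmgf n k c / c \<le> sel_lmgf n k d / d"
proof -
  let ?E = "\<lambda>c. \<integral>w. exp (c * sel_max n k w) \<partial>std_gauss_vec n"
  have pw: "exp (c * x) powr (d / c) = exp (d * x)" for x
    using c by (simp add: exp_powr_real)
  have "?E c powr (d / c) \<le> (\<integral>w. exp (c * sel_max n k w) powr (d / c) \<partial>std_gauss_vec n)"
    using integrable_sel_max(1)[OF k] c
    by (intro std_gauss_vec.jensens_inequality[where I = "{0<..}"] powr_convex) (auto simp: pw)
  then have "ln (?E c powr (d / c)) \<le> ln (?E d)"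
    unfolding pw using integral_exp_sel_max_pos[OF k, of c] by (intro ln_mono) auto
  then have "d / c * sel_lmgf n k c \<le> sel_lmgf n k d"
    using integral_exp_sel_max_pos[OF k, of c] by (simp add: ln_powr sel_lmgf_def)
  then show ?thesis using c by (simp add: field_simps)
qed

text \<open>A single fixed selection already contributes a standard normal variable. Applied to both
  vectors, this makes the dual objective at least \<open>c / 2\<close>, hence nonnegative and large
  for large \<open>c\<close>.\<close>

lemma sel_lmgf_ge_square:
  assumes k: "0 < k" "k \<le> n" and c: "0 \<le> c"
  shows "c\<^sup>2 / 2 \<le> sel_lmgf n k c"
proof -
  let ?P = "gauss_PiM {1..n}"
  obtain I where I: "I \<in> subsets_of_card n k" using subsets_of_card_nonempty[OF k(2)] by auto
  then have I': "I \<subseteq> {1..n}" "card I = k" by (auto simp: subsets_of_card_def)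
  let ?g = "\<lambda>i x. exp ((c * unit_ind k I i) * x)"
  have g: "(\<Prod>i=1..n. ?g i (w i)) = exp (c * ((\<Sum>i\<in>I. w i) / sqrt (real k)))" for w
    by (simp add: sum_mult_unit_ind[OF I'(1), symmetric] exp_sum[symmetric] sum_distrib_left mult_ac)
  have "exp (c\<^sup>2 / 2) = (\<Prod>i=1..n. exp ((c * unit_ind k I i)\<^sup>2 / 2))"
  proof -
    have "(\<Sum>i=1..n. (c * unit_ind k I i)\<^sup>2 / 2) = c\<^sup>2 / 2 * (\<Sum>i=1..n. unit_ind k I i * unit_ind k I i)"
      by (simp add: sum_distrib_left power2_eq_square mult_ac)
    then show ?thesis using unit_ind_inner(2)[OF k(1) I I] by (simp add: exp_sum[symmetric])
  qed
  also have "\<dots> = (\<integral>w. (\<Prod>i=1..n. ?g i (w i)) \<partial>?P)"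
    by (subst std_normal_PiM.product_integral_prod) (auto intro: std_normal_mgf simp: std_normal_mgf(2))
  also have "\<dots> \<le> (\<integral>w. exp (c * sel_max n k w) \<partial>?P)"
  proof (rule integral_mono)
    show "integrable ?P (\<lambda>w. \<Prod>i=1..n. ?g i (w i))"
      by (intro std_normal_PiM.product_integrable_prod std_normal_mgf) auto
    show "integrable ?P (\<lambda>w. exp (c * sel_max n k w))"
      using integrable_sel_max(1)[OF k] by (simp add: std_gauss_vec_eq)
    show "(\<Prod>i=1..n. ?g i (w i)) \<le> exp (c * sel_max n k w)" for w
      unfolding g exp_le_cancel_iff by (intro mult_left_mono sel_max_ge k I c)
  qed
  finally have "ln (exp (c\<^sup>2 / 2)) \<le> sel_lmgf n k c"
    unfolding sel_lmgf_def std_gauss_vec_eq by (intro ln_mono) auto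
  then show ?thesis by simp
qed

lemma scale_cancel:
  assumes "0 < c" "0 < x"
  shows "c * sqrt x * y / (c * x) = y / sqrt x"
proof -
  have "c * sqrt x * y / (c * x) = sqrt x / x * y" using assms by simp
  also have "\<dots> = y / sqrt x" unfolding sqrt_divide_self_eq[OF less_imp_le[OF assms(2)]] by (simp add: divide_inverse)
  finally show ?thesis .
qed

lemma isCont_trunc_mgf: "isCont (\<lambda>a. trunc_mgf a l) a"
proof -
  have "isCont (\<lambda>a. upper_tail (l - a)) a"
    using isCont_o2[of a "\<lambda>a. l - a" upper_tail] isCont_upper_tail by auto
  then show ?thesis unfolding trunc_mgf_eq by (intro continuous_intros) auto
qed

lemma tilted_0: "tilted 0 l = std_normal_distribution"
  using std_normal.prob_space by (simp add: tilted_def trunc_mgf_def density_1)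

definition tilt_level :: "real \<Rightarrow> real \<Rightarrow> real" where
  "tilt_level a b = (SOME l. measure (tilted a l) {l<..} = b)"

lemma tilt_level:
  "0 \<le> a \<Longrightarrow> 0 < b \<Longrightarrow> b < 1 \<Longrightarrow> measure (tilted a (tilt_level a b)) {tilt_level a b<..} = b"
  unfolding tilt_level_def using ex_tilted_tail_eq by (rule someI_ex)

text \<open>The upper bound of \<open>sel_lmgf_le\<close> at the matching level, in the limit and
  divided by \<open>c\<close>. The tilt is \<open>c / sqrt b\<close> because the sum of the selected
  entries is divided by \<open>sqrt k\<close>, about \<open>sqrt (b * n)\<close>.\<close>

definition lim_lmgf :: "real \<Rightarrow> real \<Rightarrow> real" where
  "lim_lmgf b c = sqrt b * tilt_level (c / sqrt b) b
    + ln (trunc_mgf (c / sqrt b) (tilt_level (c / sqrt b) b)) / c"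

text \<open>The value that \<open>lim_lmgf b c\<close> approaches as \<open>c\<close> tends to 0: no
  tilt, and the logarithm replaced by its first-order term.\<close>

definition lim_mean :: "real \<Rightarrow> real" where
  "lim_mean b = sqrt b * tilt_level 0 b
    + (\<integral>x. max 0 (x - tilt_level 0 b) \<partial>std_normal_distribution) / sqrt b"

text \<open>Both halves of the dual are instances: dimension \<open>m\<close> for the rows, and
  dimension \<open>n\<close> itself for the columns. Ratios are always taken with respect to
  \<open>n\<close>.\<close>

locale proportional =
  fixes m k :: "nat \<Rightarrow> nat" and b :: real
  assumes b: "0 < b" "b < 1"
    and k: "\<And>n. 1 \<le> n \<Longrightarrow> 0 < k n" "\<And>n. 1 \<le> n \<Longrightarrow> k n \<le> m n"
    and lim_m: "(\<lambda>n. real (m n) / real n) \<longlonglongrightarrow> 1" and lim_k: "(\<lambda>n. real (k n) / real n) \<longlonglongrightarrow> b"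
begin

text \<open>With parameter \<open>c * sqrt n\<close> every term of the dual objective has order
  \<open>sqrt n\<close>; \<open>Q\<close> is a logarithmic term with this factor removed.\<close>

definition Q where "Q n c = sel_lmgf (m n) (k n) (c * sqrt (real n)) / (c * real n)"

lemma eventually_k_less: "\<forall>\<^sub>F n in sequentially. k n < m n"
proof -
  have "((\<lambda>n. real (m n) / real n - real (k n) / real n) \<longlongrightarrow> 1 - b) sequentially"
    by (intro tendsto_diff lim_m lim_k)
  then have "\<forall>\<^sub>F n in sequentially. 0 < real (m n) / real n - real (k n) / real n"
    by (rule order_tendstoD) (use b in simp)
  then show ?thesis
    using eventually_gt_at_top[of 0]
    by eventually_elim (simp add: field_simps)
qed

text \<open>The weight \<open>t\<close> is fixed first, large enough for the error
  \<open>V / (2 * t)\<close> to fit below the gap; only then does \<open>n\<close> grow, which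
  removes the variance and the bias.\<close>

lemma eventually_expectation_sel_max_gt:
  assumes tail: "measure (tilted a l) {l<..} = b"
    and x: "x < sqrt b * l + (\<integral>x. max 0 (x - l) \<partial>tilted a l) / sqrt b"
  shows "\<forall>\<^sub>F n in sequentially. x < (\<integral>w. sel_max (m n) (k n) w \<partial>Pi\<^sub>M {1..m n} (\<lambda>_. tilted a l)) / sqrt (real n)"
proof -
  define Y where "Y = (\<integral>x. max 0 (x - l) \<partial>tilted a l)"
  define V where "V = (\<integral>x. (x - l)\<^sup>2 \<partial>tilted a l)"
  \<comment> \<open>The lower bound of \<open>expectation_sel_max_ge\<close> in the ratios
    \<open>m / n\<close>, \<open>k / n\<close> and \<open>1 / n\<close>; it is continuous at their
    limits \<open>(1, b, 0)\<close>.\<close>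
  define R where "R t \<mu> \<kappa> \<epsilon> = (\<kappa> * l + \<mu> * Y - (t * (\<mu> * \<epsilon> + (\<mu> * b - \<kappa>)\<^sup>2) + \<mu>\<^sup>2 * V / (2 * t)) / min \<kappa> (\<mu> - \<kappa>)) / sqrt \<kappa>"
    for t \<mu> \<kappa> \<epsilon> :: real
  have "((\<lambda>t. V / 2 / t) \<longlongrightarrow> 0) at_top"
    by (intro tendsto_divide_0[OF tendsto_const] filterlim_at_top_imp_at_infinity filterlim_ident)
  then have "((\<lambda>t. (b * l + Y - V / 2 / t / min b (1 - b)) / sqrt b) \<longlongrightarrow> (b * l + Y - 0 / min b (1 - b)) / sqrt b) at_top"
    using b by (intro tendsto_intros) auto
  moreover have "(b * l + Y - 0 / min b (1 - b)) / sqrt b = sqrt b * l + Y / sqrt b"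
  proof -
    have "b * l / sqrt b = b / sqrt b * l" by simp
    also have "\<dots> = sqrt b * l" using b by (simp only: real_div_sqrt less_imp_le)
    finally have "b * l / sqrt b = sqrt b * l" .
    then show ?thesis by (simp add: add_divide_distrib)
  qed
  ultimately have "\<forall>\<^sub>F t in at_top. x < (b * l + Y - V / 2 / t / min b (1 - b)) / sqrt b"
    using x by (auto simp: Y_def dest: order_tendstoD)
  then have "\<forall>\<^sub>F t in at_top. x < (b * l + Y - V / 2 / t / min b (1 - b)) / sqrt b \<and> 0 < t"
    using eventually_gt_at_top[of 0] by eventually_elim simp
  then obtain t where t: "x < (b * l + Y - V / 2 / t / min b (1 - b)) / sqrt b" "0 < t"
    by (auto simp: eventually_at_top_linorder)
  have "(\<lambda>n. 1 / real n) \<longlonglongrightarrow> 0" by real_asymp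
  then have "(\<lambda>n. R t (real (m n) / real n) (real (k n) / real n) (1 / real n)) \<longlonglongrightarrow> R t 1 b 0"
    unfolding R_def using b t lim_m lim_k by (intro tendsto_intros) (auto simp: min_def)
  moreover have "x < R t 1 b 0" using t by (simp add: R_def)
  ultimately have "\<forall>\<^sub>F n in sequentially. x < R t (real (m n) / real n) (real (k n) / real n) (1 / real n)"
    by (rule order_tendstoD)
  then show ?thesis using eventually_k_less eventually_gt_at_top[of 0]
  proof eventually_elim
    case (elim n)
    let ?S = "\<integral>w. sel_max (m n) (k n) w \<partial>Pi\<^sub>M {1..m n} (\<lambda>_. tilted a l)"
    have n: "0 < real n" and kn: "0 < k n" using elim k[of n] by auto
    define N where "N = real n"
    define K where "K = real (k n)"
    define M where "M = real (m n)"
    have pos: "0 < N" "0 < K" "K < M" using n kn elim by (auto simp: N_def K_def M_def)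
    have mn: "real (min (k n) (m n - k n)) = min K (M - K)" using elim by (auto simp: K_def M_def of_nat_diff)
    have "K * l + M * Y - (t * (M + (M * b - K)\<^sup>2) + M\<^sup>2 * V / (2 * t)) / min K (M - K) \<le> sqrt K * ?S"
      using expectation_sel_max_ge(2)[OF prob_space_tilted sets_tilted integrable_tilted_square tail kn elim(2) t(2)]
      unfolding mn unfolding Y_def V_def N_def K_def M_def .
    then have "(K * l + M * Y - (t * (M + (M * b - K)\<^sup>2) + M\<^sup>2 * V / (2 * t)) / min K (M - K)) / (sqrt K * sqrt N) \<le> ?S / sqrt N"
      using pos by (simp add: divide_simps mult_ac)
    also have "(K * l + M * Y - (t * (M + (M * b - K)\<^sup>2) + M\<^sup>2 * V / (2 * t)) / min K (M - K)) / (sqrt K * sqrt N)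
        = R t (M / N) (K / N) (1 / N)"
    proof -
      have mn: "min (K / N) (M / N - K / N) = min K (M - K) / N"
        using pos by (auto simp: min_def field_simps)
      have p: "0 < min K (M - K)" using pos by simp
      have "t * (M / N * (1 / N) + (M / N * b - K / N)\<^sup>2) + (M / N)\<^sup>2 * V / (2 * t)
          = (t * (M + (M * b - K)\<^sup>2) + M\<^sup>2 * V / (2 * t)) / N\<^sup>2"
      proof -
        have "M / N * b - K / N = (M * b - K) / N" by (simp add: diff_divide_distrib)
        then show ?thesis using pos t(2) by (simp add: power_divide add_divide_distrib distrib_left power2_eq_square)
      qed
      then have "K / N * l + M / N * Y - (t * (M / N * (1 / N) + (M / N * b - K / N)\<^sup>2) + (M / N)\<^sup>2 * V / (2 * t)) / min (K / N) (M / N - K / N)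
          = (K * l + M * Y - (t * (M + (M * b - K)\<^sup>2) + M\<^sup>2 * V / (2 * t)) / min K (M - K)) / N"
      proof (simp only: mn)
        have "K / N * l + M / N * Y - X / N\<^sup>2 / (D / N) = (K * l + M * Y - X / D) / N" for X D
          using pos by (simp add: power2_eq_square add_divide_distrib diff_divide_distrib)
        then show "K / N * l + M / N * Y - (t * (M + (M * b - K)\<^sup>2) + M\<^sup>2 * V / (2 * t)) / N\<^sup>2 / (min K (M - K) / N)
          = (K * l + M * Y - (t * (M + (M * b - K)\<^sup>2) + M\<^sup>2 * V / (2 * t)) / min K (M - K)) / N" .
      qed
      moreover have "N * sqrt (K / N) = sqrt K * sqrt N"
        using pos by (simp add: real_sqrt_divide field_simps)
      ultimately show ?thesis unfolding R_def by (simp flip: divide_divide_eq_left) (metis divide_divide_eq_left)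
    qed
    finally have "R t (M / N) (K / N) (1 / N) \<le> ?S / sqrt N" .
    then show ?case using elim(1) unfolding N_def K_def M_def by linarith
  qed
qed

lemma Q_le:
  assumes "1 \<le> n" "0 < c"
  shows "Q n c \<le> sqrt (real (k n) / real n) * l
    + real (m n) / real n * ln (trunc_mgf (c / sqrt (real (k n) / real n)) l) / c"
proof -
  have n: "0 < real n" "0 < real (k n)" using assms k(1)[of n] by auto
  have a: "c * sqrt (real n) / sqrt (real (k n)) = c / sqrt (real (k n) / real n)"
    by (simp add: real_sqrt_divide)
  have "sel_lmgf (m n) (k n) (c * sqrt (real n)) \<le> c * sqrt (real n) * (sqrt (real (k n)) * l)
      + real (m n) * ln (trunc_mgf (c / sqrt (real (k n) / real n)) l)"
    using sel_lmgf_le[of "k n" "m n" "c * sqrt (real n)" l] k[OF assms(1)] assms(2) unfolding a by simp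
  then have "Q n c \<le> (c * sqrt (real n) * (sqrt (real (k n)) * l)
      + real (m n) * ln (trunc_mgf (c / sqrt (real (k n) / real n)) l)) / (c * real n)"
    unfolding Q_def using assms by (intro divide_right_mono) auto
  also have "\<dots> = sqrt (real (k n) / real n) * l
      + real (m n) * ln (trunc_mgf (c / sqrt (real (k n) / real n)) l) / (c * real n)"
    unfolding add_divide_distrib scale_cancel[OF assms(2) n(1)] by (simp add: real_sqrt_divide)
  finally show ?thesis by (simp add: mult_ac)
qed

lemma Q_upper_tendsto:
  assumes "0 < c"
  shows "(\<lambda>n. sqrt (real (k n) / real n) * l
    + real (m n) / real n * ln (trunc_mgf (c / sqrt (real (k n) / real n)) l) / c)
    \<longlonglongrightarrow> sqrt b * l + 1 * ln (trunc_mgf (c / sqrt b) l) / c"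
proof -
  have "(\<lambda>n. trunc_mgf (c / sqrt (real (k n) / real n)) l) \<longlonglongrightarrow> trunc_mgf (c / sqrt b) l"
    using b lim_k by (intro isCont_tendsto_compose[OF isCont_trunc_mgf] tendsto_intros) auto
  then show ?thesis
    using assms trunc_mgf_pos[of "c / sqrt b" l] lim_k lim_m by (intro tendsto_intros) auto
qed

text \<open>The upper and lower bounds meet because the tilt is \<open>c / sqrt b\<close>: the
  entropy contributes \<open>- ?Y / sqrt b\<close>, which cancels the excess term
  \<open>?Y / sqrt b\<close> in the tilted mean of the maximum and leaves
  \<open>sqrt b * ?l + ln ?Z / c\<close>.\<close>

lemma Q_tendsto:
  assumes c: "0 < c"
  shows "(\<lambda>n. Q n c) \<longlonglongrightarrow> lim_lmgf b c"
proof (rule order_tendstoI)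
  let ?a = "c / sqrt b"
  let ?l = "tilt_level ?a b"
  let ?Y = "\<integral>x. max 0 (x - ?l) \<partial>tilted ?a ?l"
  let ?Z = "trunc_mgf ?a ?l"
  fix x
  show "\<forall>\<^sub>F n in sequentially. Q n c < x" if "lim_lmgf b c < x"
  proof -
    have "\<forall>\<^sub>F n in sequentially. sqrt (real (k n) / real n) * ?l
        + real (m n) / real n * ln (trunc_mgf (c / sqrt (real (k n) / real n)) ?l) / c < x"
      by (rule order_tendstoD(2)[OF Q_upper_tendsto[OF c]]) (use that in \<open>simp add: lim_lmgf_def\<close>)
    then show ?thesis using eventually_ge_at_top[of 1]
      by eventually_elim (use Q_le[OF _ c, of _ ?l] in \<open>fastforce intro: le_less_trans\<close>)
  qed
  assume x: "x < lim_lmgf b c"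
  have tail: "measure (tilted ?a ?l) {?l<..} = b" using tilt_level[of ?a b] b c by simp
  \<comment> \<open>The gap between \<open>x\<close> and the limit is shared equally between the
    mean of the maximum and the entropy term.\<close>
  define x' where "x' = sqrt b * ?l + ?Y / sqrt b - (lim_lmgf b c - x) / 2"
  have "\<forall>\<^sub>F n in sequentially. x' < (\<integral>w. sel_max (m n) (k n) w \<partial>Pi\<^sub>M {1..m n} (\<lambda>_. tilted ?a ?l)) / sqrt (real n)"
    by (rule eventually_expectation_sel_max_gt[OF tail]) (use x in \<open>simp add: x'_def\<close>)
  moreover have "\<forall>\<^sub>F n in sequentially. (lim_lmgf b c + x) / 2 - (sqrt b * ?l + ?Y / sqrt b)
      < real (m n) / real n * ((ln ?Z - ?a * ?Y) / c)"
  proof (rule order_tendstoD(1))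
    show "(\<lambda>n. real (m n) / real n * ((ln ?Z - ?a * ?Y) / c)) \<longlonglongrightarrow> 1 * ((ln ?Z - ?a * ?Y) / c)"
      by (intro tendsto_intros lim_m)
    have "(ln ?Z - ?a * ?Y) / c = ln ?Z / c - ?Y / sqrt b" using c by (simp add: diff_divide_distrib)
    then show "(lim_lmgf b c + x) / 2 - (sqrt b * ?l + ?Y / sqrt b) < 1 * ((ln ?Z - ?a * ?Y) / c)"
      unfolding mult_1
    proof (simp only:)
      have "(v + x) / 2 - (s + y) < r - y" if "x < v" "v = s + r" for v s r y :: real
        using that by (simp add: field_simps)
      from this[OF x lim_lmgf_def] show "(lim_lmgf b c + x) / 2 - (sqrt b * ?l + ?Y / sqrt b) < ln ?Z / c - ?Y / sqrt b" .
    qed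
  qed
  ultimately show "\<forall>\<^sub>F n in sequentially. x < Q n c"
    using eventually_k_less eventually_ge_at_top[of 1]
  proof eventually_elim
    case (elim n)
    let ?S = "\<integral>w. sel_max (m n) (k n) w \<partial>Pi\<^sub>M {1..m n} (\<lambda>_. tilted ?a ?l)"
    have n: "0 < real n" "0 < k n" using elim k(1)[of n] by auto
    have int: "integrable (Pi\<^sub>M {1..m n} (\<lambda>_. tilted ?a ?l)) (sel_max (m n) (k n))"
      by (rule expectation_sel_max_ge(1)[OF prob_space_tilted sets_tilted integrable_tilted_square tail n(2) elim(3) zero_less_one])
    have "real (m n) * (ln ?Z - ?a * ?Y) + (c * sqrt (real n)) * ?S \<le> sel_lmgf (m n) (k n) (c * sqrt (real n))"
      by (rule sel_lmgf_ge[OF n(2) _ int]) (use k(2) elim in auto)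
    then have "(real (m n) * (ln ?Z - ?a * ?Y) + (c * sqrt (real n)) * ?S) / (c * real n) \<le> Q n c"
      unfolding Q_def using c n by (intro divide_right_mono) auto
    also have "(real (m n) * (ln ?Z - ?a * ?Y) + (c * sqrt (real n)) * ?S) / (c * real n)
        = real (m n) / real n * ((ln ?Z - ?a * ?Y) / c) + ?S / sqrt (real n)"
      unfolding add_divide_distrib scale_cancel[OF c n(1)] by (simp add: mult.commute)
    finally have "real (m n) / real n * ((ln ?Z - ?a * ?Y) / c) + ?S / sqrt (real n) \<le> Q n c" .
    moreover have "x < q" if "u - (L - x) / 2 < s" "(L + x) / 2 - u < r" "r + s \<le> q" for u L s r q :: real
      using that by (simp add: field_simps)
    ultimately show ?case using elim(1,2) unfolding x'_def by blast
  qed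
qed

text \<open>The finite-dimensional upper bound holds at every level, so the limit does too; later
  estimates may therefore use a convenient level in place of \<open>tilt_level\<close>.\<close>

lemma lim_lmgf_le:
  assumes "0 < c"
  shows "lim_lmgf b c \<le> sqrt b * l + ln (trunc_mgf (c / sqrt b) l) / c"
proof -
  have "lim_lmgf b c \<le> sqrt b * l + 1 * ln (trunc_mgf (c / sqrt b) l) / c"
    by (rule LIMSEQ_le[OF Q_tendsto[OF assms] Q_upper_tendsto[OF assms, of l]])
       (use Q_le[OF _ assms] in blast)
  then show ?thesis by simp
qed

definition mean_max where
  "mean_max n = (\<integral>w. sel_max (m n) (k n) w \<partial>std_gauss_vec (m n)) / sqrt (real n)"

lemma eventually_mean_max_gt:
  assumes "x < lim_mean b"
  shows "\<forall>\<^sub>F n in sequentially. x < mean_max n"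
  using eventually_expectation_sel_max_gt[of 0 "tilt_level 0 b" x] tilt_level[of 0 b] b assms
  unfolding tilted_0 mean_max_def std_gauss_vec_eq lim_mean_def by simp

lemma mean_max_le_Q:
  assumes "1 \<le> n" "0 < c"
  shows "mean_max n \<le> Q n c"
proof -
  let ?S = "\<integral>w. sel_max (m n) (k n) w \<partial>std_gauss_vec (m n)"
  have "(c * sqrt (real n)) * ?S / (c * real n) \<le> Q n c"
    unfolding Q_def using k[OF assms(1)] assms by (intro divide_right_mono sel_lmgf_ge_mean) auto
  moreover have "(c * sqrt (real n)) * ?S / (c * real n) = mean_max n"
    unfolding mean_max_def by (rule scale_cancel) (use assms in auto)
  ultimately show ?thesis by simp
qed

lemma Q_mono:
  assumes "1 \<le> n" "0 < c" "c \<le> d"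
  shows "Q n c \<le> Q n d"
proof -
  have n: "0 < real n" using assms by simp
  have "sel_lmgf (m n) (k n) (c * sqrt (real n)) / (c * sqrt (real n)) / sqrt (real n)
      \<le> sel_lmgf (m n) (k n) (d * sqrt (real n)) / (d * sqrt (real n)) / sqrt (real n)"
    using k[OF assms(1)] assms n by (intro divide_right_mono sel_lmgf_div_mono mult_right_mono mult_pos_pos) auto
  then show ?thesis unfolding Q_def by (simp add: mult.assoc)
qed

lemma Q_ge:
  assumes "1 \<le> n" "0 < c"
  shows "c / 2 \<le> Q n c"
proof -
  have "(c * sqrt (real n))\<^sup>2 / 2 / (c * real n) \<le> Q n c"
    unfolding Q_def using k[OF assms(1)] assms by (intro divide_right_mono sel_lmgf_ge_square) auto
  moreover have "(c * sqrt (real n))\<^sup>2 = c\<^sup>2 * real n" by (simp add: power_mult_distrib)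
  then have "(c * sqrt (real n))\<^sup>2 / 2 / (c * real n) = c / 2"
    using assms by (simp only:) (simp add: power2_eq_square)
  ultimately show ?thesis by simp
qed

lemma lim_mean_le_lim_lmgf:
  assumes "0 < c"
  shows "lim_mean b \<le> lim_lmgf b c"
proof (rule field_le_epsilon)
  fix e :: real assume e: "0 < e"
  have "\<forall>\<^sub>F n in sequentially. lim_mean b - e \<le> Q n c"
    using eventually_mean_max_gt[of "lim_mean b - e", simplified, OF e] eventually_ge_at_top[of 1]
  proof eventually_elim
    case (elim n)
    then show ?case using mean_max_le_Q[OF elim(2) assms] by linarith
  qed
  from tendsto_lowerbound[OF Q_tendsto[OF assms] this] show "lim_mean b \<le> lim_lmgf b c + e" by simp
qed

lemma lim_lmgf_ge: "0 < c \<Longrightarrow> c / 2 \<le> lim_lmgf b c"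
  by (rule tendsto_lowerbound[OF Q_tendsto eventually_mono[OF eventually_ge_at_top[of 1] Q_ge]]) simp_all

end

section \<open>Limit of the dual\<close>

lemma exp_le_quadratic: "0 \<le> x \<Longrightarrow> exp x \<le> 1 + x + x\<^sup>2 * exp (x::real)"
proof -
  assume x: "0 \<le> x"
  have "(1 - x) * exp x \<le> exp (- x) * exp x"
    using exp_ge_add_one_self[of "- x"] by (intro mult_right_mono) auto
  then have 1: "exp x - 1 \<le> x * exp x" by (simp add: algebra_simps flip: exp_add)
  from mult_left_mono[OF this x] have "x * exp x \<le> x + x\<^sup>2 * exp x"
    by (simp add: algebra_simps power2_eq_square)
  with 1 show ?thesis by linarith
qed

text \<open>Second-order expansion at zero tilt. For \<open>a \<le> 1\<close> the remainder is
  dominated by the same integral with exponent 1, so \<open>K\<close> does not depend on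
  \<open>a\<close>.\<close>

lemma ln_trunc_mgf_le:
  obtains K where "0 \<le> K"
    "\<And>a. 0 \<le> a \<Longrightarrow> a \<le> 1 \<Longrightarrow>
      ln (trunc_mgf a l) \<le> a * (\<integral>x. max 0 (x - l) \<partial>std_normal_distribution) + a\<^sup>2 * K"
proof -
  let ?N = std_normal_distribution
  let ?Y = "\<lambda>x. max 0 (x - l)"
  let ?K = "\<integral>x. (?Y x)\<^sup>2 * exp (?Y x) \<partial>?N"
  have int_Y: "integrable ?N ?Y"
    using integrable_tilted_trunc[of 0 l] unfolding tilted_0 .
  have int_K: "integrable ?N (\<lambda>x. (?Y x)\<^sup>2 * exp (?Y x))"
  proof (rule integrable_std_normal_bounded)
    fix x
    have "(?Y x)\<^sup>2 \<le> (x - l)\<^sup>2" by (auto simp: max_def)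
    then have "(?Y x)\<^sup>2 \<le> (1 + \<bar>l\<bar>)\<^sup>2 * exp (2 * \<bar>x\<bar>)"
      using exp_abs_dominates(2)[of x l] by linarith
    moreover have "exp (?Y x) \<le> exp \<bar>l\<bar> * exp \<bar>x\<bar>"
      unfolding exp_add[symmetric] exp_le_cancel_iff by auto
    ultimately have "(?Y x)\<^sup>2 * exp (?Y x) \<le> ((1 + \<bar>l\<bar>)\<^sup>2 * exp (2 * \<bar>x\<bar>)) * (exp \<bar>l\<bar> * exp \<bar>x\<bar>)"
      by (intro mult_mono) auto
    also have "\<dots> = ((1 + \<bar>l\<bar>)\<^sup>2 * exp \<bar>l\<bar>) * exp (3 * \<bar>x\<bar>)"
    proof -
      have "3 * \<bar>x\<bar> = 2 * \<bar>x\<bar> + \<bar>x\<bar>" by simp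
      then show ?thesis by (simp only: exp_add mult_ac)
    qed
    finally show "\<bar>(?Y x)\<^sup>2 * exp (?Y x)\<bar> \<le> ((1 + \<bar>l\<bar>)\<^sup>2 * exp \<bar>l\<bar>) * exp (3 * \<bar>x\<bar>)" by simp
  qed measurable
  show thesis
  proof (rule that)
    show "0 \<le> ?K" by (intro Bochner_Integration.integral_nonneg) auto
    fix a :: real assume a: "0 \<le> a" "a \<le> 1"
    have "trunc_mgf a l \<le> (\<integral>x. 1 + a * ?Y x + a\<^sup>2 * ((?Y x)\<^sup>2 * exp (?Y x)) \<partial>?N)"
      unfolding trunc_mgf_def
    proof (rule integral_mono[OF integrable_trunc])
      show "integrable ?N (\<lambda>x. 1 + a * ?Y x + a\<^sup>2 * ((?Y x)\<^sup>2 * exp (?Y x)))"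
        using int_Y int_K by simp
      fix x
      have "exp (a * ?Y x) \<le> exp (?Y x)" using a by (simp add: mult_left_le_one_le)
      then have "(a * ?Y x)\<^sup>2 * exp (a * ?Y x) \<le> (a * ?Y x)\<^sup>2 * exp (?Y x)"
        by (intro mult_left_mono) auto
      then show "exp (a * ?Y x) \<le> 1 + a * ?Y x + a\<^sup>2 * ((?Y x)\<^sup>2 * exp (?Y x))"
        using exp_le_quadratic[of "a * ?Y x"] a by (simp add: power_mult_distrib mult.assoc)
    qed
    also have "\<dots> = 1 + (a * (\<integral>x. ?Y x \<partial>?N) + a\<^sup>2 * ?K)"
      using int_Y int_K std_normal.prob_space by simp
    finally have "ln (trunc_mgf a l) \<le> ln (1 + (a * (\<integral>x. ?Y x \<partial>?N) + a\<^sup>2 * ?K))"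
      using trunc_mgf_pos by (intro ln_mono) auto
    also have "\<dots> \<le> a * (\<integral>x. ?Y x \<partial>?N) + a\<^sup>2 * ?K"
      using a by (intro ln_add_one_self_le_self add_nonneg_nonneg mult_nonneg_nonneg Bochner_Integration.integral_nonneg) auto
    finally show "ln (trunc_mgf a l) \<le> a * (\<integral>x. ?Y x \<partial>?N) + a\<^sup>2 * ?K" .
  qed
qed

lemma (in proportional) lim_lmgf_near_0:
  assumes e: "0 < e"
  obtains d where "0 < d" "\<And>c. 0 < c \<Longrightarrow> c \<le> d \<Longrightarrow> lim_lmgf b c \<le> lim_mean b + e"
proof -
  let ?l = "tilt_level 0 b"
  let ?Y = "\<integral>x. max 0 (x - ?l) \<partial>std_normal_distribution"
  obtain K where K: "0 \<le> K" "\<And>a. 0 \<le> a \<Longrightarrow> a \<le> 1 \<Longrightarrow> ln (trunc_mgf a ?l) \<le> a * ?Y + a\<^sup>2 * K"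
    using ln_trunc_mgf_le[of ?l] by blast
  show thesis
  \<comment> \<open>The first entry keeps the tilt \<open>c / sqrt b\<close> at most 1; the second
    makes the quadratic remainder \<open>c / b * K\<close> at most \<open>e\<close>.\<close>
  proof (rule that[of "min (sqrt b) (e * b / (K + 1))"])
    show "0 < min (sqrt b) (e * b / (K + 1))" using b e K by simp
    fix c assume c: "0 < c" "c \<le> min (sqrt b) (e * b / (K + 1))"
    have "lim_lmgf b c \<le> sqrt b * ?l + ln (trunc_mgf (c / sqrt b) ?l) / c"
      by (rule lim_lmgf_le[OF c(1)])
    also have "ln (trunc_mgf (c / sqrt b) ?l) / c \<le> (c / sqrt b * ?Y + (c / sqrt b)\<^sup>2 * K) / c"
      using c b by (intro divide_right_mono K(2)) auto
    also have "\<dots> = ?Y / sqrt b + c / b * K"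
      using c b by (simp add: add_divide_distrib power_divide power2_eq_square)
    also have "c / b * K \<le> e"
    proof -
      have "c * (K + 1) \<le> e * b" using c K by (simp add: pos_le_divide_eq)
      then have "c * K \<le> e * b" using c by (simp add: distrib_left)
      then show ?thesis using b by (simp add: pos_divide_le_eq)
    qed
    finally show "lim_lmgf b c \<le> lim_mean b + e" by (simp add: lim_mean_def)
  qed
qed

\<comment> \<open>Only pointwise convergence is available, so the infimum over \<open>c > 0\<close> is compared with its values on a
  finite grid: monotonicity of \<open>q n\<close> bridges the gaps, \<open>E n\<close> covers \<open>c\<close> near \<open>0\<close>, and \<open>c \<le> q n c\<close> covers
  large \<open>c\<close>.\<close>
lemma tendsto_INF_monotone:
  fixes q :: "nat \<Rightarrow> real \<Rightarrow> real" and r :: "real \<Rightarrow> real" and E :: "nat \<Rightarrow> real"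
  assumes conv: "\<And>c. 0 < c \<Longrightarrow> (\<lambda>n. q n c) \<longlonglongrightarrow> r c"
    and mono: "\<And>n c d. 1 \<le> n \<Longrightarrow> 0 < c \<Longrightarrow> c \<le> d \<Longrightarrow> q n c \<le> q n d"
    and ge: "\<And>n c. 1 \<le> n \<Longrightarrow> 0 < c \<Longrightarrow> c \<le> q n c" and r_ge: "\<And>c. 0 < c \<Longrightarrow> c \<le> r c"
    and E_le: "\<And>n c. 1 \<le> n \<Longrightarrow> 0 < c \<Longrightarrow> E n \<le> q n c"
    and E_ge: "\<And>x. x < lo \<Longrightarrow> \<forall>\<^sub>F n in sequentially. x < E n"
    and near_0: "\<And>e. 0 < e \<Longrightarrow> \<exists>d>0. \<forall>c. 0 < c \<longrightarrow> c \<le> d \<longrightarrow> r c \<le> lo + e"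
  shows "(\<lambda>n. INF c\<in>{0<..}. - c / 2 + q n c) \<longlonglongrightarrow> (INF c\<in>{0<..}. - c / 2 + r c)"
proof (rule order_tendstoI)
  let ?I = "INF c\<in>{0<..}. - c / 2 + r c"
  have pos: "0 \<le> - c / 2 + r c" if "0 < c" for c using r_ge[OF that] that by simp
  have bdd: "bdd_below ((\<lambda>c. - c / 2 + r c) ` {0<..})" using pos by (intro bdd_belowI2[of _ 0]) auto
  have bdd_n: "bdd_below ((\<lambda>c. - c / 2 + q n c) ` {0<..})" if "1 \<le> n" for n
  proof (rule bdd_belowI2[of _ 0])
    show "0 \<le> - c / 2 + q n c" if "c \<in> {0<..}" for c using ge[OF \<open>1 \<le> n\<close>, of c] that by simp
  qed
  have I_le: "?I \<le> - c / 2 + r c" if "0 < c" for c by (rule cINF_lower[OF bdd]) (use that in simp)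
  fix x
  {
    assume "?I < x"
    then obtain c where c: "0 < c" "- c / 2 + r c < x"
      using cINF_less_iff[OF _ bdd] by auto
    have "(\<lambda>n. - c / 2 + q n c) \<longlonglongrightarrow> - c / 2 + r c" by (intro tendsto_intros conv c)
    from order_tendstoD(2)[OF this c(2)] eventually_ge_at_top[of 1]
    show "\<forall>\<^sub>F n in sequentially. (INF c\<in>{0<..}. - c / 2 + q n c) < x"
    proof eventually_elim
      case (elim n)
      have "(INF c\<in>{0<..}. - c / 2 + q n c) \<le> - c / 2 + q n c"
        by (rule cINF_lower[OF bdd_n[OF elim(2)]]) (use c in simp)
      then show ?case using elim(1) by simp
    qed
  next
    assume x: "x < ?I"
    \<comment> \<open>Each of the cases below loses at most \<open>3 * e\<close>, which is strictly
      less than the gap \<open>4 * e\<close>.\<close>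
    define e where "e = (?I - x) / 4"
    have e: "0 < e" using x by (simp add: e_def)
    obtain d0 where d0: "0 < d0" "\<And>c. 0 < c \<Longrightarrow> c \<le> d0 \<Longrightarrow> r c \<le> lo + e" using near_0[OF e] by blast
    \<comment> \<open>The mesh: moving \<open>c\<close> within one cell changes
      \<open>- c / 2\<close> by at most \<open>e / 2\<close>, and the first cell lies where
      \<open>r\<close> is within \<open>e\<close> of \<open>lo\<close>.\<close>
    define d where "d = min d0 e"
    have d: "0 < d" "d \<le> e" "r d \<le> lo + e" using d0 e by (auto simp: d_def)
    \<comment> \<open>Beyond \<open>M * d \<ge> 2 * \<bar>?I\<bar>\<close> the bound
      \<open>c \<le> q n c\<close> makes the objective at least \<open>c / 2\<close>, hence at least
      \<open>?I\<close>.\<close>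
    obtain M :: nat where M: "2 * \<bar>?I\<bar> / d \<le> real M" using real_arch_simple by blast
    have "\<forall>\<^sub>F n in sequentially. \<forall>i\<in>{1..M}. r (real i * d) - e < q n (real i * d)"
    proof (rule eventually_ball_finite)
      show "\<forall>i\<in>{1..M}. \<forall>\<^sub>F n in sequentially. r (real i * d) - e < q n (real i * d)"
        using d e by (auto intro!: order_tendstoD(1)[OF conv])
    qed simp
    moreover have "\<forall>\<^sub>F n in sequentially. lo - e < E n" using E_ge e by simp
    ultimately show "\<forall>\<^sub>F n in sequentially. x < (INF c\<in>{0<..}. - c / 2 + q n c)"
      using eventually_ge_at_top[of 1]
    proof eventually_elim
      case (elim n)
      have "?I - 3 * e \<le> (INF c\<in>{0<..}. - c / 2 + q n c)"
      proof (rule cINF_greatest)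
        fix c :: real assume "c \<in> {0<..}"
        then have c: "0 < c" by simp
        define i where "i = nat \<lfloor>c / d\<rfloor>"
        have ci: "real i * d \<le> c" "c < (real i + 1) * d"
        proof -
          have "real i = of_int \<lfloor>c / d\<rfloor>" using c d by (simp add: i_def)
          then have "real i \<le> c / d" "c / d < real i + 1" by linarith+
          then show "real i * d \<le> c" "c < (real i + 1) * d"
            using d by (simp_all add: pos_le_divide_eq pos_divide_less_eq)
        qed
        consider "i = 0" | "i \<in> {1..M}" | "M < i" by fastforce
        then show "?I - 3 * e \<le> - c / 2 + q n c"
        proof cases
          case 1
          then have "c < d" using ci by simp
          moreover have "lo - e < q n c" using E_le[OF elim(3) c] elim(2) by simp
          ultimately show ?thesis using I_le[OF d(1)] d e by linarith
        next
          case 2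
          have i: "0 < real i * d" using 2 d by simp
          have "r (real i * d) - e < q n (real i * d)" using elim(1) 2 by blast
          also have "\<dots> \<le> q n c" by (rule mono[OF elim(3) i ci(1)])
          finally have "r (real i * d) - e < q n c" .
          moreover have "c < real i * d + d" using ci by (simp add: distrib_right)
          ultimately show ?thesis using I_le[OF i] d e by linarith
        next
          case 3
          have "2 * \<bar>?I\<bar> \<le> real M * d" using M d by (simp add: pos_divide_le_eq)
          also have "\<dots> \<le> real i * d" using 3 d by (intro mult_right_mono) auto
          also have "\<dots> \<le> c" by (rule ci(1))
          finally show ?thesis using ge[OF elim(3) c] e by linarith
        qed
      qed simp
      moreover have "4 * e = ?I - x" by (simp add: e_def)
      ultimately show ?case using e by linarith
    qed
  }
qed

lemma INF_mult_left:
  fixes f :: "'a \<Rightarrow> real"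
  assumes s: "0 \<le> s" and A: "A \<noteq> {}" "bdd_below (f ` A)"
  shows "(INF x\<in>A. s * f x) = s * (INF x\<in>A. f x)"
proof -
  have "s * (INF x\<in>A. f x) = (INF y\<in>f ` A. s * y)"
    using assms by (intro continuous_at_Inf_mono) (auto simp: mono_def mult_left_mono intro!: continuous_intros)
  then show ?thesis by (simp add: image_image)
qed

lemma INF_scale:
  fixes f :: "real \<Rightarrow> real"
  assumes "0 < s"
  shows "(INF c\<in>{0<..}. f c) = (INF c\<in>{0<..}. f (c * s))"
proof -
  have "{0<..} = (\<lambda>c. c * s) ` {0<..}"
    using assms by (auto simp: image_iff intro!: bexI[of _ "_ / s"])
  then show ?thesis by (metis image_image)
qed

text \<open>The same function appears twice because rows and columns have the same limiting
  density.\<close>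

definition lim_dual :: "real \<Rightarrow> real" where
  "lim_dual b = (INF c\<in>{0<..}. - c / 2 + (lim_lmgf b c + lim_lmgf b c)) / b"

text \<open>Substituting \<open>c * sqrt n\<close> for the parameter extracts \<open>sqrt n\<close>
  from the infimum; with the outer \<open>sqrt n\<close> the prefactor becomes
  \<open>n / sqrt (k1 * k2)\<close>, which tends to \<open>1 / b\<close>.\<close>

lemma lifted_dual_tendsto:
  assumes "proportional m k1 b" "proportional (\<lambda>n. n) k2 b"
  shows "(\<lambda>n. sqrt (real n) * lifted_dual (m n) n (k1 n) (k2 n)) \<longlonglongrightarrow> lim_dual b"
proof -
  interpret Y: proportional m k1 b by fact
  interpret X: proportional "\<lambda>n. n" k2 b by fact
  let ?q = "\<lambda>n c. Y.Q n c + X.Q n c"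
  have lim: "(\<lambda>n. INF c\<in>{0<..}. - c / 2 + ?q n c) \<longlonglongrightarrow> (INF c\<in>{0<..}. - c / 2 + (lim_lmgf b c + lim_lmgf b c))"
  proof (rule tendsto_INF_monotone[where E = "\<lambda>n. Y.mean_max n + X.mean_max n" and lo = "lim_mean b + lim_mean b"])
    show "(\<lambda>n. ?q n c) \<longlonglongrightarrow> lim_lmgf b c + lim_lmgf b c" if "0 < c" for c
      by (intro tendsto_add Y.Q_tendsto X.Q_tendsto that)
    show "?q n c \<le> ?q n d" if "1 \<le> n" "0 < c" "c \<le> d" for n c d
      using that by (intro add_mono Y.Q_mono X.Q_mono)
    show "c \<le> ?q n c" if "1 \<le> n" "0 < c" for n c
      using Y.Q_ge[OF that] X.Q_ge[OF that] by simp
    show "c \<le> lim_lmgf b c + lim_lmgf b c" if "0 < c" for c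
      using Y.lim_lmgf_ge[OF that] by simp
    show "Y.mean_max n + X.mean_max n \<le> ?q n c" if "1 \<le> n" "0 < c" for n c
      using that by (intro add_mono Y.mean_max_le_Q X.mean_max_le_Q)
    show "\<forall>\<^sub>F n in sequentially. x < Y.mean_max n + X.mean_max n" if "x < lim_mean b + lim_mean b" for x
    proof -
      have "x / 2 < lim_mean b" using that by simp
      from Y.eventually_mean_max_gt[OF this] X.eventually_mean_max_gt[OF this] show ?thesis
        by eventually_elim simp
    qed
    show "\<exists>d>0. \<forall>c. 0 < c \<longrightarrow> c \<le> d \<longrightarrow> lim_lmgf b c + lim_lmgf b c \<le> lim_mean b + lim_mean b + e" if e: "0 < e" for e
    proof -
      obtain d where d: "0 < d" "\<And>c. 0 < c \<Longrightarrow> c \<le> d \<Longrightarrow> lim_lmgf b c \<le> lim_mean b + e / 2"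
        by (rule Y.lim_lmgf_near_0[of "e / 2"]) (use e in simp, blast)
      show ?thesis
      proof (intro exI[of _ d] conjI allI impI)
        fix c assume "0 < c" "c \<le> d"
        from d(2)[OF this] show "lim_lmgf b c + lim_lmgf b c \<le> lim_mean b + lim_mean b + e" by linarith
      qed (rule d(1))
    qed
  qed
  have eq: "1 / sqrt (real (k1 n) / real n * (real (k2 n) / real n)) * (INF c\<in>{0<..}. - c / 2 + ?q n c)
      = sqrt (real n) * lifted_dual (m n) n (k1 n) (k2 n)" if n: "1 \<le> n" for n
  proof -
    let ?s = "sqrt (real n)"
    have s: "0 < ?s" "?s * ?s = real n" using n by auto
    have bdd: "bdd_below ((\<lambda>c. - c / 2 + ?q n c) ` {0<..})"
    proof (rule bdd_belowI2[of _ 0])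
      show "0 \<le> - c / 2 + ?q n c" if "c \<in> {0<..}" for c
        using Y.Q_ge[OF n, of c] X.Q_ge[OF n, of c] that by simp
    qed
    have scaled: "- (c * ?s) / 2 + 1 / (c * ?s) * sel_lmgf (m n) (k1 n) (c * ?s) + 1 / (c * ?s) * sel_lmgf n (k2 n) (c * ?s)
        = ?s * (- c / 2 + ?q n c)" if c: "c \<in> {0<..}" for c
    proof -
      have "1 / (c * ?s) * y = ?s * (y / (c * real n))" for y
        using c s by (simp add: field_simps)
      then show ?thesis unfolding Y.Q_def X.Q_def distrib_left by simp
    qed
    have "(INF c\<in>{0<..}. - c / 2 + 1 / c * sel_lmgf (m n) (k1 n) c + 1 / c * sel_lmgf n (k2 n) c)
        = (INF c\<in>{0<..}. ?s * (- c / 2 + ?q n c))"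
      by (subst INF_scale[OF s(1)]) (intro INF_cong refl scaled)
    also have "\<dots> = ?s * (INF c\<in>{0<..}. - c / 2 + ?q n c)"
      by (rule INF_mult_left) (use bdd in auto)
    finally have "sqrt (real n) * lifted_dual (m n) n (k1 n) (k2 n) =
        (?s * ?s) / sqrt (real (k1 n) * real (k2 n)) * (INF c\<in>{0<..}. - c / 2 + ?q n c)"
      unfolding lifted_dual_eq by simp
    also have "(?s * ?s) / sqrt (real (k1 n) * real (k2 n)) = 1 / sqrt (real (k1 n) / real n * (real (k2 n) / real n))"
      unfolding s(2) using n by (simp add: real_sqrt_divide real_sqrt_mult)
    finally show ?thesis by simp
  qed
  have "(\<lambda>n. 1 / sqrt (real (k1 n) / real n * (real (k2 n) / real n)) * (INF c\<in>{0<..}. - c / 2 + ?q n c))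
      \<longlonglongrightarrow> 1 / sqrt (b * b) * (INF c\<in>{0<..}. - c / 2 + (lim_lmgf b c + lim_lmgf b c))"
    using Y.b by (intro tendsto_intros lim Y.lim_k X.lim_k) auto
  also have "1 / sqrt (b * b) * (INF c\<in>{0<..}. - c / 2 + (lim_lmgf b c + lim_lmgf b c)) = lim_dual b"
    using Y.b by (simp add: lim_dual_def)
  finally show ?thesis
    by (rule Lim_transform_eventually) (rule eventually_mono[OF eventually_ge_at_top[of 1] eq])
qed

section \<open>Behaviour for small densities\<close>

text \<open>Chernoff bound with exponent \<open>x\<close>.\<close>

lemma upper_tail_le:
  assumes "0 \<le> x"
  shows "upper_tail x \<le> exp (- x\<^sup>2 / 2)"
proof -
  have "upper_tail x = (\<integral>y. indicator {x<..} y \<partial>std_normal_distribution)" by simp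
  also have "\<dots> \<le> (\<integral>y. exp (- x\<^sup>2) * exp (x * y) \<partial>std_normal_distribution)"
  proof (rule integral_mono)
    show "integrable std_normal_distribution (\<lambda>y. indicator {x<..} y :: real)"
      by (rule std_normal.integrable_const_bound[of _ 1]) auto
    show "integrable std_normal_distribution (\<lambda>y. exp (- x\<^sup>2) * exp (x * y))"
      using std_normal_mgf(1) by simp
    show "indicator {x<..} y \<le> exp (- x\<^sup>2) * exp (x * y)" for y
    proof (cases "x < y")
      case True
      then have "0 \<le> - x\<^sup>2 + x * y" using assms by (simp add: power2_eq_square mult_left_mono)
      then show ?thesis using True by (simp flip: exp_add)
    qed simp
  qed
  also have "\<dots> = exp (- x\<^sup>2 + x\<^sup>2 / 2)" unfolding exp_add using std_normal_mgf(2) by simp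
  finally show ?thesis by simp
qed

text \<open>Only the mass of \<open>(x, x + 1]\<close> is kept, where the density is at least its
  value at \<open>x + 1\<close>. The constant \<open>3 / 2\<close> absorbs the normalisation, as
  \<open>2 * pi \<le> 8 \<le> exp 3\<close>.\<close>

lemma upper_tail_ge:
  assumes "0 \<le> x"
  shows "exp (- (x + 1)\<^sup>2 / 2 - 3 / 2) \<le> upper_tail x"
proof -
  have "sqrt (2 * pi) \<le> exp (3 / 2)"
  proof (rule real_le_lsqrt)
    have "2 * pi \<le> 2 ^ 3" using pi_less_4 by simp
    also have "\<dots> \<le> exp 1 ^ 3" using exp_ge_add_one_self[of 1] by (intro power_mono) auto
    also have "\<dots> = (exp (3 / 2))\<^sup>2" by (simp flip: exp_of_nat_mult)
    finally show "2 * pi \<le> (exp (3 / 2))\<^sup>2" .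
  qed simp
  then have "exp (- (x + 1)\<^sup>2 / 2) / exp (3 / 2) \<le> exp (- (x + 1)\<^sup>2 / 2) / sqrt (2 * pi)"
    by (intro divide_left_mono) auto
  then have "exp (- (x + 1)\<^sup>2 / 2 - 3 / 2) \<le> std_normal_density (x + 1)"
    by (simp add: std_normal_density_def exp_diff)
  also have "std_normal_density (x + 1) = (\<integral>y. std_normal_density (x + 1) * indicator {x<..x + 1} y \<partial>lborel)"
    by simp
  also have "\<dots> \<le> (\<integral>y. std_normal_density y * indicator {x<..} y \<partial>lborel)"
  proof (rule integral_mono)
    show "integrable lborel (\<lambda>y. std_normal_density (x + 1) * indicator {x<..x + 1} y)" by simp
    have "integrable std_normal_distribution (\<lambda>y. indicator {x<..} y :: real)"
      by (rule std_normal.integrable_const_bound[of _ 1]) auto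
    then show "integrable lborel (\<lambda>y. std_normal_density y * indicator {x<..} y)"
      by (subst (asm) integrable_density) auto
    show "std_normal_density (x + 1) * indicator {x<..x + 1} y \<le> std_normal_density y * indicator {x<..} y" for y
    proof (cases "y \<in> {x<..x + 1}")
      case True
      then have "y\<^sup>2 \<le> (x + 1)\<^sup>2" using assms by (intro power_mono) auto
      then have "std_normal_density (x + 1) \<le> std_normal_density y"
        by (auto simp: std_normal_density_def intro!: divide_right_mono)
      then show ?thesis using True by simp
    qed simp
  qed
  also have "\<dots> = (\<integral>y. indicator {x<..} y \<partial>std_normal_distribution)"
    by (subst integral_density) auto
  also have "\<dots> = upper_tail x" by simp
  finally show ?thesis .
qed

lemma upper_tail_antimono: "x \<le> y \<Longrightarrow> upper_tail y \<le> upper_tail x"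
  by (intro std_normal.finite_measure_mono) auto

section \<open>Explicit bounds for the limiting dual at a fixed density\<close>

context proportional
begin

abbreviation L where "L \<equiv> ln (1 / b)"

lemma L_pos: "0 < L" and exp_L: "exp (- L) = b"
  using b by (simp_all add: ln_div)

text \<open>The level is chosen so that \<open>exp (a\<^sup>2 / 2 - a * l) = b\<close>; bounding
  both tails trivially then gives \<open>trunc_mgf a l \<le> 1 + b\<close>.\<close>

lemma lim_lmgf_upper:
  assumes c: "0 < c"
  shows "lim_lmgf b c \<le> c / 2 + b * (L + 1) / c"
proof -
  define a where "a = c / sqrt b"
  define l where "l = a / 2 + L / a"
  have a: "0 < a" "c = a * sqrt b" using c b by (auto simp: a_def)
  have "trunc_mgf a l \<le> 1 + exp (a\<^sup>2 / 2 - a * l) * 1"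
    unfolding trunc_mgf_eq by (intro add_mono mult_left_mono) auto
  also have "a\<^sup>2 / 2 - a * l = - L" using a by (simp add: l_def field_simps power2_eq_square)
  finally have "ln (trunc_mgf a l) \<le> ln (1 + b)"
    unfolding exp_L using trunc_mgf_pos by (intro ln_mono) auto
  also have "\<dots> \<le> b" using b by (intro ln_add_one_self_le_self) auto
  finally have "ln (trunc_mgf a l) / c \<le> b / c" using c by (intro divide_right_mono) auto
  moreover have "lim_lmgf b c \<le> sqrt b * l + ln (trunc_mgf a l) / c"
    unfolding a_def by (rule lim_lmgf_le[OF c])
  moreover have "sqrt b * l = c / 2 + b * L / c"
  proof -
    have "s * (y / x) = s * s * y / (x * s)" if "0 < s" for s y x :: real using that by simp
    from this[of "sqrt b" L a] have "sqrt b * (L / a) = sqrt b * sqrt b * L / c"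
      unfolding a(2) using b real_sqrt_gt_zero by blast
    then show ?thesis using a b by (simp add: l_def distrib_left)
  qed
  ultimately show ?thesis by (simp add: distrib_left add_divide_distrib)
qed

lemma bdd_below_dual: "bdd_below ((\<lambda>c. - c / 2 + (lim_lmgf b c + lim_lmgf b c)) ` {0<..})"
proof (rule bdd_belowI2[of _ 0])
  show "0 \<le> - c / 2 + (lim_lmgf b c + lim_lmgf b c)" if "c \<in> {0<..}" for c
    using lim_lmgf_ge[of c] that by simp
qed

lemma lim_dual_le: "lim_dual b \<le> 2 * sqrt ((L + 1) / b)"
proof -
  \<comment> \<open>The minimiser of \<open>c / 2 + 2 * b * (L + 1) / c\<close>, whose minimum value
    is again \<open>c\<close>.\<close>
  define c where "c = 2 * sqrt (b * (L + 1))"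
  have pos: "0 < b * (L + 1)" by (intro mult_pos_pos add_pos_pos b(1) L_pos zero_less_one)
  then have c: "0 < c" by (simp add: c_def)
  have cc: "b * (L + 1) = c * c / 4" using pos by (simp add: c_def)
  have "(INF c\<in>{0<..}. - c / 2 + (lim_lmgf b c + lim_lmgf b c)) \<le> - c / 2 + (lim_lmgf b c + lim_lmgf b c)"
    by (rule cINF_lower[OF bdd_below_dual]) (use c in simp)
  also have "\<dots> \<le> - c / 2 + 2 * (c / 2 + b * (L + 1) / c)"
    unfolding mult_2 by (intro add_left_mono add_mono lim_lmgf_upper c)
  also have "\<dots> = c" unfolding cc using c by simp
  finally have "lim_dual b \<le> c / b" unfolding lim_dual_def using b by (intro divide_right_mono) auto
  also have "c / b = 2 * sqrt ((L + 1) / b)"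
  proof -
    have "b * (L + 1) / (b * b) = (L + 1) / b" using b by simp
    moreover have "sqrt (b * (L + 1)) / b = sqrt (b * (L + 1) / (b * b))"
      using b by (simp only: real_sqrt_divide) simp
    ultimately show ?thesis by (simp add: c_def)
  qed
  finally show ?thesis .
qed

text \<open>The integrand is bounded below by 1 up to \<open>\<mu> = sqrt (2 * L)\<close> and by
  \<open>exp (a * (x - l))\<close> above. At this cut the discarded mass is at most
  \<open>b\<close>, whatever the level, so \<open>trunc_mgf a l \<ge> 1 - b + y\<close>. Concavity
  of \<open>ln\<close> with weights \<open>1 - b\<close> and \<open>b\<close> then makes the bound
  affine in \<open>l\<close>, which lets the implicitly chosen level cancel later.\<close>

lemma ln_trunc_mgf_ge:
  assumes a: "sqrt (2 * L) \<le> a"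
  shows "b * (a\<^sup>2 / 2 - a * l) + b * (L - 2) \<le> ln (trunc_mgf a l)"
proof -
  define \<mu> where "\<mu> = sqrt (2 * L)"
  let ?N = std_normal_distribution
  have \<mu>: "0 \<le> \<mu>" "\<mu>\<^sup>2 = 2 * L" "\<mu> \<le> a" "0 \<le> a" using L_pos a by (auto simp: \<mu>_def intro: order_trans[of _ "sqrt (2 * L)"])
  define y where "y = exp (a\<^sup>2 / 2 - a * l) * upper_tail (\<mu> - a)"
  \<comment> \<open>Since \<open>a \<ge> \<mu>\<close>, the shifted cut is at most 0, and the tail
    estimate at 0 has exponent \<open>1 / 2 + 3 / 2\<close>.\<close>
  have tail: "exp (- 2) \<le> upper_tail (\<mu> - a)"
    using upper_tail_ge[of 0] upper_tail_antimono[of "\<mu> - a" 0] \<mu> by simp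
  then have y: "0 < y" unfolding y_def by (intro mult_pos_pos less_le_trans[OF exp_gt_zero]) auto
  have "1 - upper_tail \<mu> + y = (\<integral>x. 1 - indicator {\<mu><..} x + exp (a * (x - l)) * indicator {\<mu><..} x \<partial>?N)"
  proof -
    have "integrable ?N (\<lambda>x. indicator {\<mu><..} x :: real)"
      by (rule std_normal.integrable_const_bound[of _ 1]) auto
    then show ?thesis using integral_exp_tail_shift[of a l \<mu>] std_normal.prob_space by (simp add: y_def)
  qed
  also have "\<dots> \<le> trunc_mgf a l"
    unfolding trunc_mgf_def
  proof (rule integral_mono[OF _ integrable_trunc])
    have "integrable ?N (\<lambda>x. indicator {\<mu><..} x :: real)"
      by (rule std_normal.integrable_const_bound[of _ 1]) auto
    then show "integrable ?N (\<lambda>x. 1 - indicator {\<mu><..} x + exp (a * (x - l)) * indicator {\<mu><..} x)"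
      using integral_exp_tail_shift(1)[of a l \<mu>] by simp
    show "1 - indicator {\<mu><..} x + exp (a * (x - l)) * indicator {\<mu><..} x \<le> exp (a * max 0 (x - l))" for x
      using \<mu> by (auto simp: indicator_def intro!: mult_left_mono)
  qed
  moreover have "upper_tail \<mu> \<le> b"
  proof -
    have "upper_tail \<mu> \<le> exp (- \<mu>\<^sup>2 / 2)" by (rule upper_tail_le[OF \<mu>(1)])
    also have "- \<mu>\<^sup>2 / 2 = - L" unfolding \<mu>(2) by simp
    finally show ?thesis unfolding exp_L .
  qed
  ultimately have Z: "1 - b + y \<le> trunc_mgf a l" by linarith
  define z where "z = 1 - b + y"
  have z: "0 < z" using b y by (simp add: z_def)
  \<comment> \<open>Nonnegativity of the relative entropy of \<open>(b, 1 - b)\<close> with respect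
    to \<open>(y / z, (1 - b) / z)\<close>.\<close>
  have "b * ln (y / (b * z)) \<le> b * (y / (b * z) - 1)"
    using b y z by (intro mult_left_mono ln_le_minus_one) auto
  moreover have "(1 - b) * ln (1 / z) \<le> (1 - b) * (1 / z - 1)"
    using b z by (intro mult_left_mono ln_le_minus_one) auto
  moreover have "b * (y / (b * z) - 1) + (1 - b) * (1 / z - 1) = 0"
  proof -
    have "b * (y / (b * z) - 1) + (1 - b) * (1 / z - 1) = (y + (1 - b)) / z - 1"
      using b by (simp add: algebra_simps add_divide_distrib diff_divide_distrib)
    then show ?thesis using z by (simp add: z_def)
  qed
  moreover have "ln (y / (b * z)) = ln y - ln b - ln z" "ln (1 / z) = - ln z"
    using b y z by (simp_all add: ln_div ln_mult)
  ultimately have "b * (ln y - ln b) \<le> ln z" by (simp add: algebra_simps)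
  also have "\<dots> \<le> ln (trunc_mgf a l)" using z Z by (intro ln_mono) (auto simp: z_def)
  finally have "b * (ln y - ln b) \<le> ln (trunc_mgf a l)" .
  moreover have "a\<^sup>2 / 2 - a * l - 2 \<le> ln y"
  proof -
    have "0 < upper_tail (\<mu> - a)" by (rule less_le_trans[OF exp_gt_zero tail])
    moreover from this have "- 2 \<le> ln (upper_tail (\<mu> - a))" using tail by (simp add: ln_ge_iff)
    ultimately show ?thesis by (simp add: y_def ln_mult)
  qed
  then have "b * (a\<^sup>2 / 2 - a * l - 2 + L) \<le> b * (ln y - ln b)"
    using b by (intro mult_left_mono) (auto simp: ln_div)
  ultimately show ?thesis by (simp add: algebra_simps)
qed

text \<open>The level drops out: as \<open>c = a * sqrt b\<close>, the term
  \<open>- b * a * l / c\<close> cancels \<open>sqrt b * l\<close>. The assumption on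
  \<open>c\<close> says that the tilt is at least \<open>sqrt (2 * L)\<close>.\<close>

lemma lim_lmgf_lower:
  assumes c: "sqrt (2 * L) * sqrt b \<le> c"
  shows "c / 2 + b * (L - 2) / c \<le> lim_lmgf b c"
proof -
  define a where "a = c / sqrt b"
  define l where "l = tilt_level a b"
  have "0 < sqrt (2 * L) * sqrt b" using b L_pos by simp
  then have c0: "0 < c" using c by linarith
  have a: "sqrt (2 * L) \<le> a" "c = a * sqrt b" "0 < a"
    using c b c0 by (auto simp: a_def pos_le_divide_eq)
  have "sqrt b * l + (b * (a\<^sup>2 / 2 - a * l) + b * (L - 2)) / c \<le> sqrt b * l + ln (trunc_mgf a l) / c"
    using ln_trunc_mgf_ge[OF a(1)] c0 by (intro add_left_mono divide_right_mono) auto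
  also have "\<dots> = lim_lmgf b c" by (simp add: lim_lmgf_def a_def l_def)
  also have "sqrt b * l + (b * (a\<^sup>2 / 2 - a * l) + b * (L - 2)) / c = c / 2 + b * (L - 2) / c"
  proof -
    have "b * (a\<^sup>2 / 2 - a * l) / c = c / 2 - sqrt b * l"
    proof -
      have "b * (a\<^sup>2 / 2 - a * l) = c * (c / 2 - sqrt b * l)"
        using b by (simp add: a(2) algebra_simps power2_eq_square)
      then show ?thesis using c0 by simp
    qed
    then show ?thesis by (simp add: add_divide_distrib)
  qed
  finally show ?thesis .
qed

lemma lim_mean_lower:
  assumes "5 / 2 \<le> L"
  shows "sqrt b * (sqrt (2 * L - 4) - 1) \<le> lim_mean b"
proof -
  let ?l = "tilt_level 0 b"
  \<comment> \<open>At this point the lower tail bound has exponent \<open>- (L - 1 / 2)\<close> and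
    exceeds \<open>b = exp (- L)\<close>, so the untilted level lies to its right;
    \<open>L \<ge> 5 / 2\<close> ensures \<open>x \<ge> 0\<close>.\<close>
  define x where "x = sqrt (2 * L - 4) - 1"
  have x: "0 \<le> x" "(x + 1)\<^sup>2 = 2 * L - 4" using assms by (auto simp: x_def)
  have tail: "upper_tail ?l = b" using tilt_level[of 0 b] b by (simp add: tilted_0)
  have "exp (- L) < exp (- (x + 1)\<^sup>2 / 2 - 3 / 2)"
    unfolding x(2) exp_less_cancel_iff by (simp add: field_simps)
  then have "b < exp (- (x + 1)\<^sup>2 / 2 - 3 / 2)" unfolding exp_L .
  then have "b < upper_tail x" using upper_tail_ge[OF x(1)] by linarith
  then have "x \<le> ?l" using upper_tail_antimono[of ?l x] tail by force
  then have "sqrt b * x \<le> sqrt b * ?l" using b by (intro mult_left_mono) auto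
  moreover have "0 \<le> (\<integral>x. max 0 (x - ?l) \<partial>std_normal_distribution) / sqrt b"
    using b by (intro divide_nonneg_nonneg Bochner_Integration.integral_nonneg) auto
  ultimately show ?thesis unfolding lim_mean_def x_def by linarith
qed

text \<open>For large \<open>c\<close> the two-term bound is minimised by completing a square. For
  small \<open>c\<close> the loss \<open>- c / 2\<close> is at most
  \<open>sqrt (2 * L) * sqrt b / 2\<close>, and the mean bound compensates for it; the second
  assumption is exactly this requirement divided by \<open>sqrt b\<close>.\<close>

lemma lim_dual_ge:
  assumes L: "5 / 2 \<le> L" "2 * sqrt (L - 2) \<le> - sqrt (2 * L) / 2 + 2 * (sqrt (2 * L - 4) - 1)"
  shows "2 * sqrt ((L - 2) / b) \<le> lim_dual b"
proof -
  have "2 * (sqrt b * sqrt (L - 2)) \<le> (INF c\<in>{0<..}. - c / 2 + (lim_lmgf b c + lim_lmgf b c))"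
  proof (rule cINF_greatest)
    fix c :: real assume "c \<in> {0<..}"
    then have c: "0 < c" by simp
    show "2 * (sqrt b * sqrt (L - 2)) \<le> - c / 2 + (lim_lmgf b c + lim_lmgf b c)"
    proof (cases "sqrt (2 * L) * sqrt b \<le> c")
      case True
      have s: "b * (L - 2) = (sqrt b * sqrt (L - 2))\<^sup>2" using b L by (simp add: power_mult_distrib)
      have "0 \<le> (c - 2 * (sqrt b * sqrt (L - 2)))\<^sup>2 / (2 * c)" using c by simp
      also have "\<dots> = c / 2 + 2 * (b * (L - 2) / c) - 2 * (sqrt b * sqrt (L - 2))"
        unfolding s using c by (simp add: power2_diff field_simps power2_eq_square)
      finally have "2 * (sqrt b * sqrt (L - 2)) \<le> - c / 2 + 2 * (c / 2 + b * (L - 2) / c)" by simp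
      also have "\<dots> \<le> - c / 2 + (lim_lmgf b c + lim_lmgf b c)"
        unfolding mult_2 by (intro add_left_mono add_mono lim_lmgf_lower True)
      finally show ?thesis .
    next
      case False
      have "sqrt b * (2 * sqrt (L - 2)) \<le> sqrt b * (- sqrt (2 * L) / 2 + 2 * (sqrt (2 * L - 4) - 1))"
        using b L(2) by (intro mult_left_mono) auto
      then have "2 * (sqrt b * sqrt (L - 2)) \<le> - (sqrt (2 * L) * sqrt b) / 2 + 2 * (sqrt b * (sqrt (2 * L - 4) - 1))"
        by (simp add: algebra_simps)
      then show ?thesis using False lim_mean_lower[OF L(1)] lim_mean_le_lim_lmgf[OF c] by linarith
    qed
  qed simp
  then have "2 * (sqrt b * sqrt (L - 2)) / b \<le> lim_dual b"
    unfolding lim_dual_def using b by (intro divide_right_mono) auto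
  moreover have "sqrt ((L - 2) / b) = sqrt b * sqrt (L - 2) / b"
  proof -
    have "sqrt b / b = 1 / sqrt b" using sqrt_divide_self_eq[of b] b by (simp add: divide_inverse)
    then have "sqrt ((L - 2) / b) = sqrt (L - 2) * (sqrt b / b)" by (simp only: real_sqrt_divide) simp
    then show ?thesis by simp
  qed
  ultimately show ?thesis by simp
qed

end

text \<open>The bounds on \<open>lim_lmgf\<close> were obtained as limits along growing dimensions,
  so \<open>ex\<close> provides a sequence for each density. Relative to
  \<open>2 * sqrt (L / b)\<close> they are \<open>sqrt ((L - 2) / L)\<close> and
  \<open>sqrt ((L + 1) / L)\<close>.\<close>

lemma lim_dual_asymp:
  assumes ex: "\<And>b. 0 < b \<Longrightarrow> b < 1 \<Longrightarrow> \<exists>m k. proportional m k b"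
  shows "((\<lambda>b. lim_dual b / (2 * sqrt (1 / b * ln (1 / b)))) \<longlongrightarrow> 1) (at_right 0)"
proof (rule tendsto_sandwich)
  let ?L = "\<lambda>b::real. ln (1 / b)"
  have L: "filterlim ?L at_top (at_right 0)" by real_asymp
  have "\<forall>\<^sub>F x in at_top. 5 / 2 \<le> x \<and> 2 * sqrt (x - 2) \<le> - sqrt (2 * x) / 2 + 2 * (sqrt (2 * x - 4) - 1)"
  proof -
    \<comment> \<open>With \<open>141 / 100 \<le> sqrt 2 \<le> 142 / 100\<close> the coefficients
      are \<open>2 * 1.41 - 2 = 0.82\<close> and \<open>1.42 / 2 = 0.71\<close>; the positive
      difference is a rational form of \<open>3 / sqrt 2 > 2\<close>.\<close>
    have "\<forall>\<^sub>F x::real in at_top. 0 \<le> 82 / 100 * sqrt (x - 2) - 71 / 100 * sqrt x - 2" by real_asymp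
    then show ?thesis using eventually_ge_at_top[of "5 / 2"]
    proof eventually_elim
      case (elim x)
      have "141 / 100 \<le> sqrt 2" by (rule real_le_rsqrt) (simp add: power2_eq_square)
      moreover have "sqrt 2 \<le> 142 / 100" by (rule real_le_lsqrt) (simp_all add: power2_eq_square)
      ultimately have uv: "141 / 100 * sqrt (x - 2) \<le> sqrt 2 * sqrt (x - 2)"
        and wy: "sqrt 2 * sqrt x \<le> 142 / 100 * sqrt x"
        using elim(2) by (auto intro!: mult_right_mono)
      have "2 * x - 4 = 2 * (x - 2)" by simp
      then have eq: "sqrt (2 * x - 4) = sqrt 2 * sqrt (x - 2)" "sqrt (2 * x) = sqrt 2 * sqrt x"
        by (simp_all only: real_sqrt_mult)
      have "2 * u \<le> - w / 2 + 2 * (v - 1)"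
        if "141 / 100 * u \<le> v" "w \<le> 142 / 100 * y" "0 \<le> 82 / 100 * u - 71 / 100 * y - 2" for u v w y :: real
        using that by simp
      from this[OF uv wy elim(1)] elim(2) show ?case unfolding eq by blast
    qed
  qed
  from eventually_compose_filterlim[OF this L]
  have large: "\<forall>\<^sub>F b in at_right 0. 5 / 2 \<le> ?L b \<and> 2 * sqrt (?L b - 2) \<le> - sqrt (2 * ?L b) / 2 + 2 * (sqrt (2 * ?L b - 4) - 1)" .
  have small: "\<forall>\<^sub>F b in at_right 0. 0 < b \<and> b < (1::real)"
    using eventually_at_right_real[of 0 1] by simp
  show "\<forall>\<^sub>F b in at_right 0. sqrt ((?L b - 2) / ?L b) \<le> lim_dual b / (2 * sqrt (1 / b * ?L b))"
    using large small
  proof eventually_elim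
    case (elim b)
    then obtain m k where "proportional m k b" using ex by blast
    then interpret proportional m k b .
    have "2 * sqrt ((?L b - 2) / b) / (2 * sqrt (1 / b * ?L b)) \<le> lim_dual b / (2 * sqrt (1 / b * ?L b))"
      using b L_pos elim by (intro divide_right_mono lim_dual_ge) auto
    also have "2 * sqrt ((?L b - 2) / b) / (2 * sqrt (1 / b * ?L b)) = sqrt ((?L b - 2) / ?L b)"
      using b by (simp add: real_sqrt_divide)
    finally show ?case .
  qed
  show "\<forall>\<^sub>F b in at_right 0. lim_dual b / (2 * sqrt (1 / b * ?L b)) \<le> sqrt ((?L b + 1) / ?L b)"
    using small
  proof eventually_elim
    case (elim b)
    then obtain m k where "proportional m k b" using ex by blast
    then interpret proportional m k b .
    have "lim_dual b / (2 * sqrt (1 / b * ?L b)) \<le> 2 * sqrt ((?L b + 1) / b) / (2 * sqrt (1 / b * ?L b))"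
      using b L_pos by (intro divide_right_mono lim_dual_le) auto
    also have "\<dots> = sqrt ((?L b + 1) / ?L b)"
      using b by (simp add: real_sqrt_divide)
    finally show ?case .
  qed
  show "((\<lambda>b. sqrt ((?L b - 2) / ?L b)) \<longlongrightarrow> 1) (at_right 0)" by real_asymp
  show "((\<lambda>b. sqrt ((?L b + 1) / ?L b)) \<longlongrightarrow> 1) (at_right 0)" by real_asymp
qed

theorem corollary4:
  fixes m k1 k2 :: "real \<Rightarrow> nat \<Rightarrow> nat"
    and M :: "real \<Rightarrow> nat \<Rightarrow> 'a measure"
    and A :: "real \<Rightarrow> nat \<Rightarrow> nat \<Rightarrow> nat \<Rightarrow> 'a \<Rightarrow> real"
  assumes pos: "\<And>\<beta> n. \<beta> \<in> {0<..<1} \<Longrightarrow> n \<ge> 1 \<Longrightarrow> 0 < m \<beta> n \<and> 0 < k1 \<beta> n \<and> 0 < k2 \<beta> n"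
    and le: "\<And>\<beta> n. \<beta> \<in> {0<..<1} \<Longrightarrow> n \<ge> 1 \<Longrightarrow> k1 \<beta> n \<le> m \<beta> n \<and> k2 \<beta> n \<le> n"
    and lim_m: "\<And>\<beta>. \<beta> \<in> {0<..<1} \<Longrightarrow> (\<lambda>n. real (m \<beta> n) / real n) \<longlonglongrightarrow> 1"
    and lim_k1: "\<And>\<beta>. \<beta> \<in> {0<..<1} \<Longrightarrow> (\<lambda>n. real (k1 \<beta> n) / real n) \<longlonglongrightarrow> \<beta>"
    and lim_k2: "\<And>\<beta>. \<beta> \<in> {0<..<1} \<Longrightarrow> (\<lambda>n. real (k2 \<beta> n) / real n) \<longlonglongrightarrow> \<beta>"
    and prob: "\<And>\<beta> n. \<beta> \<in> {0<..<1} \<Longrightarrow> n \<ge> 1 \<Longrightarrow> prob_space (M \<beta> n)"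
    and indep: "\<And>\<beta> n. \<beta> \<in> {0<..<1} \<Longrightarrow> n \<ge> 1 \<Longrightarrow>
      prob_space.indep_vars (M \<beta> n) (\<lambda>_. borel) (\<lambda>(i, j). A \<beta> n i j) ({1..m \<beta> n} \<times> {1..n})"
    and normal: "\<And>\<beta> n i j. \<beta> \<in> {0<..<1} \<Longrightarrow> n \<ge> 1 \<Longrightarrow> i \<in> {1..m \<beta> n} \<Longrightarrow> j \<in> {1..n} \<Longrightarrow>
      distributed (M \<beta> n) lborel (A \<beta> n i j) (\<lambda>x. ennreal (std_normal_density x))"
  defines "dual \<equiv> \<lambda>\<beta> n. sqrt (real n) * lifted_dual (m \<beta> n) n (k1 \<beta> n) (k2 \<beta> n)"
    and "mean \<equiv> \<lambda>\<beta> n. sqrt (real n) *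
      (\<integral>\<omega>. largest_avg_submatrix (m \<beta> n) n (k1 \<beta> n) (k2 \<beta> n) (\<lambda>i j. A \<beta> n i j \<omega>) \<partial>M \<beta> n)"
  shows "(\<forall>\<beta>\<in>{0<..<1}. convergent (dual \<beta>)) \<and>
    ((\<lambda>\<beta>. lim (dual \<beta>) / (2 * sqrt (1 / \<beta> * ln (1 / \<beta>)))) \<longlongrightarrow> 1) (at_right 0) \<and>
    (\<forall>\<beta>\<in>{0<..<1}. limsup (\<lambda>n. ereal (mean \<beta> n)) \<le> ereal (lim (dual \<beta>))) \<and>
    Limsup (at_right 0)
      (\<lambda>\<beta>. limsup (\<lambda>n. ereal (mean \<beta> n)) / ereal (2 * sqrt (1 / \<beta> * ln (1 / \<beta>)))) \<le> 1"
proof -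
  have prop1: "proportional (m \<beta>) (k1 \<beta>) \<beta>" if "\<beta> \<in> {0<..<1}" for \<beta>
    by unfold_locales (use that pos le lim_m lim_k1 in auto)
  have prop2: "proportional (\<lambda>n. n) (k2 \<beta>) \<beta>" if "\<beta> \<in> {0<..<1}" for \<beta>
  proof unfold_locales
    \<comment> \<open>Only eventually, since \<open>0 / 0 = 0\<close> at
      \<open>n = 0\<close>.\<close>
    have "\<forall>\<^sub>F n in sequentially. 1 = real n / real n"
      using eventually_gt_at_top[of 0] by eventually_elim simp
    then show "(\<lambda>n. real n / real n) \<longlonglongrightarrow> 1" by (rule Lim_transform_eventually[OF tendsto_const])
  qed (use that pos le lim_k2 in auto)
  have dual: "dual \<beta> \<longlonglongrightarrow> lim_dual \<beta>" if "\<beta> \<in> {0<..<1}" for \<beta>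
    unfolding dual_def by (rule lifted_dual_tendsto[OF prop1[OF that] prop2[OF that]])
  have lim: "lim (dual \<beta>) = lim_dual \<beta>" if "\<beta> \<in> {0<..<1}" for \<beta>
    by (rule limI[OF dual[OF that]])
  let ?x = "\<lambda>\<beta>. 2 * sqrt (1 / \<beta> * ln (1 / \<beta>))"
  have small: "\<forall>\<^sub>F \<beta> in at_right 0. \<beta> \<in> {0<..<1::real}"
    by (rule eventually_at_right_real) simp
  have asymp: "((\<lambda>\<beta>. lim_dual \<beta> / ?x \<beta>) \<longlongrightarrow> 1) (at_right 0)"
    by (rule lim_dual_asymp) (use prop1 in auto)
  have mean_le: "mean \<beta> n \<le> dual \<beta> n" if "\<beta> \<in> {0<..<1}" "1 \<le> n" for \<beta> n
    unfolding mean_def dual_def using pos[OF that] le[OF that]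
    by (intro mult_left_mono expectation_largest_avg_submatrix_le prob indep normal that) auto
  have limsup: "limsup (\<lambda>n. ereal (mean \<beta> n)) \<le> ereal (lim_dual \<beta>)" if "\<beta> \<in> {0<..<1}" for \<beta>
  proof -
    have "limsup (\<lambda>n. ereal (mean \<beta> n)) \<le> limsup (\<lambda>n. ereal (dual \<beta> n))"
      using mean_le[OF that] by (intro Limsup_mono eventually_mono[OF eventually_ge_at_top[of 1]]) auto
    also have "\<dots> = ereal (lim_dual \<beta>)"
      by (rule lim_imp_Limsup) (use dual[OF that] in auto)
    finally show ?thesis .
  qed
  have "Limsup (at_right 0) (\<lambda>\<beta>. limsup (\<lambda>n. ereal (mean \<beta> n)) / ereal (?x \<beta>))
      \<le> Limsup (at_right 0) (\<lambda>\<beta>. ereal (lim_dual \<beta> / ?x \<beta>))"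
  proof (rule Limsup_mono)
    show "\<forall>\<^sub>F \<beta> in at_right 0. limsup (\<lambda>n. ereal (mean \<beta> n)) / ereal (?x \<beta>) \<le> ereal (lim_dual \<beta> / ?x \<beta>)"
      using small
    proof eventually_elim
      case (elim \<beta>)
      \<comment> \<open>The normaliser is a positive real on \<open>(0, 1)\<close>, so dividing by
        it preserves the inequality between extended reals.\<close>
      then have "0 < 1 / \<beta> * ln (1 / \<beta>)" by (intro mult_pos_pos ln_gt_zero) auto
      then have "0 < ?x \<beta>" by simp
      then have "limsup (\<lambda>n. ereal (mean \<beta> n)) / ereal (?x \<beta>) \<le> ereal (lim_dual \<beta>) / ereal (?x \<beta>)"
        using limsup[OF elim] by (intro ereal_divide_right_mono) auto
      also have "ereal r / ereal y = ereal (r / y)" if "0 < y" for r y using that by simp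
      from this[OF \<open>0 < ?x \<beta>\<close>] have "ereal (lim_dual \<beta>) / ereal (?x \<beta>) = ereal (lim_dual \<beta> / ?x \<beta>)" .
      finally show ?case .
    qed
  qed
  also have "\<dots> = ereal 1"
    by (rule lim_imp_Limsup) (use asymp in auto)
  finally have Lim: "Limsup (at_right 0) (\<lambda>\<beta>. limsup (\<lambda>n. ereal (mean \<beta> n)) / ereal (?x \<beta>)) \<le> 1"
    by (simp add: one_ereal_def)
  have "((\<lambda>\<beta>. lim (dual \<beta>) / ?x \<beta>) \<longlongrightarrow> 1) (at_right 0)"
    by (rule Lim_transform_eventually[OF asymp]) (use small lim in \<open>auto elim!: eventually_mono\<close>)
  moreover have "convergent (dual \<beta>)" if "\<beta> \<in> {0<..<1}" for \<beta>
    by (rule convergentI[OF dual[OF that]])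
  ultimately show ?thesis using lim limsup Lim by simp
qed

end
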